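(* Let $q$ be a prime power, let $R=R'_{2,2}=\mathbb{F}_q[[T]]+T\,\mathbb{F}_{q^2}[[T]]$ and let $n\in\mathbb{Z}_{\ge 0}$. Then, with $t:=q^{-s}$, $$\widehat{\zeta}_{R,n}(s)=\sum_{i\geq j\geq 0} (-1)^j\, q^{-(i^2+ij+j)}\, {n \brack i}_{q^{-1}}\,\frac{(q^{2i};q^{-2})_j }{(q^{-1};q^{-1})_j\, (t^2 q^{-2};q^{-2})_i}\; t^{i+j}.$$
   Context: Here $R'_{2,2}$ is the subring of $\mathbb{F}_{q^2}[[T]]$ consisting of the power series whose constant term lies in $\mathbb{F}_q$. For a commutative ring $R$ and an $R$-module $M$ having finitely many submodules of each finite index, the Quot (lattice) zeta function is the formal Dirichlet series $\zeta_M^R(s)=\sum_{L\subseteq_R M}(M:L)^{-s}$, the sum being over all $R$-submodules $L$ of $M$ of finite index $(M:L)=|M/L|$. The finitized Coh zeta function is $\widehat{\zeta}_{R,n}(s):=\zeta_{R^n}^R(s+n)$, where $R^n=R^{\oplus n}$. Dirichlet series are formal, and rational expressions in $t=q^{-s}$ are expanded as power series in $t$. Notation: $(a;x)_k=\prod_{l=0}^{k-1}(1-ax^l)$ for $k\ge0$; ${n\brack k}_x=\frac{(x;x)_n}{(x;x)_k(x;x)_{n-k}}$ for $0\le k\le n$, and ${n\brack k}_x=0$ if $k<0$ or $k>n$. In particular the sum in the claim is finite (terms with $i>n$ vanish). *)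

theory Defs
  imports
    "HOL-Algebra.Algebra"
    "HOL-Computational_Algebra.Formal_Power_Series"
    "HOL-Number_Theory.Prime_Powers"
begin

section \<open>Rings and free modules\<close>

definition ring_on :: "'a::comm_ring_1 set \<Rightarrow> 'a ring" where
  "ring_on S = \<lparr>carrier = S, monoid.mult = (*), monoid.one = 1, ring.zero = 0, add = (+)\<rparr>"

text \<open>
  The ring \<open>k[[T]] + T K[[T]]\<close>, where \<open>K\<close> is the field of all elements of the type and \<open>k\<close>
  is a subfield.
\<close>

definition R22 :: "'a::field set \<Rightarrow> 'a fps ring" where
  "R22 k = ring_on {f. fps_nth f 0 \<in> k}"

text \<open>
  The record type of modules extends that of rings, so the fields \<open>mult\<close> and \<open>one\<close> must
  be filled in. They play no role for the module structure.
\<close>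

definition free_module :: "('a, 'b) ring_scheme \<Rightarrow> nat \<Rightarrow> ('a, nat \<Rightarrow> 'a) module" where
  "free_module R n =
    \<lparr>carrier = {..<n} \<rightarrow>\<^sub>E carrier R,
     monoid.mult = (\<lambda>x y. \<lambda>i\<in>{..<n}. x i \<otimes>\<^bsub>R\<^esub> y i),
     monoid.one = (\<lambda>i\<in>{..<n}. \<one>\<^bsub>R\<^esub>),
     ring.zero = (\<lambda>i\<in>{..<n}. \<zero>\<^bsub>R\<^esub>),
     ring.add = (\<lambda>x y. \<lambda>i\<in>{..<n}. x i \<oplus>\<^bsub>R\<^esub> y i),
     smult = (\<lambda>a x. \<lambda>i\<in>{..<n}. a \<otimes>\<^bsub>R\<^esub> x i)\<rparr>"


section \<open>Formal Dirichlet series and lattice zeta functions\<close>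

text \<open>
  The formal Dirichlet series \<open>\<Sum>m\<ge>1. a m * m\<^sup>-\<^sup>s\<close> is represented by its coefficient function
  \<open>a\<close>, with the convention \<open>a 0 = 0\<close>.
\<close>

type_synonym dirichlet = "nat \<Rightarrow> rat"

definition finite_index_submodules ::
    "('a, 'b) ring_scheme \<Rightarrow> ('a, 'c, 'd) module_scheme \<Rightarrow> nat \<Rightarrow> 'c set set" where
  "finite_index_submodules R M m =
    {L. submodule L R M \<and> finite (a_rcosets\<^bsub>M\<^esub> L) \<and> card (a_rcosets\<^bsub>M\<^esub> L) = m}"

definition quot_zeta :: "('a, 'b) ring_scheme \<Rightarrow> ('a, 'c, 'd) module_scheme \<Rightarrow> dirichlet" where
  "quot_zeta R M = (\<lambda>m. of_nat (card (finite_index_submodules R M m)))"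

text \<open>The substitution \<open>s \<mapsto> s + n\<close>: it replaces \<open>m\<^sup>-\<^sup>s\<close> by \<open>m\<^sup>-\<^sup>n * m\<^sup>-\<^sup>s\<close>.\<close>

definition dirichlet_shift :: "nat \<Rightarrow> dirichlet \<Rightarrow> dirichlet" where
  "dirichlet_shift n a = (\<lambda>m. a m / of_nat m ^ n)"

definition coh_zeta :: "('a, 'b) ring_scheme \<Rightarrow> nat \<Rightarrow> dirichlet" where
  "coh_zeta R n = dirichlet_shift n (quot_zeta R (free_module R n))"

text \<open>
  The substitution \<open>t = q\<^sup>-\<^sup>s\<close> for \<open>q \<ge> 2\<close>, under which \<open>t ^ e\<close> becomes the Dirichlet monomial
  \<open>(q ^ e)\<^sup>-\<^sup>s\<close>.
\<close>

definition dirichlet_of_fps :: "nat \<Rightarrow> rat fps \<Rightarrow> dirichlet" where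
  "dirichlet_of_fps q F = (\<lambda>m. if \<exists>e. m = q ^ e then fps_nth F (THE e. m = q ^ e) else 0)"


section \<open>Pochhammer symbols and Gaussian binomials\<close>

definition qpoch :: "'a::comm_ring_1 \<Rightarrow> 'a \<Rightarrow> nat \<Rightarrow> 'a" where
  "qpoch a x k = (\<Prod>l<k. 1 - a * x ^ l)"

definition qbinom :: "'a::field \<Rightarrow> nat \<Rightarrow> nat \<Rightarrow> 'a" where
  "qbinom x n k = (if k \<le> n then qpoch x x n / (qpoch x x k * qpoch x x (n - k)) else 0)"


section \<open>Well-definedness\<close>

lemma ring_on_simps [simp]:
  "carrier (ring_on S) = S" "monoid.mult (ring_on S) = (*)" "monoid.one (ring_on S) = 1"
  "ring.zero (ring_on S) = 0" "ring.add (ring_on S) = (+)"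
  by (simp_all add: ring_on_def)

lemma free_module_simps [simp]:
  "carrier (free_module R n) = {..<n} \<rightarrow>\<^sub>E carrier R"
  "ring.zero (free_module R n) = (\<lambda>i\<in>{..<n}. \<zero>\<^bsub>R\<^esub>)"
  "ring.add (free_module R n) = (\<lambda>x y. \<lambda>i\<in>{..<n}. x i \<oplus>\<^bsub>R\<^esub> y i)"
  "smult (free_module R n) = (\<lambda>a x. \<lambda>i\<in>{..<n}. a \<otimes>\<^bsub>R\<^esub> x i)"
  by (simp_all add: free_module_def)

lemma cring_ring_on:
  assumes "0 \<in> S" "1 \<in> S" "\<And>x. x \<in> S \<Longrightarrow> - x \<in> S"
    and "\<And>x y. x \<in> S \<Longrightarrow> y \<in> S \<Longrightarrow> x + y \<in> S" "\<And>x y. x \<in> S \<Longrightarrow> y \<in> S \<Longrightarrow> x * y \<in> S"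
  shows "cring (ring_on S)"
proof (rule cringI)
  show "abelian_group (ring_on S)"
    by (rule abelian_groupI) (use assms in \<open>auto simp: algebra_simps intro!: bexI[of _ "- _"]\<close>)
  show "Group.comm_monoid (ring_on S)"
    by (rule comm_monoidI) (use assms in \<open>auto simp: algebra_simps\<close>)
qed (auto simp: algebra_simps)

lemma subfield_ring_onD:
  fixes k :: "'a::field set"
  assumes "subfield k (ring_on UNIV)"
  shows "0 \<in> k" "1 \<in> k" "\<And>x. x \<in> k \<Longrightarrow> - x \<in> k"
    and "\<And>x y. x \<in> k \<Longrightarrow> y \<in> k \<Longrightarrow> x + y \<in> k" "\<And>x y. x \<in> k \<Longrightarrow> y \<in> k \<Longrightarrow> x * y \<in> k"
proof -
  interpret U: cring "ring_on (UNIV :: 'a set)"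
    by (rule cring_ring_on) auto
  interpret K: subfield k "ring_on (UNIV :: 'a set)" by fact
  have neg: "\<ominus>\<^bsub>ring_on UNIV\<^esub> x = - x" for x :: 'a
    by (rule U.minus_equality) auto
  note sr = K.subring_axioms
  show "0 \<in> k" "1 \<in> k" "\<And>x. x \<in> k \<Longrightarrow> - x \<in> k"
    and "\<And>x y. x \<in> k \<Longrightarrow> y \<in> k \<Longrightarrow> x + y \<in> k" "\<And>x y. x \<in> k \<Longrightarrow> y \<in> k \<Longrightarrow> x * y \<in> k"
    using subringE[OF sr] neg by auto
qed

lemma cring_R22:
  assumes "subfield k (ring_on UNIV)"
  shows "cring (R22 k)"
  unfolding R22_def
  by (rule cring_ring_on) (use subfield_ring_onD[OF assms] in auto)

lemma module_free_module:
  assumes "cring R"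
  shows "module R (free_module R n)"
proof -
  interpret cring R by fact
  show ?thesis
  proof (rule moduleI)
    show "abelian_group (free_module R n)"
    proof (rule abelian_groupI)
      fix x assume x: "x \<in> carrier (free_module R n)"
      show "\<exists>y\<in>carrier (free_module R n).
          y \<oplus>\<^bsub>free_module R n\<^esub> x = \<zero>\<^bsub>free_module R n\<^esub>"
        by (rule bexI[of _ "\<lambda>i\<in>{..<n}. \<ominus>\<^bsub>R\<^esub> x i"])
          (use x in \<open>auto simp: PiE_iff l_neg fun_eq_iff\<close>)
    qed (auto simp: PiE_iff fun_eq_iff a_ac extensional_def)
  qed (auto simp: PiE_iff fun_eq_iff l_distr r_distr m_assoc extensional_def \<open>cring R\<close>)
qed

lemma module_R22:
  assumes "subfield k (ring_on UNIV)"
  shows "module (R22 k) (free_module (R22 k) n)"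
  by (intro module_free_module cring_R22 assms)

text \<open>
  The finiteness that makes \<^term>\<open>quot_zeta\<close> meaningful here: without it the cardinality in its
  definition could be that of an infinite set.
\<close>

lemma finite_finite_index_submodules:
  fixes k :: "'a::{field,finite} set"
  assumes "subfield k (ring_on UNIV)"
  shows "finite (finite_index_submodules (R22 k) (free_module (R22 k) n) m)"
proof -
  define R where "R = R22 k"
  define M where "M = free_module R n"
  note kD = subfield_ring_onD[OF assms]
  interpret module R M
    unfolding R_def M_def by (rule module_R22[OF assms])
  have cR: "f \<in> carrier R \<longleftrightarrow> fps_nth f 0 \<in> k" for f
    by (simp add: R_def R22_def)
  have mR: "a \<otimes>\<^bsub>R\<^esub> b = a * b" "a \<oplus>\<^bsub>R\<^esub> b = a + b" for a b
    by (simp_all add: R_def R22_def)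
  define sm where "sm a x = (\<lambda>i\<in>{..<n}. a * x i)" for a :: "'a fps" and x :: "nat \<Rightarrow> 'a fps"
  have sm: "a \<odot>\<^bsub>M\<^esub> x = sm a x" for a x
    by (simp add: M_def mR sm_def)
  have XR: "fps_X ^ i \<in> carrier R" for i
    using kD by (cases i) (auto simp: cR)
  have smM: "sm a x \<in> carrier M" if "a \<in> carrier R" "x \<in> carrier M" for a x
    using smult_closed[OF that] by (simp add: sm)
  define \<phi> where "\<phi> x = (\<lambda>i\<in>{..<n}. \<lambda>d\<in>{..m}. fps_nth (x i) d)" for x :: "nat \<Rightarrow> 'a fps"
  define A where "A = ({..<n} \<rightarrow>\<^sub>E {..m} \<rightarrow>\<^sub>E (UNIV :: 'a set))"
  have finA: "finite A"
    unfolding A_def by (intro finite_PiE) auto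
  have phiA: "\<phi> x \<in> A" for x
    by (auto simp: \<phi>_def A_def)
  define F where "F = finite_index_submodules R M m"
  have key: "L = {x \<in> carrier M. \<phi> x \<in> \<phi> ` L}" if LF: "L \<in> F" for L
  proof -
    have L: "submodule L R M" "finite (a_rcosets\<^bsub>M\<^esub> L)" "card (a_rcosets\<^bsub>M\<^esub> L) = m"
      using LF by (auto simp: F_def finite_index_submodules_def)
    interpret L: submodule L R M by fact
    interpret AL: abelian_subgroup L M
      by (rule abelian_subgroupI3)
        (use L.subgroup_axioms M.abelian_group_axioms in \<open>auto intro: additive_subgroup.intro\<close>)
    have LM: "x \<in> carrier M" if "x \<in> L" for x
      using AL.a_subset that by blast
    have Ladd: "(\<lambda>i\<in>{..<n}. x i + y i) \<in> L" if "x \<in> L" "y \<in> L" for x y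
      using AL.a_closed[OF that] by (simp add: M_def mR)
    have Lsm: "sm a x \<in> L" if "a \<in> carrier R" "x \<in> L" for a x
      using L.smult_closed[OF that] by (simp add: sm)
    have XL: "sm (fps_X ^ m) x \<in> L" if x: "x \<in> carrier M" for x
    proof -
      define c where "c i = L +>\<^bsub>M\<^esub> sm (fps_X ^ i) x" for i
      have "c ` {..m} \<subseteq> a_rcosets\<^bsub>M\<^esub> L"
        using M.a_rcosetsI[OF AL.a_subset smM[OF XR x]] by (auto simp: c_def)
      hence "card (c ` {..m}) \<le> m"
        using L(2,3) card_mono by metis
      hence "\<not> inj_on c {..m}"
        using card_image[of c "{..m}"] by auto
      then obtain i j where ij: "i < j" "j \<le> m" "c i = c j"
        by (metis (no_types, lifting) atMost_iff inj_onI linorder_neqE_nat)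
      have "sm (fps_X ^ i) x \<in> L +>\<^bsub>M\<^esub> sm (fps_X ^ j) x"
        using AL.a_rcos_self[OF smM[OF XR x, of i]] ij(3) by (simp add: c_def)
      then obtain h where h: "h \<in> L"
        "sm (fps_X ^ i) x = h \<oplus>\<^bsub>M\<^esub> sm (fps_X ^ j) x"
        by (auto simp: a_r_coset_def')
      have hi: "h l = (fps_X ^ i - fps_X ^ j) * x l" if "l < n" for l
        using fun_cong[OF h(2), of l] that by (simp add: M_def mR sm_def algebra_simps)
      define v :: "'a fps" where "v = 1 - fps_X ^ (j - i)"
      have v0: "fps_nth v 0 = 1" using ij(1) by (simp add: v_def)
      define u where "u = fps_X ^ (m - i) * inverse v"
      have "inverse v \<in> carrier R" using kD v0 by (simp add: cR)
      hence uR: "u \<in> carrier R"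
        unfolding u_def using XR[of "m - i"] kD(5) by (auto simp: cR)
      have "(fps_X :: 'a fps) ^ i - fps_X ^ j = fps_X ^ i * v"
        using ij(1) by (simp add: v_def right_diff_distrib flip: power_add)
      moreover have "inverse v * v = 1" using v0 by (intro inverse_mult_eq_1) simp
      moreover have "(fps_X :: 'a fps) ^ (m - i) * fps_X ^ i = fps_X ^ m"
        using ij by (simp flip: power_add)
      ultimately have ue: "u * (fps_X ^ i - fps_X ^ j) = fps_X ^ m"
        unfolding u_def by (simp add: mult.assoc mult.left_commute mult.commute)
      have "sm u h = sm (fps_X ^ m) x"
        using ue by (auto simp: sm_def hi fun_eq_iff simp flip: mult.assoc)
      thus ?thesis using Lsm[OF uR h(1)] by simp
    qed
    have "y \<in> L" if y: "y \<in> carrier M" "\<phi> y = \<phi> x" and x: "x \<in> L" for x y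
    proof -
      have eq: "fps_nth (y i) d = fps_nth (x i) d" if "i < n" "d \<le> m" for i d
        using fun_cong[OF fun_cong[OF y(2), of i], of d] that by (simp add: \<phi>_def)
      define z where "z = (\<lambda>i\<in>{..<n}. fps_shift m (y i - x i))"
      have z: "z \<in> carrier M"
        using eq kD(1) by (auto simp: z_def M_def cR)
      have "fps_X ^ m * fps_shift m (y i - x i) = y i - x i" if "i < n" for i
        by (rule fps_ext) (use eq[OF that] in \<open>auto simp: fps_X_power_mult_nth\<close>)
      hence "(\<lambda>i\<in>{..<n}. x i + sm (fps_X ^ m) z i) = y"
        using y(1) by (auto simp: sm_def z_def M_def PiE_iff extensional_def fun_eq_iff)
      thus ?thesis using Ladd[OF x XL[OF z]] by simp
    qed
    thus ?thesis using LM by blast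
  qed
  have "inj_on ((`) \<phi>) F"
  proof (rule inj_onI)
    fix L L' assume L: "L \<in> F" "L' \<in> F" "\<phi> ` L = \<phi> ` L'"
    show "L = L'"
      by (subst key[OF L(1)], subst key[OF L(2)], subst L(3)) (rule refl)
  qed
  moreover have "((`) \<phi>) ` F \<subseteq> Pow A" using phiA by auto
  hence "finite (((`) \<phi>) ` F)" using finA finite_subset by blast
  ultimately have "finite F" using finite_imageD by blast
  thus ?thesis by (simp add: F_def M_def R_def)
qed

end

theory Submission
  imports Defs "HOL-Library.Function_Algebras"
begin

text \<open>
  Write \<open>K\<close> for the field with \<open>q^2\<close> elements, \<open>k\<close> for its subfield with \<open>q\<close> elements, \<open>S = K[[T]]\<close>
  and \<open>R = k + T S\<close>. Let \<open>L\<close> be a submodule of finite index in \<open>R^a \<oplus> S^b\<close>, and consider a coordinate with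
  values in \<open>R\<close>. If it takes a unit value on \<open>L\<close>, then \<open>L\<close> is an extension of \<open>R\<close> by its kernel \<open>L'\<close>,
  and the extensions of a given \<open>L'\<close> correspond to the cosets of \<open>L'\<close>. Otherwise the coordinate lies
  in \<open>T S\<close>, and division by \<open>T\<close> gives a submodule of \<open>R^(a-1) \<oplus> S^(b+1)\<close>. The solution of this recursion
  is \<open>A_n(t) = (\<Sum>i. [n,i]_q t^i B_i(q^(n-i) t))\<close>, where \<open>A_n\<close> and \<open>B_i\<close> count the \<open>R\<close>-submodules of \<open>R^n\<close>
  and \<open>S^i\<close>. Run over \<open>S\<close> instead of \<open>R\<close>, the same argument gives the zeta function of \<open>S^i\<close>, with
  factors \<open>1 / (1 - q^(2l) t^2)\<close> for \<open>l < i\<close>.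

  To compute \<open>B_i\<close>, sort the \<open>R\<close>-submodules \<open>L\<close> of \<open>S^i\<close> by \<open>S L\<close>, which is free of rank \<open>i\<close>. Those with
  \<open>S L = S^i\<close> contain \<open>T S^i\<close> and correspond to the \<open>k\<close>-subspaces of \<open>K^i\<close> that span it over \<open>K\<close>. Projecting
  a subspace along a coordinate line yields a recursion for their number by codimension \<open>j\<close>, with
  solution \<open>q^(j choose 2) (\<Prod>l<j. (q^(2(i-l)) - 1) / (q^(l+1) - 1))\<close>.
\<close>

section \<open>Indices of additive subgroups\<close>

text \<open>The ring \<open>R\<close> is not a principal ideal domain, so its lattices need not be
  free and have no normal form to count. Division by \<open>T\<close> moreover leaves the family of
  the \<open>R^n\<close>: since \<open>T S\<close> lies in \<open>R\<close>, the divided coordinate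
  ranges over all of \<open>S\<close>. This forces the mixed modules
  \<open>R^a \<oplus> S^b\<close>. For their generating functions the recursion reads F(a+1,b)(t) =
  F(a,b)(q t) + t F(a,b+1)(t), where the dilation by \<open>q\<close> records the m cosets of a
  submodule of index m. Over \<open>S\<close> the residue field has q^2 elements and the division
  leads back to the same module, whence the geometric series in t^2. The inclusion of
  \<open>T S\<close> in \<open>R\<close> is also the reason why S L = S^i forces T S^i into L: T S^i
  = (T S) L is contained in R L = L. The shift s + n replaces t by q^(-n) t, so B_i is finally
  evaluated at q^(-i) t, and n survives only in the Gaussian binomial.\<close>

lemma bij_betw_images:
  assumes "\<And>x y. x \<in> A \<Longrightarrow> y \<in> A \<Longrightarrow> f x = f y \<longleftrightarrow> g x = g y"
  obtains h where "bij_betw h (f ` A) (g ` A)"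
proof
  have h: "g (inv_into A f (f x)) = g x" if "x \<in> A" for x
    using assms[of "inv_into A f (f x)" x] that by (simp add: f_inv_into_f inv_into_into)
  show "bij_betw (\<lambda>y. g (inv_into A f y)) (f ` A) (g ` A)"
    unfolding bij_betw_def using h assms by (auto simp: inj_on_def image_image cong: image_cong)
qed

definition add_subgroup :: "'v::ab_group_add set \<Rightarrow> bool" where
  "add_subgroup L \<longleftrightarrow> 0 \<in> L \<and> (\<forall>x\<in>L. \<forall>y\<in>L. x - y \<in> L)"

definition add_coset :: "'v::ab_group_add set \<Rightarrow> 'v \<Rightarrow> 'v set" where
  "add_coset L x = {y. y - x \<in> L}"

text \<open>Finiteness belongs to the notion, so an infinite quotient has no index at all instead of
  the index 0 that the convention for \<open>card\<close> would give.\<close>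

definition has_index :: "'v::ab_group_add set \<Rightarrow> 'v set \<Rightarrow> nat \<Rightarrow> bool" where
  "has_index U L m \<longleftrightarrow> finite (add_coset L ` U) \<and> card (add_coset L ` U) = m"

lemma add_subgroup_zero: "add_subgroup L \<Longrightarrow> 0 \<in> L"
  by (simp add: add_subgroup_def)

lemma add_subgroup_diff: "add_subgroup L \<Longrightarrow> x \<in> L \<Longrightarrow> y \<in> L \<Longrightarrow> x - y \<in> L"
  by (simp add: add_subgroup_def)

lemma add_subgroup_uminus: "add_subgroup L \<Longrightarrow> x \<in> L \<Longrightarrow> - x \<in> L"
  using add_subgroup_diff[of L 0 x] by (simp add: add_subgroup_zero)

lemma add_subgroup_add: "add_subgroup L \<Longrightarrow> x \<in> L \<Longrightarrow> y \<in> L \<Longrightarrow> x + y \<in> L"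
  using add_subgroup_diff[of L x "- y"] by (simp add: add_subgroup_uminus)

lemma add_coset_eq_iff: "add_subgroup L \<Longrightarrow> add_coset L x = add_coset L y \<longleftrightarrow> x - y \<in> L"
proof
  assume L: "add_subgroup L"
  { assume "add_coset L x = add_coset L y"
    moreover have "x \<in> add_coset L x" using L by (simp add: add_coset_def add_subgroup_zero)
    ultimately show "x - y \<in> L" by (simp add: add_coset_def) }
  { assume *: "x - y \<in> L"
    have "z - x \<in> L \<longleftrightarrow> z - y \<in> L" for z
      using add_subgroup_add[OF L _ *, of "z - x"] add_subgroup_diff[OF L _ *, of "z - y"]
      by (auto simp: algebra_simps)
    thus "add_coset L x = add_coset L y" by (simp add: add_coset_def) }
qed


lemma has_index_unique: "has_index U L m \<Longrightarrow> has_index U L m' \<Longrightarrow> m = m'"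
  by (simp add: has_index_def)

lemma has_index_pos: "has_index U L m \<Longrightarrow> U \<noteq> {} \<Longrightarrow> m > 0"
  by (auto simp: has_index_def card_gt_0_iff)

text \<open>The values of \<open>f\<close> serve as names of the cosets: two elements of
  \<open>U\<close> share a value exactly when they share a coset. Only the fibres of
  \<open>f\<close> count.\<close>

lemma has_index_image_iff:
  assumes "add_subgroup L"
    and "\<And>x y. x \<in> U \<Longrightarrow> y \<in> U \<Longrightarrow> x - y \<in> L \<longleftrightarrow> f x = f y"
  shows "has_index U L m \<longleftrightarrow> finite (f ` U) \<and> card (f ` U) = m"
proof -
  obtain h where "bij_betw h (add_coset L ` U) (f ` U)"
    by (rule bij_betw_images[of U "add_coset L" f]) (use assms in \<open>auto simp: add_coset_eq_iff\<close>)
  thus ?thesis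
    unfolding has_index_def using bij_betw_finite bij_betw_same_card by metis
qed

text \<open>The map \<open>f\<close> induces a bijection of the cosets on both sides. Surjectivity
  is asked only modulo \<open>L'\<close> and compatibility only through differences, so one rule
  covers inclusions, reduction modulo \<open>T\<close>, injective linear maps and the map from
  scalars to multiples of a fixed vector.\<close>

lemma has_index_transfer:
  assumes "add_subgroup L" "add_subgroup L'"
    and "\<And>x. x \<in> U \<Longrightarrow> f x \<in> U'"
    and "\<And>y. y \<in> U' \<Longrightarrow> \<exists>x\<in>U. y - f x \<in> L'"
    and "\<And>x y. x \<in> U \<Longrightarrow> y \<in> U \<Longrightarrow> x - y \<in> L \<longleftrightarrow> f x - f y \<in> L'"
  shows "has_index U L m \<longleftrightarrow> has_index U' L' m"
proof -
  have "(\<lambda>x. add_coset L' (f x)) ` U = add_coset L' ` U'"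
  proof (intro equalityI subsetI)
    fix C assume "C \<in> add_coset L' ` U'"
    then obtain y where y: "y \<in> U'" "C = add_coset L' y" by blast
    then obtain x where "x \<in> U" "y - f x \<in> L'" using assms(4) by blast
    thus "C \<in> (\<lambda>x. add_coset L' (f x)) ` U"
      using y add_coset_eq_iff[OF assms(2)] by blast
  qed (use assms(3) in auto)
  thus ?thesis
    using has_index_image_iff[OF assms(1), of U "\<lambda>x. add_coset L' (f x)"] assms(5)
    by (simp add: add_coset_eq_iff[OF assms(2)] has_index_def)
qed

lemma has_index_refl:
  assumes "add_subgroup L"
  shows "has_index L L m \<longleftrightarrow> m = 1"
proof -
  have "L \<noteq> {}" using assms add_subgroup_zero by auto
  hence "(\<lambda>x. ()) ` L = {()}" by auto
  moreover have "has_index L L m \<longleftrightarrow> finite ((\<lambda>x. ()) ` L) \<and> card ((\<lambda>x. ()) ` L) = m"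
    by (rule has_index_image_iff[OF assms]) (simp add: add_subgroup_diff[OF assms])
  ultimately show ?thesis by (simp only:) auto
qed


text \<open>Tower law: with chosen representatives \<open>r\<close> of \<open>U\<close> modulo
  \<open>M\<close> and \<open>s\<close> of \<open>M\<close> modulo \<open>L\<close>, the sums
  \<open>r C + s D\<close> meet every coset of \<open>L\<close> in \<open>U\<close> exactly
  once.\<close>

lemma has_index_mult:
  assumes L: "add_subgroup L" and M: "add_subgroup M" and U: "add_subgroup U"
    and sub: "L \<subseteq> M" "M \<subseteq> U" and "has_index U M a" "has_index M L b"
  shows "has_index U L (a * b)"
proof -
  define r where "r = inv_into U (add_coset M)"
  define s where "s = inv_into M (add_coset L)"
  have r: "r C \<in> U" "add_coset M (r C) = C" if "C \<in> add_coset M ` U" for C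
    using that by (auto simp: r_def inv_into_into f_inv_into_f)
  have s: "s D \<in> M" "add_coset L (s D) = D" if "D \<in> add_coset L ` M" for D
    using that by (auto simp: s_def inv_into_into f_inv_into_f)
  let ?f = "\<lambda>(C, D). add_coset L (r C + s D)"
  have "bij_betw ?f (add_coset M ` U \<times> add_coset L ` M) (add_coset L ` U)"
    unfolding bij_betw_def
  proof
    show "inj_on ?f (add_coset M ` U \<times> add_coset L ` M)"
    proof (rule inj_onI; clarify)
      fix x y d e assume *: "x \<in> U" "y \<in> U" "d \<in> M" "e \<in> M"
        "add_coset L (r (add_coset M x) + s (add_coset L d)) = add_coset L (r (add_coset M y) + s (add_coset L e))"
      define C D C' D' where "C = add_coset M x" and "D = add_coset L d" and "C' = add_coset M y"
        and "D' = add_coset L e"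
      have mem: "C \<in> add_coset M ` U" "D \<in> add_coset L ` M" "C' \<in> add_coset M ` U" "D' \<in> add_coset L ` M"
        using * by (auto simp: C_def D_def C'_def D'_def)
      have eq: "(r C + s D) - (r C' + s D') \<in> L"
        using * by (simp add: add_coset_eq_iff[OF L] C_def D_def C'_def D'_def)
      have "s D - s D' \<in> M"
        by (rule add_subgroup_diff[OF M s(1)[OF mem(2)] s(1)[OF mem(4)]])
      from add_subgroup_diff[OF M subsetD[OF sub(1) eq] this] have "r C - r C' \<in> M"
        by (simp add: algebra_simps)
      hence "C = C'" by (simp flip: add_coset_eq_iff[OF M] add: r(2) mem)
      moreover from this have "s D - s D' \<in> L" using eq by simp
      hence "D = D'" by (simp flip: add_coset_eq_iff[OF L] add: s(2) mem)
      ultimately show "add_coset M x = add_coset M y \<and> add_coset L d = add_coset L e"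
        by (simp add: C_def D_def C'_def D'_def)
    qed
    show "?f ` (add_coset M ` U \<times> add_coset L ` M) = add_coset L ` U"
    proof (intro equalityI subsetI)
      fix z assume "z \<in> ?f ` (add_coset M ` U \<times> add_coset L ` M)"
      then obtain C D where "C \<in> add_coset M ` U" "D \<in> add_coset L ` M" "z = add_coset L (r C + s D)" by auto
      thus "z \<in> add_coset L ` U"
        using add_subgroup_add[OF U r(1) subsetD[OF sub(2) s(1)]] by simp
    next
      fix z assume "z \<in> add_coset L ` U"
      then obtain x where x: "x \<in> U" "z = add_coset L x" by auto
      define C where "C = add_coset M x"
      have C: "C \<in> add_coset M ` U" using x by (simp add: C_def)
      have xM: "x - r C \<in> M"
        using r(2)[OF C] by (simp flip: add_coset_eq_iff[OF M] add: C_def)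
      define D where "D = add_coset L (x - r C)"
      have D: "D \<in> add_coset L ` M" using xM by (simp add: D_def)
      have "x - r C - s D \<in> L"
        using s(2)[OF D] by (simp flip: add_coset_eq_iff[OF L] add: D_def)
      hence "z = add_coset L (r C + s D)" using x by (simp add: add_coset_eq_iff[OF L] algebra_simps)
      thus "z \<in> ?f ` (add_coset M ` U \<times> add_coset L ` M)" using C D by auto
    qed
  qed
  from bij_betw_finite[OF this] bij_betw_same_card[OF this] show ?thesis
    using assms(6,7) by (auto simp: has_index_def card_cartesian_product)
qed

lemma has_index_factor:
  assumes L: "add_subgroup L" and M: "add_subgroup M" and U: "add_subgroup U"
    and sub: "L \<subseteq> M" "M \<subseteq> U" and fin: "has_index U L m"
  obtains a b where "has_index U M a" "has_index M L b" "m = a * b"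
proof -
  have finU: "finite (add_coset L ` U)" using fin by (simp add: has_index_def)
  have "finite (add_coset L ` M)" using finite_subset[OF image_mono[OF sub(2)] finU] .
  moreover have "add_coset M ` U = (\<lambda>C. add_coset M (inv_into U (add_coset L) C)) ` add_coset L ` U"
  proof -
    have "add_coset M (inv_into U (add_coset L) (add_coset L x)) = add_coset M x" if "x \<in> U" for x
    proof -
      have "add_coset L (inv_into U (add_coset L) (add_coset L x)) = add_coset L x"
        using that by (intro f_inv_into_f) blast
      thus ?thesis
        using sub(1) by (auto simp: add_coset_eq_iff[OF M] add_coset_eq_iff[OF L])
    qed
    thus ?thesis unfolding image_image by (intro image_cong) auto
  qed
  from this finite_imageI[OF finU] have "finite (add_coset M ` U)" by simp
  ultimately obtain a b where ab: "has_index U M a" "has_index M L b" by (auto simp: has_index_def)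
  show ?thesis
    by (rule that[OF ab has_index_unique[OF fin has_index_mult[OF L M U sub ab]]])
qed

text \<open>Lagrange's theorem, obtained from the tower law for
  \<open>{0} \<subseteq> L \<subseteq> U\<close>. The product form avoids a division of natural
  numbers.\<close>

lemma has_index_finite_iff:
  assumes "add_subgroup L" "add_subgroup U" "L \<subseteq> U" "finite U"
  shows "has_index U L m \<longleftrightarrow> card U = m * card L"
proof -
  have zero: "has_index Y {0} n \<longleftrightarrow> finite Y \<and> card Y = n" for Y :: "'a set" and n
    using has_index_image_iff[of "{0}" Y "\<lambda>x. x"] by (simp add: add_subgroup_def)
  have finL: "finite L" using assms finite_subset by blast
  have L0: "card L > 0" using finL add_subgroup_zero[OF assms(1)] card_gt_0_iff by blast
  obtain m' where m': "has_index U L m'" using assms(4) by (auto simp: has_index_def)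
  have "has_index U {0} (m' * card L)"
    by (rule has_index_mult[OF _ assms(1,2) _ assms(3) m'])
      (use finL zero assms in \<open>auto simp: add_subgroup_def\<close>)
  hence "card U = m' * card L" using zero by blast
  thus ?thesis using m' has_index_unique L0 by (metis mult_right_cancel not_gr_zero)
qed

section \<open>Submodules of function spaces\<close>

definition scal :: "'r::comm_ring_1 \<Rightarrow> ('i \<Rightarrow> 'r) \<Rightarrow> 'i \<Rightarrow> 'r" where
  "scal c x = (\<lambda>i. c * x i)"

lemma scal_apply [simp]: "scal c x i = c * x i"
  by (simp add: scal_def)

lemma scal_simps [simp]: "scal 0 x = 0" "scal c 0 = 0" "scal 1 x = x" "scal (- c) x = - scal c x"
  by (auto simp: fun_eq_iff)

lemma scal_distribs:
  "scal c (x + y) = scal c x + scal c y" "scal c (x - y) = scal c x - scal c y"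
  "scal (c + d) x = scal c x + scal d x" "scal (c - d) x = scal c x - scal d x"
  by (auto simp: fun_eq_iff algebra_simps)

lemma scal_scal: "scal c (scal d x) = scal (c * d) x"
  by (auto simp: fun_eq_iff algebra_simps)

text \<open>Vectors are functions on the whole index type that vanish off \<open>B\<close>. Modules
  of different ranks then share one type, the pointwise group structure applies, and a coordinate
  submodule is a subset.\<close>

definition supported :: "'i set \<Rightarrow> ('i \<Rightarrow> 'r::zero) set" where
  "supported B = {x. \<forall>i. i \<notin> B \<longrightarrow> x i = 0}"

text \<open>The scalars form a mere subset of the ambient ring, so the same set of vectors can be
  viewed over \<open>k\<close> and over the whole field, or over \<open>R\<close> and over
  \<open>S\<close>.\<close>

definition submod :: "'r::comm_ring_1 set \<Rightarrow> ('i \<Rightarrow> 'r) set \<Rightarrow> bool" where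
  "submod S L \<longleftrightarrow> add_subgroup L \<and> (\<forall>c\<in>S. \<forall>x\<in>L. scal c x \<in> L)"

lemma submod_add_subgroup: "submod S L \<Longrightarrow> add_subgroup L"
  by (simp add: submod_def)

lemma submod_zero: "submod S L \<Longrightarrow> 0 \<in> L"
  by (simp add: submod_def add_subgroup_zero)

lemma submod_diff: "submod S L \<Longrightarrow> x \<in> L \<Longrightarrow> y \<in> L \<Longrightarrow> x - y \<in> L"
  by (simp add: submod_def add_subgroup_diff)

lemma submod_add: "submod S L \<Longrightarrow> x \<in> L \<Longrightarrow> y \<in> L \<Longrightarrow> x + y \<in> L"
  by (simp add: submod_def add_subgroup_add)

lemma submod_scal: "submod S L \<Longrightarrow> c \<in> S \<Longrightarrow> x \<in> L \<Longrightarrow> scal c x \<in> L"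
  by (simp add: submod_def)

lemma submodI:
  assumes "0 \<in> L" "\<And>x y. x \<in> L \<Longrightarrow> y \<in> L \<Longrightarrow> x - y \<in> L"
    "\<And>c x. c \<in> S \<Longrightarrow> x \<in> L \<Longrightarrow> scal c x \<in> L"
  shows "submod S L"
  using assms by (simp add: submod_def add_subgroup_def)

lemma submod_Int: "submod S L \<Longrightarrow> submod S M \<Longrightarrow> submod S (L \<inter> M)"
  by (auto simp: submod_def add_subgroup_def)

lemma submod_mono: "submod S L \<Longrightarrow> S' \<subseteq> S \<Longrightarrow> submod S' L"
  by (auto simp: submod_def)

lemma submod_supported: "submod S (supported B)"
  by (rule submodI) (auto simp: supported_def)

lemma submod_zero_set: "submod S {0}"
  by (rule submodI) auto

section \<open>Extensions of a submodule by one vector\<close>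

locale scalar_ring =
  fixes S :: "'r::comm_ring_1 set"
  assumes zero_mem: "0 \<in> S" and one_mem: "1 \<in> S"
    and diff_mem: "\<And>a b. a \<in> S \<Longrightarrow> b \<in> S \<Longrightarrow> a - b \<in> S"
    and mult_mem: "\<And>a b. a \<in> S \<Longrightarrow> b \<in> S \<Longrightarrow> a * b \<in> S"
begin

lemma uminus_mem: "a \<in> S \<Longrightarrow> - a \<in> S"
  using diff_mem[of 0 a] zero_mem by simp


definition adjoin :: "('i \<Rightarrow> 'r) set \<Rightarrow> ('i \<Rightarrow> 'r) \<Rightarrow> ('i \<Rightarrow> 'r) set" where
  "adjoin L v = {x. \<exists>c\<in>S. x - scal c v \<in> L}"

lemma submod_adjoin:
  assumes "submod S L"
  shows "submod S (adjoin L v)"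
proof (rule submodI)
  show "0 \<in> adjoin L v"
    using submod_zero[OF assms] zero_mem by (auto simp: adjoin_def intro: bexI[of _ 0])
next
  fix x y assume "x \<in> adjoin L v" "y \<in> adjoin L v"
  then obtain c d where "c \<in> S" "x - scal c v \<in> L" "d \<in> S" "y - scal d v \<in> L"
    by (auto simp: adjoin_def)
  thus "x - y \<in> adjoin L v"
    using submod_diff[OF assms, of "x - scal c v" "y - scal d v"] diff_mem[of c d]
    by (auto simp: adjoin_def scal_distribs algebra_simps intro!: bexI[of _ "c - d"])
next
  fix a x assume "a \<in> S" "x \<in> adjoin L v"
  then obtain c where "c \<in> S" "x - scal c v \<in> L" by (auto simp: adjoin_def)
  thus "scal a x \<in> adjoin L v"
    using submod_scal[OF assms \<open>a \<in> S\<close>, of "x - scal c v"] mult_mem[OF \<open>a \<in> S\<close>, of c]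
    by (auto simp: adjoin_def scal_distribs scal_scal intro!: bexI[of _ "a * c"])
qed

lemma adjoin_superset: "L \<subseteq> adjoin L v"
  using zero_mem by (auto simp: adjoin_def intro!: bexI[of _ 0])

lemma adjoin_self: "submod S L \<Longrightarrow> v \<in> adjoin L v"
  using one_mem submod_zero by (auto simp: adjoin_def intro!: bexI[of _ 1])

lemma adjoin_subset:
  assumes "submod S M" "L \<subseteq> M" "v \<in> M"
  shows "adjoin L v \<subseteq> M"
proof
  fix x assume "x \<in> adjoin L v"
  then obtain c where "c \<in> S" "x - scal c v \<in> L" by (auto simp: adjoin_def)
  thus "x \<in> M"
    using submod_add[OF assms(1), of "x - scal c v" "scal c v"] submod_scal[OF assms(1)] assms
    by auto
qed

text \<open>When \<open>v\<close> is free modulo \<open>Y\<close>, these are the submodules of Y + S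
  v that have kernel \<open>W\<close> and full image under the projection to the coefficient of
  \<open>v\<close>.\<close>

definition extensions ::
    "('i \<Rightarrow> 'r) set \<Rightarrow> ('i \<Rightarrow> 'r) set \<Rightarrow> ('i \<Rightarrow> 'r) \<Rightarrow> ('i \<Rightarrow> 'r) set set" where
  "extensions Y W v =
    {L. submod S L \<and> L \<subseteq> adjoin Y v \<and> L \<inter> Y = W \<and> (\<exists>y\<in>Y. y + v \<in> L)}"

context
  fixes Y W :: "('i \<Rightarrow> 'r) set" and v :: "'i \<Rightarrow> 'r"
  assumes Y: "submod S Y" and W: "submod S W" and WY: "W \<subseteq> Y"
    and free: "\<And>c. c \<in> S \<Longrightarrow> scal c v \<in> Y \<Longrightarrow> c = 0"
begin

lemma extension_coset:
  assumes "L \<in> extensions Y W v" "y \<in> Y" "y + v \<in> L"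
  shows "{z\<in>Y. z + v \<in> L} = add_coset W y"
proof -
  have L: "submod S L" "L \<inter> Y = W" using assms by (auto simp: extensions_def)
  have "z - y \<in> W" if "z \<in> Y" "z + v \<in> L" for z
    using that assms submod_diff[OF L(1), of "z + v" "y + v"] submod_diff[OF Y] L(2) by auto
  moreover have "z \<in> Y \<and> z + v \<in> L" if "z - y \<in> W" for z
    using that submod_add[OF L(1), of "z - y" "y + v"] submod_add[OF Y, of "z - y" y] assms L(2)
    by auto
  ultimately show ?thesis by (auto simp: add_coset_def)
qed

lemma extension_eq_adjoin:
  assumes "L \<in> extensions Y W v" "y \<in> Y" "y + v \<in> L"
  shows "L = adjoin W (y + v)"
proof
  have L: "submod S L" "L \<subseteq> adjoin Y v" "L \<inter> Y = W" using assms by (auto simp: extensions_def)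
  show "adjoin W (y + v) \<subseteq> L" using L assms by (intro adjoin_subset) auto
  show "L \<subseteq> adjoin W (y + v)"
  proof
    fix x assume x: "x \<in> L"
    then obtain c where c: "c \<in> S" "x - scal c v \<in> Y" using L by (auto simp: adjoin_def)
    have "x - scal c (y + v) \<in> L"
      using submod_diff[OF L(1) x submod_scal[OF L(1) c(1) assms(3)]] .
    moreover have "x - scal c (y + v) \<in> Y"
      using submod_diff[OF Y c(2) submod_scal[OF Y c(1) assms(2)]]
      by (simp add: scal_distribs algebra_simps)
    ultimately show "x \<in> adjoin W (y + v)" using c L by (auto simp: adjoin_def)
  qed
qed

lemma adjoin_in_extensions:
  assumes "y \<in> Y"
  shows "adjoin W (y + v) \<in> extensions Y W v"
proof -
  have "y + v \<in> adjoin Y v"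
    using assms one_mem by (auto simp: adjoin_def intro!: bexI[of _ 1])
  hence "adjoin W (y + v) \<subseteq> adjoin Y v"
    using WY adjoin_superset[of Y v] by (intro adjoin_subset submod_adjoin Y) auto
  moreover have "adjoin W (y + v) \<inter> Y \<subseteq> W"
  proof
    fix x assume x: "x \<in> adjoin W (y + v) \<inter> Y"
    then obtain c where c: "c \<in> S" "x - scal c (y + v) \<in> W" by (auto simp: adjoin_def)
    \<comment> \<open>The left-hand side equals \<open>scal c v\<close>, so freeness of
      \<open>v\<close> modulo \<open>Y\<close> applies.\<close>
    have "x - (x - scal c (y + v)) - scal c y \<in> Y"
      by (intro submod_diff[OF Y] subsetD[OF WY c(2)] submod_scal[OF Y c(1) assms])
        (use x in auto)
    hence "c = 0" using free c by (simp add: scal_distribs)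
    thus "x \<in> W" using c by simp
  qed
  ultimately show ?thesis
    using WY adjoin_superset[of W "y + v"] adjoin_self[OF W, of "y + v"] assms submod_adjoin[OF W]
    by (auto simp: extensions_def)
qed

text \<open>An extension is W + S (y + v) for any \<open>y\<close> in \<open>Y\<close> with
  \<open>y + v\<close> in it. Two such \<open>y\<close> differ by an element of
  \<open>L \<inter> Y = W\<close>, so exactly a coset of \<open>W\<close> in \<open>Y\<close> is
  determined, and every coset occurs.\<close>

lemma bij_betw_extensions:
  "bij_betw (\<lambda>L. {y\<in>Y. y + v \<in> L}) (extensions Y W v) (add_coset W ` Y)"
  unfolding bij_betw_def
proof
  have hit: "\<exists>y\<in>Y. y + v \<in> L" if "L \<in> extensions Y W v" for L
    using that by (auto simp: extensions_def)
  show "inj_on (\<lambda>L. {y\<in>Y. y + v \<in> L}) (extensions Y W v)"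
  proof (rule inj_onI)
    fix L L' assume *: "L \<in> extensions Y W v" "L' \<in> extensions Y W v" "{y\<in>Y. y + v \<in> L} = {y\<in>Y. y + v \<in> L'}"
    obtain y where "y \<in> Y" "y + v \<in> L" using hit[OF *(1)] by blast
    moreover from this have "y + v \<in> L'" using *(3) by blast
    ultimately show "L = L'" using extension_eq_adjoin * by metis
  qed
  show "(\<lambda>L. {y\<in>Y. y + v \<in> L}) ` extensions Y W v = add_coset W ` Y"
  proof (intro equalityI subsetI)
    fix C assume "C \<in> (\<lambda>L. {y\<in>Y. y + v \<in> L}) ` extensions Y W v"
    thus "C \<in> add_coset W ` Y" using hit extension_coset by fast
  next
    fix C assume "C \<in> add_coset W ` Y"
    then obtain y where y: "y \<in> Y" "C = add_coset W y" by blast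
    have "{z\<in>Y. z + v \<in> adjoin W (y + v)} = C"
      using extension_coset[OF adjoin_in_extensions y(1) adjoin_self[OF W]] y by simp
    thus "C \<in> (\<lambda>L. {y\<in>Y. y + v \<in> L}) ` extensions Y W v" using adjoin_in_extensions[OF y(1)] by blast
  qed
qed

lemma card_extensions:
  assumes "has_index Y W m"
  shows "finite (extensions Y W v) \<and> card (extensions Y W v) = m"
  using bij_betw_finite[OF bij_betw_extensions] bij_betw_same_card[OF bij_betw_extensions] assms
  by (simp add: has_index_def)

text \<open>The inclusion of \<open>Y\<close> induces the bijection of quotients: \<open>L\<close>
  contains some \<open>y + v\<close>, hence meets every coset of \<open>Y\<close>, and it meets
  \<open>Y\<close> itself in \<open>W\<close>.\<close>

lemma has_index_extension:
  assumes "L \<in> extensions Y W v"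
  shows "has_index (adjoin Y v) L m \<longleftrightarrow> has_index Y W m"
proof -
  have L: "submod S L" "L \<inter> Y = W" using assms by (auto simp: extensions_def)
  obtain y where y: "y \<in> Y" "y + v \<in> L" using assms by (auto simp: extensions_def)
  have "has_index Y W m \<longleftrightarrow> has_index (adjoin Y v) L m"
  proof (rule has_index_transfer[where f = "\<lambda>x. x"])
    fix x assume "x \<in> adjoin Y v"
    then obtain c where c: "c \<in> S" "x - scal c v \<in> Y" by (auto simp: adjoin_def)
    show "\<exists>z\<in>Y. x - z \<in> L"
    proof (rule bexI)
      \<comment> \<open>The element subtracted from \<open>x\<close> is x - c (y + v), which lies in
        \<open>Y\<close> and is congruent to \<open>x\<close> modulo \<open>L\<close>.\<close>
      show "x - (x - scal c v - scal c y) \<in> L"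
        using submod_scal[OF L(1) c(1) y(2)] by (simp add: scal_distribs add.commute)
      show "x - scal c v - scal c y \<in> Y"
        using submod_diff[OF Y c(2) submod_scal[OF Y c(1) y(1)]] .
    qed
  qed (use adjoin_superset[of Y v] submod_diff[OF Y] L submod_add_subgroup[OF W]
      submod_add_subgroup[OF L(1)] in auto)
  thus ?thesis by simp
qed

end

end

text \<open>The ambient ring is only commutative, and inverses are asked for inside
  \<open>S\<close>. Thus the constants within a power series ring form an instance, and lattices
  become vector spaces over them.\<close>

locale finite_scalar_field = scalar_ring S for S :: "'r::comm_ring_1 set" +
  assumes finite_scalars: "finite S"
    and inverse_mem: "\<And>a. a \<in> S \<Longrightarrow> a \<noteq> 0 \<Longrightarrow> \<exists>b\<in>S. b * a = 1"
begin

lemma card_scalars: "card S \<ge> 2" if "(0::'r) \<noteq> 1"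
  using card_mono[OF finite_scalars, of "{0, 1}"] zero_mem one_mem that by auto

lemma scal_mem_iff:
  assumes "submod S L" "c \<in> S" "c \<noteq> 0"
  shows "scal c x \<in> L \<longleftrightarrow> x \<in> L"
proof
  obtain b where b: "b \<in> S" "b * c = 1" using inverse_mem assms by blast
  show "x \<in> L" if "scal c x \<in> L"
    using submod_scal[OF assms(1) b(1) that] b(2) by (simp add: scal_scal)
qed (use submod_scal[OF assms(1,2)] in auto)

lemma has_index_adjoin:
  assumes L: "submod S L" and v: "v \<notin> L"
  shows "has_index (adjoin L v) L (card S)"
proof -
  have 1: "has_index S {0} (card S)"
    using has_index_image_iff[of "{0}" S "\<lambda>x. x"] finite_scalars by (simp add: add_subgroup_def)
  have "has_index S {0} (card S) \<longleftrightarrow> has_index (adjoin L v) L (card S)"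
  proof (rule has_index_transfer[where f = "\<lambda>c. scal c v"])
    fix c d assume "c \<in> S" "d \<in> S"
    hence "scal (c - d) v \<in> L \<longleftrightarrow> c - d = 0"
      using scal_mem_iff[OF L, of "c - d" v] v submod_zero[OF L] diff_mem by auto
    thus "c - d \<in> {0} \<longleftrightarrow> scal c v - scal d v \<in> L" by (simp add: scal_distribs)
  next
    fix c assume "c \<in> S"
    thus "scal c v \<in> adjoin L v"
      using submod_zero[OF L] by (auto simp: adjoin_def intro!: bexI[of _ c])
  next
    show "add_subgroup {0::'r}" by (simp add: add_subgroup_def)
  qed (use submod_add_subgroup[OF L] in \<open>auto simp: adjoin_def\<close>)
  with 1 show ?thesis by simp
qed

text \<open>Induction on the index instead of on a dimension, since \<open>U\<close> may be
  infinite: adjoining a vector outside \<open>L\<close> divides the index by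
  \<open>card S\<close>.\<close>

lemma has_index_power:
  assumes "(0::'r) \<noteq> 1" "submod S U" "submod S L" "L \<subseteq> U" "has_index U L m"
  shows "\<exists>e. m = card S ^ e"
  using assms(3-5)
proof (induction m arbitrary: L rule: less_induct)
  case (less m L)
  show ?case
  proof (cases "L = U")
    case True
    thus ?thesis
      using less.prems has_index_refl[OF submod_add_subgroup[OF assms(2)]] by (auto intro: exI[of _ 0])
  next
    case False
    then obtain v where v: "v \<in> U" "v \<notin> L" using less.prems by blast
    have sub: "adjoin L v \<subseteq> U" by (rule adjoin_subset[OF assms(2) less.prems(2) v(1)])
    note M = submod_adjoin[OF less.prems(1), of v]
    obtain a b where ab: "has_index U (adjoin L v) a" "has_index (adjoin L v) L b" "m = a * b"
      using has_index_factor[OF submod_add_subgroup[OF less.prems(1)] submod_add_subgroup[OF M]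
          submod_add_subgroup[OF assms(2)] adjoin_superset sub less.prems(3)] by blast
    have b: "b = card S" using has_index_unique[OF ab(2) has_index_adjoin[OF less.prems(1) v(2)]] .
    have "a > 0" using has_index_pos[OF ab(1)] v by blast
    hence "a < m" using ab(3) b card_scalars[OF assms(1)] by simp
    then obtain e where "a = card S ^ e" using less.IH M sub ab(1) by blast
    hence "m = card S ^ Suc e" using ab(3) b by simp
    thus ?thesis by blast
  qed
qed

text \<open>A submodule that is maximal among those with property \<open>P\<close> must be
  \<open>V\<close>, since otherwise one more vector could be adjoined. This replaces the choice of a
  basis.\<close>

lemma finite_submod_induct [consumes 2, case_names zero adjoin]:
  assumes V: "submod S V" "finite V"
    and zero: "P {0}"
    and step: "\<And>U v. submod S U \<Longrightarrow> adjoin U v \<subseteq> V \<Longrightarrow> v \<notin> U \<Longrightarrow> P U \<Longrightarrow> P (adjoin U v)"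
  shows "P V"
proof -
  define F where "F = {U. submod S U \<and> U \<subseteq> V \<and> P U}"
  have "finite F" using finite_subset[of F "Pow V"] V by (auto simp: F_def)
  moreover have "{0} \<in> F" using submod_zero_set submod_zero[OF V(1)] zero by (auto simp: F_def)
  ultimately obtain U where U: "U \<in> F" "\<And>M. M \<in> F \<Longrightarrow> U \<subseteq> M \<Longrightarrow> M = U"
    using finite_has_maximal[of F] by blast
  have "U = V"
  proof (rule ccontr)
    assume "U \<noteq> V"
    then obtain v where v: "v \<in> V" "v \<notin> U" using U by (auto simp: F_def)
    have U': "submod S U" "U \<subseteq> V" "P U" using U by (auto simp: F_def)
    have "adjoin U v \<subseteq> V" using adjoin_subset[OF V(1)] U' v by blast
    hence "adjoin U v \<in> F" using step U' v submod_adjoin by (auto simp: F_def)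
    thus False using U(2) adjoin_superset adjoin_self[OF U'(1)] v by blast
  qed
  thus ?thesis using U by (auto simp: F_def)
qed

end

section \<open>Subspaces over finite fields\<close>

definition proj :: "'i \<Rightarrow> ('i \<Rightarrow> 'r::zero) \<Rightarrow> 'i \<Rightarrow> 'r" where
  "proj p x = x(p := 0)"

lemma proj_simps [simp]:
  "proj p (x + y) = proj p x + proj p y" "proj p (x - y) = proj p x - proj p y"
  "proj p (scal c x) = scal c (proj p x)" "proj p 0 = 0"
  for x y :: "'i \<Rightarrow> 'r::comm_ring_1"
  by (auto simp: proj_def fun_eq_iff)

lemma proj_id: "p \<notin> B \<Longrightarrow> x \<in> supported B \<Longrightarrow> proj p x = x"
  by (auto simp: proj_def supported_def fun_eq_iff)

lemma proj_eq_0_iff: "proj p x = 0 \<longleftrightarrow> x \<in> supported {p}"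
  by (auto simp: proj_def supported_def fun_eq_iff)

lemma proj_in_supported_iff:
  "p \<notin> B \<Longrightarrow> proj p x \<in> supported B \<longleftrightarrow> x \<in> supported (insert p B)"
  by (auto simp: proj_def supported_def)

lemma submod_proj_image:
  assumes "submod S V"
  shows "submod S (proj p ` V)"
proof (rule submodI)
  show "0 \<in> proj p ` V" using submod_zero[OF assms] by (auto intro: image_eqI[of _ _ 0])
next
  fix x y assume "x \<in> proj p ` V" "y \<in> proj p ` V"
  then obtain a b where "a \<in> V" "x = proj p a" "b \<in> V" "y = proj p b" by auto
  thus "x - y \<in> proj p ` V"
    using submod_diff[OF assms, of a b] by (auto intro!: image_eqI[of _ _ "a - b"])
next
  fix c x assume "c \<in> S" "x \<in> proj p ` V"
  then obtain a where "a \<in> V" "x = proj p a" by auto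
  thus "scal c x \<in> proj p ` V"
    using submod_scal[OF assms \<open>c \<in> S\<close>, of a] by (auto intro!: image_eqI[of _ _ "scal c a"])
qed

lemma submod_proj_vimage:
  assumes "submod S U"
  shows "submod S {x. proj p x \<in> U}"
  by (rule submodI) (use submod_zero[OF assms] submod_diff[OF assms] submod_scal[OF assms] in auto)

lemma finite_supported:
  assumes "finite B"
  shows "finite (supported B :: ('i \<Rightarrow> 'a::{zero,finite}) set)"
    and "card (supported B :: ('i \<Rightarrow> 'a::{zero,finite}) set) = card (UNIV :: 'a set) ^ card B"
proof -
  have *: "bij_betw (\<lambda>x. restrict x B) (supported B :: ('i \<Rightarrow> 'a) set) (B \<rightarrow>\<^sub>E UNIV)"
    by (rule bij_betwI[where g = "\<lambda>x i. if i \<in> B then x i else 0"])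
      (auto simp: supported_def fun_eq_iff PiE_iff extensional_def)
  have "finite (B \<rightarrow>\<^sub>E (UNIV :: 'a set))" using assms by (intro finite_PiE) auto
  thus "finite (supported B :: ('i \<Rightarrow> 'a) set)" using bij_betw_finite[OF *] by simp
  show "card (supported B :: ('i \<Rightarrow> 'a) set) = card (UNIV :: 'a set) ^ card B"
    using bij_betw_same_card[OF *] assms by (simp add: card_PiE)
qed

text \<open>Rank and nullity in multiplicative form: the kernel of the projection on
  \<open>V\<close> is the part of \<open>V\<close> on the coordinate line \<open>p\<close>.\<close>

lemma card_proj_image:
  assumes "submod S V" "finite V"
  shows "card V = card (proj p ` V) * card (V \<inter> supported {p})"
proof -
  have V: "add_subgroup V" and I: "add_subgroup (V \<inter> supported {p})"
    using submod_add_subgroup submod_Int submod_supported assms(1) by blast+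
  have "has_index V (V \<inter> supported {p}) (card (proj p ` V)) \<longleftrightarrow>
      finite (proj p ` V) \<and> card (proj p ` V) = card (proj p ` V)"
    by (rule has_index_image_iff[OF I])
      (use add_subgroup_diff[OF V] in \<open>auto simp flip: proj_eq_0_iff\<close>)
  hence "has_index V (V \<inter> supported {p}) (card (proj p ` V))" using assms(2) by simp
  thus ?thesis using has_index_finite_iff[OF I V] assms(2) by auto
qed

section \<open>Subspaces with prescribed projection and kernel\<close>

definition lifts :: "'r::comm_ring_1 set \<Rightarrow> 'i \<Rightarrow> ('i \<Rightarrow> 'r) set \<Rightarrow> ('i \<Rightarrow> 'r) set \<Rightarrow> ('i \<Rightarrow> 'r) set set"
  where "lifts S p U N = {V. submod S V \<and> proj p ` V = U \<and> V \<inter> supported {p} = N}"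

lemma liftsD:
  "V \<in> lifts S p U N \<Longrightarrow> submod S V" "V \<in> lifts S p U N \<Longrightarrow> proj p ` V = U"
  "V \<in> lifts S p U N \<Longrightarrow> V \<inter> supported {p} = N"
  by (auto simp: lifts_def)

lemma lifts_subset:
  assumes "V \<in> lifts S p U N" "U \<subseteq> supported B" "p \<notin> B"
  shows "V \<subseteq> supported (insert p B)"
  using assms by (auto simp: lifts_def simp flip: proj_in_supported_iff)

lemma finite_lifts:
  fixes U :: "('i \<Rightarrow> 'a::{field,finite}) set"
  assumes "finite B" "U \<subseteq> supported B" "p \<notin> B"
  shows "finite (lifts S p U N)"
proof (rule finite_subset)
  show "lifts S p U N \<subseteq> Pow (supported (insert p B))" using lifts_subset[OF _ assms(2,3)] by blast
qed (use finite_supported(1)[of "insert p B"] assms(1) in simp)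

lemma lifts_zero:
  assumes "submod S N" "N \<subseteq> supported {p}"
  shows "lifts S p {0} N = {N}"
proof -
  have "V = N" if "V \<in> lifts S p {0} N" for V
  proof -
    have "V \<subseteq> supported {p}"
    proof
      fix x assume "x \<in> V"
      hence "proj p x \<in> {0}" using liftsD(2)[OF that] by blast
      thus "x \<in> supported {p}" by (simp flip: proj_eq_0_iff)
    qed
    thus ?thesis using liftsD(3)[OF that] by auto
  qed
  moreover have "proj p x = 0" if "x \<in> N" for x
    using that assms(2) by (auto simp: proj_eq_0_iff)
  hence "proj p ` N = {0}"
    using submod_zero[OF assms(1)] by (simp add: image_constant_conv cong: image_cong) blast
  ultimately show ?thesis using assms by (auto simp: lifts_def)
qed

text \<open>Let Y be the preimage of \<open>U\<close> under the projection. A lift \<open>V\<close>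
  of U + S v cuts out the lift \<open>W = V \<inter> Y\<close> of \<open>U\<close> and is an
  extension of it by \<open>v\<close>, which lies in the image of the projection and is fixed by it.
  Counting lifts thereby reduces to counting extensions.\<close>

lemma (in finite_scalar_field) lifts_adjoin:
  assumes U: "submod S U" and v: "v \<notin> U" "adjoin U v \<subseteq> supported B" "p \<notin> B"
  shows "lifts S p (adjoin U v) N = (\<Union>W\<in>lifts S p U N. extensions {x. proj p x \<in> U} W v)"
proof -
  define Y where "Y = {x. proj p x \<in> U}"
  have Y: "submod S Y" unfolding Y_def by (rule submod_proj_vimage[OF U])
  have NY: "supported {p} \<subseteq> Y"
    using submod_zero[OF U] by (auto simp: Y_def simp flip: proj_eq_0_iff)
  have pv: "proj p v = v" using adjoin_self[OF U, of v] v by (intro proj_id[of p B]) auto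
  have "V \<in> (\<Union>W\<in>lifts S p U N. extensions Y W v)" if V: "V \<in> lifts S p (adjoin U v) N" for V
  proof -
    note V' = liftsD[OF V]
    have "proj p ` (V \<inter> Y) = U"
    proof (intro equalityI subsetI)
      fix u assume u: "u \<in> U"
      hence "u \<in> proj p ` V" using V'(2) adjoin_superset by blast
      thus "u \<in> proj p ` (V \<inter> Y)" using u by (auto simp: Y_def)
    qed (auto simp: Y_def)
    hence "V \<inter> Y \<in> lifts S p U N" using submod_Int[OF V'(1) Y] V'(3) NY by (auto simp: lifts_def)
    moreover have "V \<subseteq> adjoin Y v"
    proof
      fix x assume "x \<in> V"
      hence "proj p x \<in> adjoin U v" using V'(2) by blast
      thus "x \<in> adjoin Y v" by (simp add: adjoin_def Y_def pv)
    qed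
    moreover have "v \<in> proj p ` V" using V'(2) adjoin_self[OF U] by simp
    then obtain x where "x \<in> V" "proj p x = v" by auto
    \<comment> \<open>The vector \<open>x - v\<close> has projection 0 and hence lies in
      \<open>Y\<close>.\<close>
    hence "\<exists>y\<in>Y. y + v \<in> V"
      using submod_zero[OF U] pv by (intro bexI[of _ "x - v"]) (auto simp: Y_def)
    ultimately show ?thesis using V'(1) by (auto simp: extensions_def)
  qed
  moreover have "V \<in> lifts S p (adjoin U v) N"
    if W: "W \<in> lifts S p U N" and V: "V \<in> extensions Y W v" for V W
  proof -
    note W' = liftsD[OF W]
    have V': "submod S V" "V \<subseteq> adjoin Y v" "V \<inter> Y = W" using V by (auto simp: extensions_def)
    obtain y where y: "y \<in> Y" "y + v \<in> V" using V by (auto simp: extensions_def)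
    note P = submod_proj_image[OF V'(1), of p]
    have UP: "U \<subseteq> proj p ` V" using W'(2) V'(3) by auto
    have "proj p (y + v) - proj p y \<in> proj p ` V"
      by (rule submod_diff[OF P]) (use y UP in \<open>auto simp: Y_def simp del: proj_simps\<close>)
    hence "v \<in> proj p ` V" by (simp add: pv)
    hence "adjoin U v \<subseteq> proj p ` V" by (rule adjoin_subset[OF P UP])
    moreover have "proj p ` V \<subseteq> adjoin U v"
    proof (rule image_subsetI)
      fix x assume "x \<in> V"
      hence "x \<in> adjoin Y v" using V'(2) by blast
      thus "proj p x \<in> adjoin U v" by (simp add: adjoin_def Y_def pv)
    qed
    moreover have "V \<inter> supported {p} = N" using NY V'(3) W'(3) by auto
    ultimately show ?thesis using V'(1) by (auto simp: lifts_def)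
  qed
  ultimately show ?thesis unfolding Y_def by blast
qed

text \<open>A lift of \<open>U\<close> amounts to a linear map from \<open>U\<close> to the quotient of a coordinate line by \<open>N\<close>.\<close>

lemma card_lifts:
  fixes U :: "('i \<Rightarrow> 'a::{field,finite}) set"
  assumes "finite_scalar_field S" and U: "submod S U" "U \<subseteq> supported B" "finite B" "p \<notin> B"
    and N: "submod S N" "N \<subseteq> supported {p}" and "card U = card S ^ d"
  shows "card (lifts S p U N) * card N ^ d = card (UNIV :: 'a set) ^ d"
proof -
  interpret finite_scalar_field S by fact
  have S2: "card S \<ge> 2" by (rule card_scalars) simp
  have finU: "finite U" using U finite_supported finite_subset by blast
  have fin_p: "finite (supported {p} :: ('i \<Rightarrow> 'a) set)"
    and card_p: "card (supported {p} :: ('i \<Rightarrow> 'a) set) = card (UNIV :: 'a set)"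
    using finite_supported[of "{p}"] by auto
  \<comment> \<open>Here \<open>m\<close> is the number of elements of the coordinate line modulo
    \<open>N\<close>, that is, the number of possible images of one further basis vector of
    \<open>U\<close>.\<close>
  obtain m where m: "card (UNIV :: 'a set) = m * card N"
    using has_index_finite_iff[OF submod_add_subgroup[OF N(1)] submod_add_subgroup[OF submod_supported] N(2) fin_p]
      card_p fin_p by (auto simp: has_index_def)
  have "\<forall>d. card U = card S ^ d \<longrightarrow> card (lifts S p U N) * card N ^ d = card (UNIV :: 'a set) ^ d"
    using U(1) finU
  proof (induction rule: finite_submod_induct)
    case zero
    show ?case
    proof (intro allI impI)
      fix d assume "card {0 :: 'i \<Rightarrow> 'a} = card S ^ d"
      hence "d = 0" using S2 by (cases d) auto
      thus "card (lifts S p {0} N) * card N ^ d = card (UNIV :: 'a set) ^ d"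
        by (simp add: lifts_zero[OF N])
    qed
  next
    case (adjoin T v)
    have TB: "T \<subseteq> supported B" using adjoin.hyps(2) adjoin_superset U(2) by blast
    have finT: "finite T" using TB finite_supported(1)[OF U(3)] finite_subset by blast
    have AB: "adjoin T v \<subseteq> supported B" using adjoin.hyps(2) U(2) by blast
    have finA: "finite (adjoin T v)" using AB finite_supported(1)[OF U(3)] finite_subset by blast
    have cardA: "card (adjoin T v) = card S * card T"
      using has_index_adjoin[OF adjoin.hyps(1,3)] adjoin_superset finA
        has_index_finite_iff[OF submod_add_subgroup submod_add_subgroup, OF adjoin.hyps(1)
          submod_adjoin[OF adjoin.hyps(1)]] by blast
    define Y where "Y = {x. proj p x \<in> T}"
    have Y: "submod S Y" unfolding Y_def by (rule submod_proj_vimage[OF adjoin.hyps(1)])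
    have "Y \<subseteq> supported (insert p B)"
      using TB U(4) by (auto simp: Y_def simp flip: proj_in_supported_iff)
    hence finY: "finite Y" using finite_supported(1) U(3) finite_subset by blast
    have projT: "proj p x = x" if "x \<in> T" for x using that TB proj_id[OF U(4)] by blast
    have "proj p ` Y = T"
    proof (intro equalityI subsetI)
      fix x assume "x \<in> T"
      thus "x \<in> proj p ` Y" using projT[of x] by (intro image_eqI[of _ _ x]) (auto simp: Y_def)
    qed (auto simp: Y_def)
    moreover have "Y \<inter> supported {p} = supported {p}"
      using submod_zero[OF adjoin.hyps(1)] by (auto simp: Y_def simp flip: proj_eq_0_iff)
    ultimately have cardY: "card Y = card T * card (UNIV :: 'a set)"
      using card_proj_image[OF Y finY, of p] card_p by simp
    \<comment> \<open>The number of extensions is the index of \<open>W\<close> in \<open>Y\<close>.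
      Both have image \<open>T\<close> under the projection, with kernels \<open>N\<close> and the
      whole line, so this index is \<open>m\<close> for every \<open>W\<close>.\<close>
    have ext: "finite (extensions Y W v) \<and> card (extensions Y W v) = m" if W: "W \<in> lifts S p T N" for W
    proof (rule card_extensions[OF Y liftsD(1)[OF W]])
      show WY: "W \<subseteq> Y" using liftsD(2)[OF W] by (auto simp: Y_def)
      have "card W = card T * card N"
        using card_proj_image[OF liftsD(1)[OF W] finite_subset[OF WY finY], of p] liftsD[OF W]
        by simp
      hence "card Y = m * card W" using cardY m by simp
      thus "has_index Y W m"
        using has_index_finite_iff[OF submod_add_subgroup[OF liftsD(1)[OF W]]
            submod_add_subgroup[OF Y] WY finY] by blast
      fix c assume c: "c \<in> S" "scal c v \<in> Y"
      have "proj p v = v"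
        using AB adjoin_self[OF adjoin.hyps(1)] by (intro proj_id[OF U(4)]) auto
      hence "scal c v \<in> T" using c by (simp add: Y_def)
      thus "c = 0" using scal_mem_iff[OF adjoin.hyps(1) c(1)] adjoin.hyps(3) by blast
    qed
    have "card (lifts S p (adjoin T v) N) = card (\<Union>W\<in>lifts S p T N. extensions Y W v)"
      using lifts_adjoin[OF adjoin.hyps(1,3) AB U(4)] by (simp add: Y_def)
    also have "\<dots> = (\<Sum>W\<in>lifts S p T N. card (extensions Y W v))"
      by (rule card_UN_disjoint)
        (use finite_lifts[OF U(3) TB U(4)] ext in \<open>auto simp: extensions_def\<close>)
    also have "\<dots> = card (lifts S p T N) * m" using ext by simp
    finally have card_eq: "card (lifts S p (adjoin T v) N) = card (lifts S p T N) * m" .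
    show ?case
    proof (intro allI impI)
      fix d assume d: "card (adjoin T v) = card S ^ d"
      have "card T > 0" using finT submod_zero[OF adjoin.hyps(1)] card_gt_0_iff by blast
      hence "card S * card T \<noteq> 1" using S2 by simp
      then obtain d' where d': "d = Suc d'" using d cardA by (cases d) auto
      hence "card T = card S ^ d'" using d cardA S2 by (cases "S = {}") auto
      hence "card (lifts S p T N) * card N ^ d' = card (UNIV :: 'a set) ^ d'" using adjoin.IH by blast
      thus "card (lifts S p (adjoin T v) N) * card N ^ d = card (UNIV :: 'a set) ^ d"
        unfolding d' card_eq using m by (simp add: algebra_simps)
    qed
  qed
  thus ?thesis using assms(8) by blast
qed

section \<open>Subspaces spanning over a quadratic extension\<close>

text \<open>Only existence of the decomposition is asked. It is unique for \<open>k\<close> in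
  \<open>K\<close>, but not for \<open>R\<close> in \<open>S\<close>, where \<open>T S\<close> is
  contained in \<open>R\<close>; the locale is used for both pairs.\<close>

locale quadratic_extension = scalar_ring S for S :: "'r::comm_ring_1 set" +
  fixes w :: 'r
  assumes decomp: "\<exists>a\<in>S. \<exists>b\<in>S. c = a + b * w"
begin

text \<open>Because every scalar is \<open>a + b * w\<close> with \<open>a\<close> and
  \<open>b\<close> in \<open>S\<close>, the sum L + w L is already the module generated by
  \<open>L\<close> over the whole ring.\<close>

definition qspan :: "('i \<Rightarrow> 'r) set \<Rightarrow> ('i \<Rightarrow> 'r) set" where
  "qspan L = {x + scal w y |x y. x \<in> L \<and> y \<in> L}"

lemma qspanI: "x \<in> L \<Longrightarrow> y \<in> L \<Longrightarrow> x + scal w y \<in> qspan L"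
  by (auto simp: qspan_def)

lemma qspanE:
  assumes "z \<in> qspan L"
  obtains x y where "x \<in> L" "y \<in> L" "z = x + scal w y"
  using assms by (auto simp: qspan_def)

lemma qspan_superset: "submod S L \<Longrightarrow> L \<subseteq> qspan L"
  using qspanI[of _ L 0] submod_zero by fastforce

lemma submod_qspan:
  assumes "submod S L"
  shows "submod UNIV (qspan L)"
proof -
  have diff: "u - v \<in> qspan L" if uv: "u \<in> qspan L" "v \<in> qspan L" for u v
  proof -
    obtain a b c d where *: "a \<in> L" "b \<in> L" "c \<in> L" "d \<in> L" "u = a + scal w b" "v = c + scal w d"
      using uv by (metis qspanE)
    have "u - v = (a - c) + scal w (b - d)" using * by (simp add: scal_distribs)
    thus ?thesis using * submod_diff[OF assms] qspanI by metis
  qed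
  have 0: "0 \<in> qspan L" using submod_zero[OF assms] qspan_superset[OF assms] by blast
  have scal: "scal c x \<in> qspan L" if x: "x \<in> L" for c x
  proof -
    obtain a b where ab: "a \<in> S" "b \<in> S" "c = a + b * w" using decomp by blast
    hence "scal c x = scal a x + scal w (scal b x)"
      by (simp add: scal_distribs scal_scal mult.commute)
    thus ?thesis using submod_scal[OF assms _ x] ab qspanI by metis
  qed
  show ?thesis
  proof (rule submodI)
    fix c x assume "x \<in> qspan L"
    then obtain a b where ab: "a \<in> L" "b \<in> L" "x = a + scal w b" by (rule qspanE)
    have "scal c x = scal c a - scal (- (c * w)) b"
      using ab by (simp add: scal_distribs scal_scal)
    thus "scal c x \<in> qspan L" using diff[OF scal[OF ab(1)] scal[OF ab(2)]] by metis
  qed (use 0 diff in auto)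
qed

lemma qspan_least:
  assumes "submod UNIV M" "L \<subseteq> M"
  shows "qspan L \<subseteq> M"
proof
  fix z assume "z \<in> qspan L"
  then obtain x y where "x \<in> L" "y \<in> L" "z = x + scal w y" by (rule qspanE)
  thus "z \<in> M" using submod_add[OF assms(1)] submod_scal[OF assms(1)] assms(2) by blast
qed

lemma qspan_image:
  assumes "\<And>x y. x \<in> L \<Longrightarrow> y \<in> L \<Longrightarrow> f (x + scal w y) = f x + scal w (f y)"
  shows "qspan (f ` L) = f ` qspan L"
proof (intro equalityI subsetI)
  fix z assume "z \<in> qspan (f ` L)"
  then obtain x y where xy: "x \<in> L" "y \<in> L" "z = f x + scal w (f y)"
    by (elim qspanE) auto
  hence "z = f (x + scal w y)" using assms by simp
  thus "z \<in> f ` qspan L" using qspanI[OF xy(1,2)] by blast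
next
  fix z assume "z \<in> f ` qspan L"
  then obtain x y where xy: "x \<in> L" "y \<in> L" "z = f (x + scal w y)"
    by (elim imageE qspanE) auto
  hence "z = f x + scal w (f y)" using assms by simp
  thus "z \<in> qspan (f ` L)" using xy by (simp add: qspanI)
qed

end

lemma supported_singletonE:
  fixes x z :: "'i \<Rightarrow> 'a::field"
  assumes "x \<in> supported {p}" "x \<noteq> 0" "z \<in> supported {p}"
  obtains d where "z = scal d x"
proof
  have "x p \<noteq> 0" using assms(1,2) by (auto simp: supported_def fun_eq_iff)
  moreover have "x i = 0" "z i = 0" if "i \<noteq> p" for i
    using assms(1,3) that by (auto simp: supported_def)
  ultimately show "z = scal (z p / x p) x"
    by (intro ext) (metis scal_apply mult_zero_right nonzero_eq_divide_eq)
qed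

lemma submod_UNIV_supported_singleton:
  fixes H :: "('i \<Rightarrow> 'a::field) set"
  assumes "submod UNIV H" "x \<in> H" "x \<in> supported {p}" "x \<noteq> 0"
  shows "supported {p} \<subseteq> H"
  using supported_singletonE[OF assms(3,4)] submod_scal[OF assms(1) UNIV_I assms(2)]
  by (metis subsetI)

lemma submod_eq_supported_insert:
  fixes H :: "('i \<Rightarrow> 'a::field) set"
  assumes "submod UNIV H" "supported {p} \<subseteq> H" "proj p ` H = supported B" "p \<notin> B"
  shows "H = supported (insert p B)"
proof (intro equalityI subsetI)
  fix x assume "x \<in> H"
  hence "proj p x \<in> supported B" using assms(3) by blast
  thus "x \<in> supported (insert p B)" using proj_in_supported_iff[OF assms(4)] by blast
next
  fix x :: "'i \<Rightarrow> 'a" assume "x \<in> supported (insert p B)"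
  hence "proj p x \<in> proj p ` H" using assms(3) proj_in_supported_iff[OF assms(4)] by blast
  then obtain h where h: "h \<in> H" "proj p h = proj p x" by auto
  hence "x - h \<in> supported {p}" by (simp flip: proj_eq_0_iff)
  hence "(x - h) + h \<in> H" using assms(2) h(1) submod_add[OF assms(1)] by blast
  thus "x \<in> H" by simp
qed

lemma finite_scalar_field_UNIV: "finite_scalar_field (UNIV :: 'a::{field,finite} set)"
  by unfold_locales (auto intro: left_inverse)

section \<open>Counting the k-subspaces that span over K\<close>

locale finite_quadratic_extension =
  finite_scalar_field k + quadratic_extension k w for k :: "'a::{field,finite} set" and w +
  assumes card_UNIV: "card (UNIV :: 'a set) = card k ^ 2"
begin

lemma card_k: "card k \<ge> 2"
  by (rule card_scalars) simp

lemma card_supported_sq: "finite B \<Longrightarrow> card (supported B :: ('i \<Rightarrow> 'a) set) = card k ^ (2 * card B)"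
  by (simp add: finite_supported(2) card_UNIV power_mult)

context
  fixes U :: "('i \<Rightarrow> 'a) set" and B p
  assumes U: "submod k U" "qspan U = supported B" and B: "finite B" and p: "p \<notin> B"
begin

lemma U_subset: "U \<subseteq> supported B"
  using qspan_superset[OF U(1)] U(2) by blast

lemma proj_qspan_lift:
  assumes "V \<in> lifts k p U N"
  shows "proj p ` qspan V = supported B"
  using qspan_image[of V "proj p"] liftsD(2)[OF assms] U(2) by simp

text \<open>A nonzero vector of the lift on the line \<open>p\<close> puts the entire line into the
  span, and the projection already spans the other coordinates. Only lifts with kernel 0 can fail to
  span.\<close>

lemma qspan_lift:
  assumes "V \<in> lifts k p U N" "N \<noteq> {0}"
  shows "qspan V = supported (insert p B)"
proof -
  note V = liftsD[OF assms(1)]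
  have "0 \<in> N" using V(1,3) submod_zero by (auto simp: supported_def)
  then obtain x where "x \<in> V" "x \<in> supported {p}" "x \<noteq> 0" using V(3) assms(2) by blast
  thus ?thesis
    using submod_eq_supported_insert[OF submod_qspan[OF V(1)] _ proj_qspan_lift[OF assms(1)] p]
      submod_UNIV_supported_singleton[OF submod_qspan[OF V(1)]] qspan_superset[OF V(1)] by blast
qed

text \<open>If a lift \<open>V\<close> with kernel 0 fails to span, its span H contains no nonzero
  vector of the line \<open>p\<close>, so H is the graph of a K-linear map from
  \<open>supported B\<close> to that line. Conversely \<open>V\<close> is recovered as the part of
  this graph that lies over \<open>U\<close>.\<close>

lemma bij_betw_nonspanning_lifts:
  "bij_betw qspan {V \<in> lifts k p U {0}. qspan V \<noteq> supported (insert p B)}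
     (lifts UNIV p (supported B) {0})"
proof (rule bij_betwI[where g = "\<lambda>H. {x\<in>H. proj p x \<in> U}"])
  show "qspan \<in> {V \<in> lifts k p U {0}. qspan V \<noteq> supported (insert p B)} \<rightarrow>
      lifts UNIV p (supported B) {0}"
  proof
    fix V assume "V \<in> {V \<in> lifts k p U {0}. qspan V \<noteq> supported (insert p B)}"
    hence V: "V \<in> lifts k p U {0}" "qspan V \<noteq> supported (insert p B)" by auto
    note H = submod_qspan[OF liftsD(1)[OF V(1)]]
    have "x = 0" if "x \<in> qspan V" "x \<in> supported {p}" for x
      using submod_eq_supported_insert[OF H _ proj_qspan_lift[OF V(1)] p] V(2)
        submod_UNIV_supported_singleton[OF H that] by blast
    hence "qspan V \<inter> supported {p} = {0}"
      using submod_zero[OF H] by (auto simp: supported_def)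
    thus "qspan V \<in> lifts UNIV p (supported B) {0}"
      using H proj_qspan_lift[OF V(1)] by (simp add: lifts_def)
  qed
next
  have lift: "{x\<in>H. proj p x \<in> U} \<in> lifts k p U {0}" and
    qspan: "qspan {x\<in>H. proj p x \<in> U} = H"
    if "H \<in> lifts UNIV p (supported B) {0}" for H
  proof -
    note H = liftsD[OF that]
    let ?V = "{x\<in>H. proj p x \<in> U}"
    have "?V = H \<inter> {x. proj p x \<in> U}" by auto
    hence V: "submod k ?V"
      using submod_Int[OF submod_mono[OF H(1)] submod_proj_vimage[OF U(1)]] by auto
    have pV: "proj p ` ?V = U"
    proof (intro equalityI subsetI)
      fix u assume u: "u \<in> U"
      hence "u \<in> proj p ` H" using H(2) U_subset by blast
      thus "u \<in> proj p ` ?V" using u by auto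
    qed auto
    have "?V \<inter> supported {p} = {0}"
      using H(3) submod_zero[OF V] by auto
    thus l: "?V \<in> lifts k p U {0}" using V pV by (simp add: lifts_def)
    show "qspan ?V = H"
    proof (intro equalityI subsetI)
      fix h assume h: "h \<in> H"
      hence "proj p h \<in> proj p ` qspan ?V" using H(2) proj_qspan_lift[OF l] by auto
      then obtain g where g: "g \<in> qspan ?V" "proj p h = proj p g" by auto
      moreover have "qspan ?V \<subseteq> H" by (rule qspan_least[OF H(1)]) auto
      ultimately have "h - g \<in> H \<inter> supported {p}"
        using submod_diff[OF H(1) h] by (auto simp flip: proj_eq_0_iff)
      thus "h \<in> qspan ?V" using H(3) g by auto
    next
      have "qspan ?V \<subseteq> H" by (rule qspan_least[OF H(1)]) auto
      thus "h \<in> H" if "h \<in> qspan ?V" for h using that by blast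
    qed
  qed
  show "(\<lambda>H. {x\<in>H. proj p x \<in> U}) \<in> lifts UNIV p (supported B) {0} \<rightarrow>
      {V \<in> lifts k p U {0}. qspan V \<noteq> supported (insert p B)}"
  proof
    fix H :: "('i \<Rightarrow> 'a) set" assume H: "H \<in> lifts UNIV p (supported B) {0}"
    have "(\<lambda>i. if i = p then 1 else 0) \<in> supported (insert p B) \<inter> supported {p}"
      by (simp add: supported_def)
    moreover have "(\<lambda>i. if i = p then 1 else 0 :: 'a) \<noteq> 0" by (auto simp: fun_eq_iff)
    ultimately have "H \<noteq> supported (insert p B)" using liftsD(3)[OF H] by blast
    thus "{x\<in>H. proj p x \<in> U} \<in> {V \<in> lifts k p U {0}. qspan V \<noteq> supported (insert p B)}"
      using lift[OF H] qspan[OF H] by simp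
  qed
  show "qspan {x\<in>H. proj p x \<in> U} = H" if "H \<in> lifts UNIV p (supported B) {0}" for H
    by (rule qspan[OF that])
  fix V assume "V \<in> {V \<in> lifts k p U {0}. qspan V \<noteq> supported (insert p B)}"
  hence V: "V \<in> lifts k p U {0}" "qspan V \<noteq> supported (insert p B)" by auto
  note H = submod_qspan[OF liftsD(1)[OF V(1)]]
  have 0: "x = 0" if "x \<in> qspan V" "x \<in> supported {p}" for x
    using submod_eq_supported_insert[OF H _ proj_qspan_lift[OF V(1)] p] V(2)
      submod_UNIV_supported_singleton[OF H that] by blast
  show "{x \<in> qspan V. proj p x \<in> U} = V"
  proof (intro equalityI subsetI)
    fix x assume x: "x \<in> {x \<in> qspan V. proj p x \<in> U}"
    hence "proj p x \<in> proj p ` V" using liftsD(2)[OF V(1)] by simp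
    then obtain v where v: "v \<in> V" "proj p x = proj p v" by auto
    have "x - v \<in> qspan V"
      using x v qspan_superset[OF liftsD(1)[OF V(1)]] submod_diff[OF H] by blast
    moreover have "x - v \<in> supported {p}" using v(2) by (simp flip: proj_eq_0_iff)
    ultimately have "x - v = 0" by (rule 0)
    thus "x \<in> V" using v by simp
  qed (use qspan_superset[OF liftsD(1)[OF V(1)]] liftsD(2)[OF V(1)] in auto)
qed

text \<open>There are q^((2 - s) d) lifts in all. For \<open>s > 0\<close> each of them spans; for
  \<open>s = 0\<close> the graphs of K-linear maps are discarded, and there are q^(2 |B|) of these.
  The sum in the last claim stands in for a subtraction.\<close>

lemma card_spanning_lifts:
  assumes N: "submod k N" "N \<subseteq> supported {p}" "card N = card k ^ s" and d: "card U = card k ^ d"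
  shows "s = 2 \<Longrightarrow> card {V \<in> lifts k p U N. qspan V = supported (insert p B)} = 1"
    and "s = 1 \<Longrightarrow> card {V \<in> lifts k p U N. qspan V = supported (insert p B)} = card k ^ d"
    and "s = 0 \<Longrightarrow> card {V \<in> lifts k p U N. qspan V = supported (insert p B)} + card k ^ (2 * card B) =
           card k ^ (2 * d)"
proof -
  have q: "card k > 1" using card_k by simp
  have k0: "k \<noteq> {}" using zero_mem by blast
  have count: "card (lifts k p U N) * card N ^ d = card k ^ (2 * d)"
    using card_lifts[OF finite_scalar_field_axioms U(1) U_subset B p N(1,2) d] card_UNIV
    by (simp add: power_mult)
  have all: "{V \<in> lifts k p U N. qspan V = supported (insert p B)} = lifts k p U N" if "s > 0"
  proof -
    have "card N > 1" unfolding N(3) using that q by (intro one_less_power)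
    hence "N \<noteq> {0}" by auto
    thus ?thesis using qspan_lift by blast
  qed
  { assume "s = 2"
    thus "card {V \<in> lifts k p U N. qspan V = supported (insert p B)} = 1"
      using all count N(3) q k0 by (simp add: power_mult) }
  { assume "s = 1"
    thus "card {V \<in> lifts k p U N. qspan V = supported (insert p B)} = card k ^ d"
      using all count N(3) q k0 by (simp add: mult_2 power_add) }
  { assume "s = 0"
    hence "card N = 1" using N(3) by simp
    hence N0: "N = {0}" using submod_zero[OF N(1)] by (auto simp: card_1_singleton_iff)
    \<comment> \<open>The same count of lifts, now with all of \<open>K\<close> as field of scalars
      and \<open>supported B\<close> of dimension \<open>card B\<close>.\<close>
    have "card (lifts UNIV p (supported B :: ('i \<Rightarrow> 'a) set) {0}) * card {0 :: 'i \<Rightarrow> 'a} ^ card B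
        = card (UNIV :: 'a set) ^ card B"
      by (rule card_lifts[OF finite_scalar_field_UNIV submod_supported order_refl B p submod_zero_set])
        (use B in \<open>simp_all add: finite_supported(2) submod_zero[OF submod_supported]\<close>)
    hence "card {V \<in> lifts k p U {0}. qspan V \<noteq> supported (insert p B)} = card k ^ (2 * card B)"
      using bij_betw_same_card[OF bij_betw_nonspanning_lifts] card_UNIV by (simp add: power_mult)
    moreover have "card (lifts k p U {0}) =
        card {V \<in> lifts k p U {0}. qspan V = supported (insert p B)} +
        card {V \<in> lifts k p U {0}. qspan V \<noteq> supported (insert p B)}"
      using finite_lifts[OF B U_subset p]
      by (subst card_Un_disjoint[symmetric]) (auto intro!: arg_cong[where f = card])
    ultimately show "card {V \<in> lifts k p U N. qspan V = supported (insert p B)} + card k ^ (2 * card B) =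
           card k ^ (2 * d)"
      using count N0 by simp }
qed

end

definition subspaces_at :: "'i \<Rightarrow> nat \<Rightarrow> ('i \<Rightarrow> 'a) set set" where
  "subspaces_at p s = {N. submod k N \<and> N \<subseteq> supported {p} \<and> card N = card k ^ s}"

lemma finite_subspaces_at: "finite (subspaces_at p s :: ('i \<Rightarrow> 'a) set set)"
proof (rule finite_subset)
  show "finite (Pow (supported {p} :: ('i \<Rightarrow> 'a) set))" using finite_supported(1)[of "{p}"] by simp
qed (auto simp: subspaces_at_def)

text \<open>The coordinate line has dimension 2 over \<open>k\<close>. Each of its q^2 - 1 nonzero
  vectors lies on exactly one k-line, and a k-line holds q - 1 of them, whence q + 1 lines.\<close>

lemma card_subspaces_at:
  "card (subspaces_at p 0 :: ('i \<Rightarrow> 'a) set set) = 1"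
  "card (subspaces_at p 1 :: ('i \<Rightarrow> 'a) set set) = card k + 1"
  "card (subspaces_at p 2 :: ('i \<Rightarrow> 'a) set set) = 1"
proof -
  let ?E = "supported {p} :: ('i \<Rightarrow> 'a) set"
  have fin: "finite ?E" and cE: "card ?E = card k ^ 2"
    using finite_supported(1)[of "{p}"] card_supported_sq[of "{p}"] by auto
  have "N = {0}" if "N \<in> subspaces_at p 0" for N :: "('i \<Rightarrow> 'a) set"
    using that submod_zero by (fastforce simp: subspaces_at_def card_1_singleton_iff)
  moreover have "{0} \<in> subspaces_at p 0"
    using submod_zero_set by (auto simp: subspaces_at_def supported_def)
  ultimately have "(subspaces_at p 0 :: ('i \<Rightarrow> 'a) set set) = {{0}}" by blast
  thus "card (subspaces_at p 0 :: ('i \<Rightarrow> 'a) set set) = 1" by simp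
  have "N = ?E" if "N \<in> subspaces_at p 2" for N
    using that card_subset_eq[OF fin, of N] cE by (auto simp: subspaces_at_def)
  moreover have "?E \<in> subspaces_at p 2" using submod_supported cE by (auto simp: subspaces_at_def)
  ultimately have "subspaces_at p 2 = {?E}" by blast
  thus "card (subspaces_at p 2 :: ('i \<Rightarrow> 'a) set set) = 1" by simp
  have line: "adjoin {0} x \<in> subspaces_at p 1" if "x \<in> ?E" "x \<noteq> 0" for x
  proof -
    have "adjoin {0} x \<subseteq> ?E"
      by (rule adjoin_subset[OF submod_supported]) (use that in \<open>auto simp: supported_def\<close>)
    moreover from this have "finite (adjoin {0} x)" using fin finite_subset by blast
    hence "card (adjoin {0} x) = card k * card {0 :: 'i \<Rightarrow> 'a}"
      using has_index_adjoin[OF submod_zero_set, of x] that(2) adjoin_superset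
        has_index_finite_iff[OF submod_add_subgroup submod_add_subgroup, OF submod_zero_set
          submod_adjoin[OF submod_zero_set]] by (metis singletonD)
    ultimately show ?thesis using submod_adjoin[OF submod_zero_set] by (auto simp: subspaces_at_def)
  qed
  have eq_line: "N = adjoin {0} x" if "N \<in> subspaces_at p 1" "x \<in> N" "x \<noteq> 0" for N and x :: "'i \<Rightarrow> 'a"
  proof -
    have N: "submod k N" "N \<subseteq> ?E" "card N = card k" using that by (auto simp: subspaces_at_def)
    have "adjoin {0} x \<subseteq> N" by (rule adjoin_subset[OF N(1)]) (use that submod_zero[OF N(1)] in auto)
    moreover have "card (adjoin {0} x) = card N"
      using line[of x] that N by (auto simp: subspaces_at_def)
    ultimately show ?thesis using card_subset_eq[of N] N(2) fin finite_subset by metis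
  qed
  have "?E - {0} = (\<Union>N\<in>subspaces_at p 1. N - {0})"
  proof (intro equalityI subsetI)
    fix x assume "x \<in> ?E - {0}"
    thus "x \<in> (\<Union>N\<in>subspaces_at p 1. N - {0})"
      using line[of x] adjoin_self[OF submod_zero_set, of x] by blast
  qed (auto simp: subspaces_at_def)
  hence "card (?E - {0}) = card (\<Union>N\<in>subspaces_at p 1. N - {0 :: 'i \<Rightarrow> 'a})" by simp
  also have "\<dots> = (\<Sum>N\<in>subspaces_at p 1. card (N - {0 :: 'i \<Rightarrow> 'a}))"
  proof (rule card_UN_disjoint[OF finite_subspaces_at])
    show "\<forall>N\<in>subspaces_at p 1. finite (N - {0 :: 'i \<Rightarrow> 'a})"
      using fin finite_subset by (fastforce simp: subspaces_at_def)
    show "\<forall>N\<in>subspaces_at p 1. \<forall>M\<in>subspaces_at p 1. N \<noteq> M \<longrightarrow>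
        (N - {0 :: 'i \<Rightarrow> 'a}) \<inter> (M - {0}) = {}"
      using eq_line by blast
  qed
  also have "\<dots> = (\<Sum>N\<in>(subspaces_at p 1 :: ('i \<Rightarrow> 'a) set set). card k - 1)"
    by (rule sum.cong) (auto simp: subspaces_at_def submod_zero)
  also have "\<dots> = card (subspaces_at p 1 :: ('i \<Rightarrow> 'a) set set) * (card k - 1)" by simp
  finally have "card k ^ 2 - 1 = card (subspaces_at p 1 :: ('i \<Rightarrow> 'a) set set) * (card k - 1)"
    using cE by (subst (asm) card_Diff_singleton) (simp_all add: submod_zero[OF submod_supported])
  moreover have "card k ^ 2 - 1 = (card k + 1) * (card k - 1)"
    using card_k by (simp add: power2_eq_square algebra_simps)
  ultimately have "card (subspaces_at p 1 :: ('i \<Rightarrow> 'a) set set) * (card k - 1) =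
      (card k + 1) * (card k - 1)" by metis
  moreover have "card k - 1 \<noteq> 0" using card_k by simp
  ultimately show "card (subspaces_at p 1 :: ('i \<Rightarrow> 'a) set set) = card k + 1"
    by (metis mult_right_cancel)
qed

text \<open>The index \<open>j\<close> is the codimension over \<open>k\<close> in a space of
  k-dimension 2 |B|. It is expressed by cardinalities, since no notion of dimension is set
  up.\<close>

definition spanning :: "'i set \<Rightarrow> nat \<Rightarrow> ('i \<Rightarrow> 'a) set set" where
  "spanning B j =
    {V. submod k V \<and> qspan V = supported B \<and> card V * card k ^ j = card k ^ (2 * card B)}"

lemma spanningD:
  assumes "V \<in> spanning B j"
  shows "submod k V" "qspan V = supported B" "card V * card k ^ j = card k ^ (2 * card B)"
    "V \<subseteq> supported B"
  using assms qspan_superset[of V] by (auto simp: spanning_def)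

lemma finite_spanning: "finite B \<Longrightarrow> finite (spanning B j :: ('i \<Rightarrow> 'a) set set)"
  by (rule finite_subset[of _ "Pow (supported B)"]) (use spanningD(4) finite_supported(1) in auto)

lemma card_spanning_member:
  assumes "V \<in> spanning B j"
  shows "j \<le> 2 * card B" "card V = card k ^ (2 * card B - j)"
proof -
  have q: "card k \<ge> 2" by (rule card_k)
  note V = spanningD(3)[OF assms]
  have "card k ^ j dvd card k ^ (2 * card B)" using V by (metis dvd_triv_right)
  thus j: "j \<le> 2 * card B" using q by (simp add: power_dvd_imp_le)
  have "card k ^ (2 * card B) = card k ^ (2 * card B - j) * card k ^ j"
    using j by (simp flip: power_add)
  thus "card V = card k ^ (2 * card B - j)" using V q by (cases "k = {}") auto
qed

lemma spanning_empty: "card (spanning {} j :: ('i \<Rightarrow> 'a) set set) = (if j = 0 then 1 else 0)"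
proof -
  have E: "supported {} = {0 :: 'i \<Rightarrow> 'a}" by (auto simp: supported_def fun_eq_iff)
  have "qspan {0 :: 'i \<Rightarrow> 'a} = {0}" by (auto simp: qspan_def)
  hence "{0 :: 'i \<Rightarrow> 'a} \<in> spanning {} 0"
    using submod_zero_set[of k] by (simp add: E spanning_def)
  moreover have "V = {0} \<and> j = 0" if V: "V \<in> spanning {} j" for V :: "('i \<Rightarrow> 'a) set"
  proof -
    have V0: "V = {0}" using spanningD(4)[OF V] submod_zero[OF spanningD(1)[OF V]] E by blast
    have "card k ^ j = 1" using spanningD(3)[OF V] by (simp add: V0)
    thus ?thesis using V0 card_k by (cases j) auto
  qed
  ultimately have "V \<in> spanning {} j \<longleftrightarrow> j = 0 \<and> V = {0}" for V :: "('i \<Rightarrow> 'a) set" by metis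
  hence "spanning {} j = (if j = 0 then {{0 :: 'i \<Rightarrow> 'a}} else {})" by auto
  thus ?thesis by simp
qed

text \<open>Sort the subspaces by their projection \<open>U\<close> and their kernel
  \<open>N\<close> on the line \<open>p\<close>. If \<open>N\<close> has dimension s, then
  \<open>U\<close> has codimension j + s - 2, and it spans again. The three terms belong to s = 2,
  1, 0; the factor q + 1 counts the choices of \<open>N\<close> for s = 1. Integers allow the
  subtraction for s = 0.\<close>

lemma card_spanning_insert:
  assumes B: "finite B" "p \<notin> B"
  shows "int (card (spanning (insert p B) j :: ('i \<Rightarrow> 'a) set set)) =
      int (card (spanning B j :: ('i \<Rightarrow> 'a) set set))
    + (if j \<ge> 1 then (int (card k) + 1) * int (card (spanning B (j - 1) :: ('i \<Rightarrow> 'a) set set))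
         * int (card k) ^ (2 * card B - (j - 1)) else 0)
    + (if j \<ge> 2 then int (card (spanning B (j - 2) :: ('i \<Rightarrow> 'a) set set))
         * (int (card k) ^ (2 * (2 * card B - (j - 2))) - int (card k) ^ (2 * card B)) else 0)"
proof -
  let ?q = "int (card k)"
  define G where "G U N = {V \<in> lifts k p U N. qspan V = supported (insert p B)}"
    for U N :: "('i \<Rightarrow> 'a) set"
  \<comment> \<open>The guard keeps \<open>j + s - 2\<close> from being truncated: a negative
    codimension would otherwise be read as 0.\<close>
  define I where "I s = (if j + s \<ge> 2 then spanning B (j + s - 2) \<times> subspaces_at p s else {})"
    for s :: nat
  have I_mem: "U \<in> spanning B (j + s - 2) \<and> submod k N \<and> N \<subseteq> supported {p} \<and> card N = card k ^ s"
    if "(U, N) \<in> I s" for U N s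
    using that by (auto simp: I_def subspaces_at_def split: if_splits)
  have finI: "finite (I s)" for s
    using B by (auto simp: I_def intro!: finite_cartesian_product finite_spanning finite_subspaces_at)
  have finG: "finite (G U N)" if "U \<subseteq> supported B" for U N
    using finite_lifts[OF B(1) that B(2)] by (auto simp: G_def)
  have disjG: "G U N \<inter> G U' N' = {}" if "(U, N) \<noteq> (U', N')" for U N U' N'
    using that by (auto simp: G_def lifts_def)
  have cardB: "card (insert p B) = card B + 1" using B by simp
  have q: "card k \<ge> 2" by (rule card_k)
  have "spanning (insert p B) j = (\<Union>(U, N)\<in>(\<Union>s\<in>{0, 1, 2}. I s). G U N)"
  proof (intro equalityI subsetI)
    fix V assume V: "V \<in> spanning (insert p B) j"
    note V' = spanningD[OF V]
    have finV: "finite V" using V'(4) finite_supported(1) B(1) finite_subset by blast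
    define U where "U = proj p ` V"
    define N where "N = V \<inter> supported {p}"
    have VG: "V \<in> G U N" using V'(1,2) by (simp add: G_def U_def N_def lifts_def)
    have "qspan U = proj p ` qspan V" unfolding U_def by (rule qspan_image) simp
    also have "\<dots> = supported B"
    proof (intro equalityI subsetI)
      fix x assume "x \<in> proj p ` qspan V"
      thus "x \<in> supported B" using V'(2) proj_in_supported_iff[OF B(2)] by auto
    next
      fix x :: "'i \<Rightarrow> 'a" assume "x \<in> supported B"
      thus "x \<in> proj p ` qspan V"
        using V'(2) proj_id[OF B(2), of x] by (intro image_eqI[of _ _ x]) (auto simp: supported_def)
    qed
    finally have U: "submod k U" "qspan U = supported B"
      using submod_proj_image[OF V'(1)] by (auto simp: U_def)
    have N: "submod k N" "N \<subseteq> supported {p}"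
      using submod_Int[OF V'(1) submod_supported] by (auto simp: N_def)
    obtain s where s: "card N = card k ^ s"
    proof -
      have "finite (supported {p} :: ('i \<Rightarrow> 'a) set)" by (simp add: finite_supported(1))
      hence "finite N" using N(2) finite_subset by blast
      hence "has_index N {0} (card N)"
        using has_index_finite_iff[OF submod_add_subgroup[OF submod_zero_set] submod_add_subgroup[OF N(1)]]
          submod_zero[OF N(1)] by simp
      thus ?thesis
        using has_index_power[OF _ N(1) submod_zero_set] submod_zero[OF N(1)] that by auto
    qed
    have "card N \<le> card k ^ 2"
      using card_mono[OF finite_supported(1) N(2)] card_supported_sq[of "{p}"] by simp
    hence s2: "s \<le> 2" using s q by (simp add: power_le_imp_le_exp)
    have eq: "card U * card k ^ (s + j) = card k ^ (2 * card B + 2)"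
      using card_proj_image[OF V'(1) finV, of p] V'(3) s cardB
      by (simp add: U_def N_def power_add algebra_simps)
    \<comment> \<open>The size of the ambient space bounds \<open>U\<close>, which rules out a
      negative codimension and gives \<open>2 \<le> s + j\<close>.\<close>
    have "card U \<le> card k ^ (2 * card B)"
      using card_mono[OF finite_supported(1)[OF B(1)] qspan_superset[OF U(1), unfolded U(2)]]
        card_supported_sq[OF B(1)] by simp
    hence "card k ^ (2 * card B + 2) \<le> card k ^ (2 * card B) * card k ^ (s + j)"
      using eq by (metis mult_le_mono1)
    hence "card k ^ (2 * card B + 2) \<le> card k ^ (2 * card B + (s + j))"
      by (simp only: power_add)
    hence "2 * card B + 2 \<le> 2 * card B + (s + j)"
      by (rule power_le_imp_le_exp[rotated]) (use q in simp)
    hence js: "2 \<le> s + j" by simp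
    define i where "i = s + j - 2"
    have "s + j = i + 2" using js by (simp add: i_def)
    hence "card U * card k ^ i * card k ^ 2 = card k ^ (2 * card B) * card k ^ 2"
      using eq by (simp add: power_add mult.assoc)
    hence "card U * card k ^ i = card k ^ (2 * card B)" using q by (cases "k = {}") auto
    hence "U \<in> spanning B i" using U by (simp add: spanning_def)
    hence "(U, N) \<in> I s" using N s js by (simp add: I_def subspaces_at_def i_def add.commute)
    moreover have "s \<in> {0, 1, 2}" using s2 by auto
    ultimately show "V \<in> (\<Union>(U, N)\<in>(\<Union>s\<in>{0, 1, 2}. I s). G U N)" using VG by blast
  next
    fix V assume "V \<in> (\<Union>(U, N)\<in>(\<Union>s\<in>{0, 1, 2}. I s). G U N)"
    then obtain s U N where *: "(U, N) \<in> I s" "V \<in> G U N" by blast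
    hence js: "j + s \<ge> 2" and U: "U \<in> spanning B (j + s - 2)" and N: "N \<in> subspaces_at p s"
      by (auto simp: I_def split: if_splits)
    have V: "V \<in> lifts k p U N" "qspan V = supported (insert p B)" using * by (auto simp: G_def)
    have finV: "finite V"
      using lifts_subset[OF V(1) spanningD(4)[OF U] B(2)] finite_supported(1) B(1) finite_subset
      by blast
    define i where "i = j + s - 2"
    have ji: "j + s = i + 2" using js by (simp add: i_def)
    have "card V * card k ^ j = card U * card k ^ (j + s)"
      using card_proj_image[OF liftsD(1)[OF V(1)] finV, of p] liftsD[OF V(1)] N
      by (simp add: subspaces_at_def power_add)
    also have "\<dots> = card U * card k ^ i * card k ^ 2"
      by (simp add: ji power_add power2_eq_square)
    also have "\<dots> = card k ^ (2 * card (insert p B))"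
      using spanningD(3)[OF U] cardB by (simp add: i_def power_add power2_eq_square)
    finally show "V \<in> spanning (insert p B) j" using liftsD(1)[OF V(1)] V(2) by (simp add: spanning_def)
  qed
  also have "card \<dots> = (\<Sum>(U, N)\<in>(\<Union>s\<in>{0, 1, 2}. I s). card (G U N))"
    unfolding case_prod_beta
  proof (rule card_UN_disjoint)
    show "\<forall>z\<in>(\<Union>s\<in>{0, 1, 2}. I s). finite (G (fst z) (snd z))"
    proof
      fix z assume "z \<in> (\<Union>s\<in>{0, 1, 2}. I s)"
      then obtain i where "fst z \<in> spanning B i" by (auto simp: I_def split: if_splits)
      thus "finite (G (fst z) (snd z))" using finG spanningD(4) by blast
    qed
    show "\<forall>z\<in>(\<Union>s\<in>{0, 1, 2}. I s). \<forall>z'\<in>(\<Union>s\<in>{0, 1, 2}. I s). z \<noteq> z' \<longrightarrow>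
        G (fst z) (snd z) \<inter> G (fst z') (snd z') = {}"
      using disjG by (metis prod.collapse)
  qed (use finI in auto)
  also have "\<dots> = (\<Sum>s\<in>{0, 1, 2}. \<Sum>(U, N)\<in>I s. card (G U N))"
  proof (rule sum.UNION_disjoint)
    have "card N = card k ^ s" if "(U, N) \<in> I s" for U N s
      using that by (auto simp: I_def subspaces_at_def split: if_splits)
    hence "s = s'" if "z \<in> I s" "z \<in> I s'" for z s s'
      using that q by (metis power_inject_exp prod.collapse Suc_1 Suc_le_lessD)
    thus "\<forall>s\<in>{0, 1, 2}. \<forall>s'\<in>{0, 1, 2}. s \<noteq> s' \<longrightarrow> I s \<inter> I s' = {}"
      unfolding disjoint_iff by metis
  qed (use finI in auto)
  finally have "int (card (spanning (insert p B) j :: ('i \<Rightarrow> 'a) set set)) =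
      (\<Sum>(U, N)\<in>I 0. int (card (G U N))) + (\<Sum>(U, N)\<in>I 1. int (card (G U N))) +
      (\<Sum>(U, N)\<in>I 2. int (card (G U N)))"
    by (simp add: case_prod_beta)
  moreover have "(\<Sum>(U, N)\<in>I 2. int (card (G U N))) = int (card (spanning B j :: ('i \<Rightarrow> 'a) set set))"
  proof -
    have "card (G U N) = 1" if "(U, N) \<in> I 2" for U N
      unfolding G_def
      by (rule card_spanning_lifts(1)[where s = 2 and d = "2 * card B - j"])
        (use I_mem[OF that] B in \<open>auto dest: spanningD card_spanning_member simp: spanningD(2)\<close>)
    hence "(\<Sum>(U, N)\<in>I 2. int (card (G U N))) = (\<Sum>(U, N)\<in>I 2. 1)"
      by (intro sum.cong) auto
    thus ?thesis using card_subspaces_at(3)[of p] by (simp add: I_def card_cartesian_product)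
  qed
  moreover have "(\<Sum>(U, N)\<in>I 1. int (card (G U N))) =
    (if j \<ge> 1 then (?q + 1) * int (card (spanning B (j - 1) :: ('i \<Rightarrow> 'a) set set))
       * ?q ^ (2 * card B - (j - 1)) else 0)"
  proof (cases "j \<ge> 1")
    case True
    hence I1: "I 1 = spanning B (j - 1) \<times> subspaces_at p 1" by (simp add: I_def)
    have "card (G U N) = card k ^ (2 * card B - (j - 1))" if "(U, N) \<in> I 1" for U N
      unfolding G_def
      by (rule card_spanning_lifts(2)[where s = 1])
        (use I_mem[OF that] B in \<open>auto dest: spanningD card_spanning_member simp: spanningD(2)\<close>)
    hence "(\<Sum>(U, N)\<in>I 1. int (card (G U N))) = (\<Sum>(U, N)\<in>I 1. ?q ^ (2 * card B - (j - 1)))"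
      by (intro sum.cong) auto
    moreover have "card (I 1) = card (spanning B (j - 1) :: ('i \<Rightarrow> 'a) set set) * (card k + 1)"
      unfolding I1 card_cartesian_product card_subspaces_at(2) ..
    ultimately show ?thesis using True by (simp add: case_prod_beta algebra_simps)
  qed (simp add: I_def)
  moreover have "(\<Sum>(U, N)\<in>I 0. int (card (G U N))) =
    (if j \<ge> 2 then int (card (spanning B (j - 2) :: ('i \<Rightarrow> 'a) set set))
       * (?q ^ (2 * (2 * card B - (j - 2))) - ?q ^ (2 * card B)) else 0)"
  proof (cases "j \<ge> 2")
    case True
    hence I0: "I 0 = spanning B (j - 2) \<times> subspaces_at p 0" by (simp add: I_def)
    have "card (G U N) + card k ^ (2 * card B) = card k ^ (2 * (2 * card B - (j - 2)))"
      if "(U, N) \<in> I 0" for U N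
      unfolding G_def
      by (rule card_spanning_lifts(3)[where s = 0])
        (use I_mem[OF that] B in \<open>auto dest: spanningD card_spanning_member simp: spanningD(2)\<close>)
    hence "int (card (G U N)) = ?q ^ (2 * (2 * card B - (j - 2))) - ?q ^ (2 * card B)"
      if "(U, N) \<in> I 0" for U N
      using that by (simp flip: of_nat_power add: eq_diff_eq of_nat_add[symmetric] del: of_nat_add)
    hence "(\<Sum>(U, N)\<in>I 0. int (card (G U N))) =
        (\<Sum>(U, N)\<in>I 0. ?q ^ (2 * (2 * card B - (j - 2))) - ?q ^ (2 * card B))"
      by (intro sum.cong) auto
    thus ?thesis
      using True card_subspaces_at(1)[of p] by (simp add: I0 card_cartesian_product)
  qed (simp add: I_def)
  ultimately show ?thesis by simp
qed

end

section \<open>Lattices over power series\<close>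

definition linmap :: "(('i \<Rightarrow> 'r::comm_ring_1) \<Rightarrow> 'j \<Rightarrow> 'r) \<Rightarrow> bool" where
  "linmap f \<longleftrightarrow> (\<forall>x y. f (x + y) = f x + f y) \<and> (\<forall>c x. f (scal c x) = scal c (f x))"

lemma linmapD:
  assumes "linmap f"
  shows "f (x + y) = f x + f y" "f (scal c x) = scal c (f x)" "f (x - y) = f x - f y" "f 0 = 0"
proof -
  show *: "f (x + y) = f x + f y" "f (scal c x) = scal c (f x)" for x y c
    using assms by (auto simp: linmap_def)
  show "f 0 = 0" using *(2)[of 0 0] by simp
  show "f (x - y) = f x - f y" using *(1)[of x "scal (-1) y"] *(2)[of "-1" y] by simp
qed

context
  fixes f :: "('i \<Rightarrow> 'r::comm_ring_1) \<Rightarrow> 'j \<Rightarrow> 'r" and Y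
  assumes f: "linmap f" and inj: "inj_on f Y"
begin

text \<open>A \<open>linmap\<close> is linear over the whole ambient ring, so one map transports
  submodules over every set of scalars, over \<open>R\<close> and over \<open>S\<close>
  alike.\<close>

lemma submod_linmap_image_iff:
  assumes Y: "submod S Y" and "L \<subseteq> Y"
  shows "submod S (f ` L) \<longleftrightarrow> submod S L"
proof
  assume L: "submod S L"
  show "submod S (f ` L)"
  proof (rule submodI)
    show "0 \<in> f ` L" using submod_zero[OF L] linmapD(4)[OF f] by (metis image_eqI)
    show "u - v \<in> f ` L" if "u \<in> f ` L" "v \<in> f ` L" for u v
      using that submod_diff[OF L] by (auto simp flip: linmapD(3)[OF f])
    show "scal c u \<in> f ` L" if "c \<in> S" "u \<in> f ` L" for c u
      using that submod_scal[OF L] by (auto simp flip: linmapD(2)[OF f])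
  qed
next
  assume L: "submod S (f ` L)"
  have mem: "x \<in> L" if "f x \<in> f ` L" "x \<in> Y" for x
    using that assms(2) inj by (auto simp: inj_on_def)
  show "submod S L"
  proof (rule submodI)
    show "0 \<in> L" using mem[of 0] submod_zero[OF L] submod_zero[OF Y] linmapD(4)[OF f] by simp
    show "u - v \<in> L" if "u \<in> L" "v \<in> L" for u v
    proof -
      have "u \<in> Y" "v \<in> Y" using that assms(2) by auto
      thus ?thesis
        using mem[of "u - v"] submod_diff[OF Y, of u v]
          submod_diff[OF L imageI[OF that(1)] imageI[OF that(2)]]
        by (simp add: linmapD(3)[OF f])
    qed
    show "scal c u \<in> L" if "c \<in> S" "u \<in> L" for c u
    proof -
      have "u \<in> Y" using that assms(2) by auto
      thus ?thesis
        using mem[of "scal c u"] submod_scal[OF Y that(1)] submod_scal[OF L that(1) imageI[OF that(2)]]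
        by (simp add: linmapD(2)[OF f])
    qed
  qed
qed

lemma has_index_linmap_image_iff:
  assumes "submod S Y" "submod S L" "L \<subseteq> Y"
  shows "has_index (f ` Y) (f ` L) m \<longleftrightarrow> has_index Y L m"
proof -
  have fL: "add_subgroup (f ` L)"
    using submod_linmap_image_iff[OF assms(1,3)] assms(2) submod_add_subgroup by blast
  have "has_index Y L m \<longleftrightarrow> has_index (f ` Y) (f ` L) m"
  proof (rule has_index_transfer[OF submod_add_subgroup[OF assms(2)] fL])
    show "\<exists>x\<in>Y. y - f x \<in> f ` L" if "y \<in> f ` Y" for y
      using that add_subgroup_zero[OF fL] by force
    show "x - y \<in> L \<longleftrightarrow> f x - f y \<in> f ` L" if "x \<in> Y" "y \<in> Y" for x y
      using submod_diff[OF assms(1) that] assms(3) inj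
      by (auto simp: inj_on_def simp flip: linmapD(3)[OF f])
  qed auto
  thus ?thesis by simp
qed

text \<open>The predicates \<open>P\<close> and \<open>Q\<close> carry a further condition across:
  that of having full span, or none in the division by \<open>T\<close>.\<close>

lemma bij_betw_linmap_image:
  assumes "submod S Y" and "\<And>L. submod S L \<Longrightarrow> L \<subseteq> Y \<Longrightarrow> P (f ` L) \<longleftrightarrow> Q L"
  shows "bij_betw ((`) f) {L. submod S L \<and> L \<subseteq> Y \<and> has_index Y L m \<and> Q L}
    {L. submod S L \<and> L \<subseteq> f ` Y \<and> has_index (f ` Y) L m \<and> P L}"
  unfolding bij_betw_def
proof
  show "inj_on ((`) f) {L. submod S L \<and> L \<subseteq> Y \<and> has_index Y L m \<and> Q L}"
    using inj inj_on_image_eq_iff[of f Y] by (intro inj_onI) auto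
  show "(`) f ` {L. submod S L \<and> L \<subseteq> Y \<and> has_index Y L m \<and> Q L} =
      {L. submod S L \<and> L \<subseteq> f ` Y \<and> has_index (f ` Y) L m \<and> P L}"
  proof (intro equalityI subsetI)
    fix M assume "M \<in> (`) f ` {L. submod S L \<and> L \<subseteq> Y \<and> has_index Y L m \<and> Q L}"
    then obtain L where "submod S L" "L \<subseteq> Y" "has_index Y L m" "Q L" "M = f ` L" by blast
    thus "M \<in> {L. submod S L \<and> L \<subseteq> f ` Y \<and> has_index (f ` Y) L m \<and> P L}"
      using submod_linmap_image_iff[OF assms(1)] has_index_linmap_image_iff[OF assms(1)] assms(2) by auto
  next
    fix M assume M: "M \<in> {L. submod S L \<and> L \<subseteq> f ` Y \<and> has_index (f ` Y) L m \<and> P L}"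
    then obtain L where L: "L \<subseteq> Y" "M = f ` L" by (auto simp: subset_image_iff)
    have "submod S L" using M L submod_linmap_image_iff[OF assms(1) L(1)] by simp
    moreover from this have "has_index Y L m" "Q L"
      using M L has_index_linmap_image_iff[OF assms(1) _ L(1)] assms(2) by auto
    ultimately show "M \<in> (`) f ` {L. submod S L \<and> L \<subseteq> Y \<and> has_index Y L m \<and> Q L}"
      using L by blast
  qed
qed

end

section \<open>Lattices with coordinates in R and in S\<close>

definition const_in :: "'a::field set \<Rightarrow> 'a fps set" where
  "const_in \<kappa> = {f. fps_nth f 0 \<in> \<kappa>}"

lemma const_in_UNIV [simp]: "const_in UNIV = UNIV"
  by (simp add: const_in_def)

text \<open>For \<open>\<kappa> = k\<close> this is R^A \<oplus> S^B; for
  \<open>\<kappa> = UNIV\<close> both kinds of coordinates coincide and the lattice is free over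
  \<open>S\<close>. The parameter lets one recursion serve both rings.\<close>

definition mixed_lattice :: "'a::field set \<Rightarrow> 'i set \<Rightarrow> 'i set \<Rightarrow> ('i \<Rightarrow> 'a fps) set" where
  "mixed_lattice \<kappa> A B = {x\<in>supported (A \<union> B). \<forall>i\<in>A. x i \<in> const_in \<kappa>}"

lemma mixed_lattice_empty: "mixed_lattice \<kappa> {} B = supported B"
  by (simp add: mixed_lattice_def)

lemma mixed_lattice_UNIV: "mixed_lattice UNIV A B = supported (A \<union> B)"
  by (simp add: mixed_lattice_def)

definition sublattices :: "'a::field set \<Rightarrow> ('i \<Rightarrow> 'a fps) set \<Rightarrow> nat \<Rightarrow> ('i \<Rightarrow> 'a fps) set set" where
  "sublattices \<kappa> U m = {L. submod (const_in \<kappa>) L \<and> L \<subseteq> U \<and> has_index U L m}"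

lemma inverse_fun_mem:
  fixes T :: "'a::field set"
  assumes "finite_scalar_field T" "a \<in> T"
  shows "inverse a \<in> T"
proof (cases "a = 0")
  case False
  then obtain b where "b \<in> T" "b * a = 1" using finite_scalar_field.inverse_mem[OF assms] by blast
  thus ?thesis using inverse_unique[of a b] by (simp add: mult.commute)
qed (use assms in simp)

lemma scalar_ring_const_in:
  assumes "scalar_ring \<kappa>"
  shows "scalar_ring (const_in \<kappa>)"
  using scalar_ring.zero_mem[OF assms] scalar_ring.one_mem[OF assms] scalar_ring.diff_mem[OF assms]
    scalar_ring.mult_mem[OF assms]
  by unfold_locales (auto simp: const_in_def)

lemma submod_lattice:
  assumes "scalar_ring \<kappa>"
  shows "submod (const_in \<kappa>) (mixed_lattice \<kappa> A B)"
proof -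
  interpret c: scalar_ring "const_in \<kappa>" by (rule scalar_ring_const_in[OF assms])
  show ?thesis
    by (rule submodI) (auto simp: mixed_lattice_def supported_def c.zero_mem c.diff_mem c.mult_mem)
qed

lemma finite_scalar_field_const:
  fixes \<kappa> :: "'a::field set"
  assumes "finite_scalar_field \<kappa>"
  shows "finite_scalar_field (fps_const ` \<kappa>)"
proof -
  interpret finite_scalar_field \<kappa> by fact
  show ?thesis
  proof
    show "a - b \<in> fps_const ` \<kappa>" if "a \<in> fps_const ` \<kappa>" "b \<in> fps_const ` \<kappa>" for a b
      using that diff_mem by (auto simp: fps_const_sub)
    show "a * b \<in> fps_const ` \<kappa>" if "a \<in> fps_const ` \<kappa>" "b \<in> fps_const ` \<kappa>" for a b
      using that mult_mem by auto
    show "\<exists>b\<in>fps_const ` \<kappa>. b * a = 1" if "a \<in> fps_const ` \<kappa>" "a \<noteq> 0" for a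
      using that inverse_mem by force
    show "0 \<in> fps_const ` \<kappa>" using zero_mem by force
    show "1 \<in> fps_const ` \<kappa>" using one_mem by force
  qed (use finite_scalars in simp)
qed

text \<open>The constants from \<open>\<kappa>\<close> lie in \<open>const_in \<kappa>\<close>, so
  every lattice is a vector space over a finite field and indices are powers of its size.\<close>

lemma has_index_power_lattice:
  assumes "finite_scalar_field \<kappa>" "submod (const_in \<kappa>) U" "submod (const_in \<kappa>) L" "L \<subseteq> U"
    "has_index U L m"
  shows "\<exists>e. m = card \<kappa> ^ e"
proof -
  interpret c: finite_scalar_field "fps_const ` \<kappa>" by (rule finite_scalar_field_const[OF assms(1)])
  have "fps_const ` \<kappa> \<subseteq> const_in \<kappa>" by (auto simp: const_in_def)
  moreover have "card (fps_const ` \<kappa>) = card \<kappa>" by (intro card_image inj_onI) (metis fps_nth_fps_const)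
  ultimately show ?thesis using c.has_index_power[of U L m] submod_mono[OF assms(2)]
      submod_mono[OF assms(3)] assms(4,5) by simp
qed

lemma sublattices_zero:
  assumes "scalar_ring \<kappa>"
  shows "sublattices \<kappa> (mixed_lattice \<kappa> A B) 0 = {}"
  using has_index_pos[of "mixed_lattice \<kappa> A B" _ 0] submod_zero[OF submod_lattice[OF assms, of A B]]
  by (auto simp: sublattices_def)

text \<open>
  The submodules of a lattice in which the coordinate \<open>p\<close> takes a unit value split off a free
  summand of rank one; in the others, this coordinate may be divided by \<open>T\<close>.
\<close>

lemma card_sublattices_insert:
  fixes \<kappa> :: "'a::{field,finite} set" and A B :: "'i set"
  assumes \<kappa>: "finite_scalar_field \<kappa>" and p: "p \<notin> A \<union> B"
    and fin1: "finite (sublattices \<kappa> (mixed_lattice \<kappa> A B) m)"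
    and fin2: "card \<kappa> dvd m \<Longrightarrow> finite (sublattices \<kappa> (mixed_lattice \<kappa> A (insert p B)) (m div card \<kappa>))"
  shows "finite (sublattices \<kappa> (mixed_lattice \<kappa> (insert p A) B) m)"
    and "card (sublattices \<kappa> (mixed_lattice \<kappa> (insert p A) B) m) =
      m * card (sublattices \<kappa> (mixed_lattice \<kappa> A B) m) +
      (if card \<kappa> dvd m then card (sublattices \<kappa> (mixed_lattice \<kappa> A (insert p B)) (m div card \<kappa>)) else 0)"
proof -
  interpret finite_scalar_field \<kappa> by fact
  interpret c: scalar_ring "const_in \<kappa>" by (rule scalar_ring_const_in) unfold_locales
  have cinv: "inverse f \<in> const_in \<kappa>" if "f \<in> const_in \<kappa>" for f
    using that inverse_fun_mem[OF \<kappa>] by (simp add: const_in_def)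
  define U where "U = mixed_lattice \<kappa> (insert p A) B"
  define Y where "Y = mixed_lattice \<kappa> A B"
  define v :: "'i \<Rightarrow> 'a fps" where "v = (\<lambda>i. if i = p then 1 else 0)"
  have U: "submod (const_in \<kappa>) U" and Y: "submod (const_in \<kappa>) Y"
    unfolding U_def Y_def by (rule submod_lattice, unfold_locales)+
  have YU: "Y = {x\<in>U. x p = 0}"
    using p c.zero_mem by (auto simp: Y_def U_def mixed_lattice_def supported_def)
  have vU: "v \<in> U"
    using c.one_mem c.zero_mem by (auto simp: U_def mixed_lattice_def supported_def v_def)
  have vp: "v p = 1" by (simp add: v_def)
  have Up: "x p \<in> const_in \<kappa>" if "x \<in> U" for x using that by (simp add: U_def mixed_lattice_def)
  have adj: "c.adjoin Y v = U"
  proof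
    show "c.adjoin Y v \<subseteq> U" by (rule c.adjoin_subset[OF U _ vU]) (simp add: YU)
    have "x - scal (x p) v \<in> Y" if "x \<in> U" for x
      using that submod_diff[OF U that submod_scal[OF U Up[OF that] vU]] by (simp add: YU vp)
    thus "U \<subseteq> c.adjoin Y v" using Up by (auto simp: c.adjoin_def)
  qed
  have free: "c = 0" if "scal c v \<in> Y" for c using that by (simp add: YU vp)
  define E1 where "E1 = {L\<in>sublattices \<kappa> U m. \<exists>x\<in>L. fps_nth (x p) 0 \<noteq> 0}"
  define E2 where "E2 = {L\<in>sublattices \<kappa> U m. \<forall>x\<in>L. fps_nth (x p) 0 = 0}"
  have E1_eq: "E1 = (\<Union>W\<in>sublattices \<kappa> Y m. c.extensions Y W v)"
  proof (intro equalityI subsetI)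
    fix L assume "L \<in> E1"
    then obtain x where L: "submod (const_in \<kappa>) L" "L \<subseteq> U" "has_index U L m"
      and x: "x \<in> L" "fps_nth (x p) 0 \<noteq> 0" by (auto simp: E1_def sublattices_def)
    \<comment> \<open>A series with nonzero constant term in the field \<open>\<kappa>\<close> is a
      unit of \<open>const_in \<kappa>\<close>, so the coordinate \<open>p\<close> can be scaled to
      1 within \<open>L\<close>.\<close>
    define y where "y = scal (inverse (x p)) x"
    have y: "y \<in> L" using submod_scal[OF L(1) cinv[OF Up] x(1)] x L(2) by (auto simp: y_def)
    have "y p = 1" using inverse_mult_eq_1[OF x(2)] by (simp add: y_def)
    hence "y - v \<in> Y" using submod_diff[OF U _ vU, of y] y L(2) by (auto simp: YU vp)
    hence "\<exists>z\<in>Y. z + v \<in> L" using y by (intro bexI[of _ "y - v"]) auto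
    hence LE: "L \<in> c.extensions Y (L \<inter> Y) v"
      using L adj by (simp add: c.extensions_def)
    have LY: "submod (const_in \<kappa>) (L \<inter> Y)" by (rule submod_Int[OF L(1) Y])
    have "has_index Y (L \<inter> Y) m"
      using c.has_index_extension[OF Y LY _ free LE] L(3) adj by simp
    hence "L \<inter> Y \<in> sublattices \<kappa> Y m" using LY by (simp add: sublattices_def)
    thus "L \<in> (\<Union>W\<in>sublattices \<kappa> Y m. c.extensions Y W v)" using LE by blast
  next
    fix L assume "L \<in> (\<Union>W\<in>sublattices \<kappa> Y m. c.extensions Y W v)"
    then obtain W where W: "submod (const_in \<kappa>) W" "W \<subseteq> Y" "has_index Y W m"
      and L: "L \<in> c.extensions Y W v" by (auto simp: sublattices_def)
    have "has_index U L m" using c.has_index_extension[OF Y W(1,2) free L] W(3) adj by simp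
    moreover obtain y where "y \<in> Y" "y + v \<in> L" using L by (auto simp: c.extensions_def)
    moreover from this have "fps_nth ((y + v) p) 0 \<noteq> 0" by (simp add: YU vp)
    moreover have "submod (const_in \<kappa>) L" "L \<subseteq> U" using L adj by (auto simp: c.extensions_def)
    ultimately show "L \<in> E1" unfolding E1_def sublattices_def by blast
  qed
  have ext_card: "finite (c.extensions Y W v) \<and> card (c.extensions Y W v) = m"
    if "W \<in> sublattices \<kappa> Y m" for W
    using that by (intro c.card_extensions[OF Y _ _ free]) (auto simp: sublattices_def)
  have finE1: "finite E1" using E1_eq ext_card fin1 by (simp add: Y_def)
  have "card E1 = (\<Sum>W\<in>sublattices \<kappa> Y m. card (c.extensions Y W v))"
    unfolding E1_eq
    by (rule card_UN_disjoint) (use fin1 ext_card in \<open>auto simp: Y_def c.extensions_def\<close>)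
  hence cardE1: "card E1 = m * card (sublattices \<kappa> Y m)" using ext_card by simp
  define Y2 where "Y2 = mixed_lattice \<kappa> A (insert p B)"
  define U2 where "U2 = {x\<in>U. fps_nth (x p) 0 = 0}"
  \<comment> \<open>Multiplication by \<open>T\<close> in the coordinate \<open>p\<close> alone. It
    maps all power series onto those with constant term 0, and these lie in
    \<open>const_in \<kappa>\<close>; hence \<open>p\<close> moves from \<open>A\<close> to
    \<open>B\<close>.\<close>
  define \<sigma> :: "('i \<Rightarrow> 'a fps) \<Rightarrow> 'i \<Rightarrow> 'a fps" where "\<sigma> x = x(p := fps_X * x p)" for x
  have Y2: "submod (const_in \<kappa>) Y2" unfolding Y2_def by (rule submod_lattice, unfold_locales)
  have U2: "submod (const_in \<kappa>) U2"
    by (rule submodI)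
      (use submod_zero[OF U] submod_diff[OF U] submod_scal[OF U] in \<open>auto simp: U2_def\<close>)
  have \<sigma>: "linmap \<sigma>" by (auto simp: linmap_def \<sigma>_def fun_eq_iff algebra_simps)
  have inj: "inj_on \<sigma> Y2"
  proof (rule inj_onI, rule ext)
    fix x y i assume "\<sigma> x = \<sigma> y"
    hence "\<sigma> x i = \<sigma> y i" by simp
    thus "x i = y i" by (auto simp: \<sigma>_def split: if_splits)
  qed
  have \<sigma>Y: "\<sigma> ` Y2 = U2"
  proof (intro equalityI subsetI)
    fix z assume "z \<in> \<sigma> ` Y2"
    then obtain x where "x \<in> Y2" "z = \<sigma> x" by blast
    thus "z \<in> U2"
      using p zero_mem
      by (auto simp: U2_def U_def Y2_def mixed_lattice_def supported_def \<sigma>_def const_in_def)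
  next
    fix z assume z: "z \<in> U2"
    hence "fps_X * fps_shift 1 (z p) = z p"
      by (intro fps_ext) (auto simp: U2_def)
    hence "z = \<sigma> (z(p := fps_shift 1 (z p)))" by (simp add: \<sigma>_def)
    moreover have "z(p := fps_shift 1 (z p)) \<in> Y2"
      using z p by (auto simp: U2_def U_def Y2_def mixed_lattice_def supported_def)
    ultimately show "z \<in> \<sigma> ` Y2" by blast
  qed
  \<comment> \<open>The constant term of the coordinate \<open>p\<close> takes every value in
    \<open>\<kappa>\<close> on \<open>U\<close>, and \<open>U2\<close> is where it vanishes. Hence
    the index of a submodule of \<open>U2\<close> is a multiple of
    \<open>card \<kappa>\<close>.\<close>
  have idx: "has_index U U2 (card \<kappa>)"
  proof -
    have "(\<lambda>x. fps_nth (x p) 0) ` U = \<kappa>"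
    proof (intro equalityI subsetI)
      fix a assume "a \<in> \<kappa>"
      hence "scal (fps_const a) v \<in> U" by (intro submod_scal[OF U _ vU]) (simp add: const_in_def)
      thus "a \<in> (\<lambda>x. fps_nth (x p) 0) ` U"
        by (intro image_eqI[of _ _ "scal (fps_const a) v"]) (simp_all add: vp)
    qed (use Up in \<open>auto simp: const_in_def\<close>)
    moreover have "has_index U U2 (card \<kappa>) \<longleftrightarrow> finite ((\<lambda>x. fps_nth (x p) 0) ` U) \<and>
        card ((\<lambda>x. fps_nth (x p) 0) ` U) = card \<kappa>"
      by (rule has_index_image_iff[OF submod_add_subgroup[OF U2]])
        (use submod_diff[OF U] in \<open>auto simp: U2_def\<close>)
    ultimately show ?thesis using finite_scalars by simp
  qed
  have q: "card \<kappa> \<ge> 2" by (rule card_scalars) simp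
  have factor: "\<exists>m'. m = card \<kappa> * m' \<and> has_index U2 L m'"
    if L: "submod (const_in \<kappa>) L" "L \<subseteq> U2" "has_index U L m" for L
  proof -
    obtain a b where ab: "has_index U U2 a" "has_index U2 L b" "m = a * b"
      using has_index_factor[OF submod_add_subgroup[OF L(1)] submod_add_subgroup[OF U2]
          submod_add_subgroup[OF U] L(2) _ L(3)] by (auto simp: U2_def)
    thus ?thesis using has_index_unique[OF idx ab(1)] by blast
  qed
  have E2_eq: "E2 = {L. submod (const_in \<kappa>) L \<and> L \<subseteq> U2 \<and> has_index U L m}"
    by (auto simp: E2_def sublattices_def U2_def)
  have E2: "finite E2 \<and> card E2 =
    (if card \<kappa> dvd m then card (sublattices \<kappa> Y2 (m div card \<kappa>)) else 0)"
  proof (cases "card \<kappa> dvd m")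
    case True
    then obtain m' where m': "m = card \<kappa> * m'" by blast
    have "has_index U L m \<longleftrightarrow> has_index U2 L m'" if L: "submod (const_in \<kappa>) L" "L \<subseteq> U2" for L
    proof
      assume "has_index U L m"
      thus "has_index U2 L m'" using factor[OF L] m' q by auto
    next
      assume "has_index U2 L m'"
      thus "has_index U L m"
        using has_index_mult[OF submod_add_subgroup[OF L(1)] submod_add_subgroup[OF U2]
            submod_add_subgroup[OF U] L(2) _ idx] m' by (auto simp: U2_def)
    qed
    hence "E2 = {L. submod (const_in \<kappa>) L \<and> L \<subseteq> U2 \<and> has_index U2 L m' \<and> True}"
      unfolding E2_eq by auto
    moreover have "bij_betw ((`) \<sigma>) {L. submod (const_in \<kappa>) L \<and> L \<subseteq> Y2 \<and> has_index Y2 L m' \<and> True}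
        {L. submod (const_in \<kappa>) L \<and> L \<subseteq> \<sigma> ` Y2 \<and> has_index (\<sigma> ` Y2) L m' \<and> True}"
      by (rule bij_betw_linmap_image[OF \<sigma> inj Y2]) simp
    ultimately have bij: "bij_betw ((`) \<sigma>) (sublattices \<kappa> Y2 m') E2"
      by (simp add: \<sigma>Y sublattices_def)
    have "m div card \<kappa> = m'" using m' q by simp
    thus ?thesis
      using bij_betw_finite[OF bij] bij_betw_same_card[OF bij] fin2[OF True] True
      by (simp add: Y2_def)
  next
    case False
    have "L \<notin> E2" for L
    proof
      assume "L \<in> E2"
      then obtain m' where "m = card \<kappa> * m'" using factor[of L] unfolding E2_eq by auto
      thus False using False by simp
    qed
    hence "E2 = {}" by blast
    thus ?thesis using False by simp
  qed
  have split: "sublattices \<kappa> U m = E1 \<union> E2" "E1 \<inter> E2 = {}" by (auto simp: E1_def E2_def)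
  show "finite (sublattices \<kappa> (mixed_lattice \<kappa> (insert p A) B) m)"
    using split finE1 E2 by (simp add: U_def)
  show "card (sublattices \<kappa> (mixed_lattice \<kappa> (insert p A) B) m) =
      m * card (sublattices \<kappa> (mixed_lattice \<kappa> A B) m) +
      (if card \<kappa> dvd m then card (sublattices \<kappa> (mixed_lattice \<kappa> A (insert p B)) (m div card \<kappa>)) else 0)"
    using card_Un_disjoint[OF finE1 _ split(2)] E2 cardE1 split(1) by (simp add: U_def Y_def Y2_def)
qed

text \<open>A column reduction over a discrete valuation ring. An element \<open>u\<close> whose
  coordinate \<open>p\<close> has least order divides that coordinate of all others, so \<Lambda> is
  the sum of its part with coordinate 0 at \<open>p\<close>, free by induction, and the multiples of
  \<open>u\<close>.\<close>

lemma finite_index_free: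
  fixes \<Lambda> :: "('i \<Rightarrow> 'a::field fps) set"
  assumes "finite B" "submod UNIV \<Lambda>" "\<Lambda> \<subseteq> supported B" "has_index (supported B) \<Lambda> m"
  shows "\<exists>f. linmap f \<and> inj_on f (supported B) \<and> f ` supported B = \<Lambda>"
  using assms
proof (induction B arbitrary: \<Lambda> m rule: finite_induct)
  case empty
  have "supported {} = {0 :: 'i \<Rightarrow> 'a fps}" by (auto simp: supported_def fun_eq_iff)
  moreover from this have "\<Lambda> = {0}" using empty.prems submod_zero by blast
  ultimately show ?case by (intro exI[of _ id]) (simp add: linmap_def fun_eq_iff)
next
  case (insert p B \<Lambda> m)
  note \<Lambda> = insert.prems(1,2)
  have \<Lambda>0: "add_subgroup \<Lambda>" by (rule submod_add_subgroup[OF \<Lambda>(1)])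
  have fin: "finite (add_coset \<Lambda> ` supported (insert p B))"
    using insert.prems(3) by (simp add: has_index_def)
  define v :: "'i \<Rightarrow> 'a fps" where "v = (\<lambda>i. if i = p then 1 else 0)"
  have vS: "v \<in> supported (insert p B)" by (simp add: v_def supported_def)
  have "\<exists>x\<in>\<Lambda>. x p \<noteq> 0"
  proof -
    \<comment> \<open>The multiples \<open>T^d v\<close> fall into finitely many cosets of
      \<Lambda>. A coincidence puts a multiple of \<open>v\<close> by a nonzero difference of powers
      of \<open>T\<close> into \<Lambda>, so the coordinate \<open>p\<close> does not vanish
      there.\<close>
    define c where "c d = add_coset \<Lambda> (scal (fps_X ^ d) v)" for d :: nat
    have "range c \<subseteq> add_coset \<Lambda> ` supported (insert p B)"
      using submod_scal[OF submod_supported UNIV_I vS] by (auto simp: c_def)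
    hence "finite (range c)" using fin finite_subset by blast
    hence "\<not> inj c" using finite_imageD[of c UNIV] by auto
    then obtain d e where de: "d \<noteq> e" "c d = c e" by (auto simp: inj_def)
    hence "scal (fps_X ^ d) v - scal (fps_X ^ e) v \<in> \<Lambda>"
      using add_coset_eq_iff[OF \<Lambda>0] by (simp add: c_def)
    moreover have "(fps_X ^ d - fps_X ^ e :: 'a fps) \<noteq> 0"
    proof
      assume "(fps_X ^ d - fps_X ^ e :: 'a fps) = 0"
      hence "fps_nth (fps_X ^ d - fps_X ^ e :: 'a fps) d = 0" by simp
      thus False using de(1) by (simp add: fps_X_power_nth)
    qed
    ultimately show ?thesis
      by (intro bexI[of _ "scal (fps_X ^ d) v - scal (fps_X ^ e) v"]) (auto simp: v_def)
  qed
  then obtain u where u: "u \<in> \<Lambda>" "u p \<noteq> 0"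
    "\<And>x. x \<in> \<Lambda> \<Longrightarrow> x p \<noteq> 0 \<Longrightarrow> subdegree (u p) \<le> subdegree (x p)"
    using ex_has_least_nat[of "\<lambda>x. x \<in> \<Lambda> \<and> x p \<noteq> 0" _ "\<lambda>x. subdegree (x p)"] by blast
  have dvd: "u p dvd x p" if "x \<in> \<Lambda>" for x
    using fps_dvd_iff[OF u(2), of "x p"] u(3)[OF that] by (cases "x p = 0") auto
  define M where "M = \<Lambda> \<inter> supported B"
  have M: "submod UNIV M" "M \<subseteq> supported B"
    using submod_Int[OF \<Lambda>(1) submod_supported] by (auto simp: M_def)
  have sub: "supported B \<subseteq> (supported (insert p B) :: ('i \<Rightarrow> 'a fps) set)"
    by (auto simp: supported_def)
  have zero_p: "x \<in> supported B \<longleftrightarrow> x \<in> supported (insert p B) \<and> x p = 0" for x :: "'i \<Rightarrow> 'a fps"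
    using insert.hyps(2) by (auto simp: supported_def)
  have "has_index (supported B) M (card (add_coset \<Lambda> ` supported B))"
  proof -
    have "has_index (supported B) M (card (add_coset \<Lambda> ` supported B)) \<longleftrightarrow>
        finite (add_coset \<Lambda> ` supported B) \<and>
        card (add_coset \<Lambda> ` supported B) = card (add_coset \<Lambda> ` supported B)"
    proof (rule has_index_image_iff[OF submod_add_subgroup[OF M(1)]])
      fix x y :: "'i \<Rightarrow> 'a fps" assume "x \<in> supported B" "y \<in> supported B"
      hence "x - y \<in> supported B" by (rule submod_diff[OF submod_supported])
      thus "x - y \<in> M \<longleftrightarrow> add_coset \<Lambda> x = add_coset \<Lambda> y"
        by (simp add: M_def add_coset_eq_iff[OF \<Lambda>0])
    qed
    moreover have "finite (add_coset \<Lambda> ` supported B)"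
      by (rule finite_subset[OF image_mono[OF sub] fin])
    ultimately show ?thesis by simp
  qed
  then obtain g where g: "linmap g" "inj_on g (supported B)" "g ` supported B = M"
    using insert.IH[OF M] by blast
  define f where "f x = g (proj p x) + scal (x p) u" for x
  have f: "linmap f"
    by (auto simp: linmap_def f_def linmapD[OF g(1)] scal_distribs scal_scal algebra_simps)
  have gp: "g (proj p x) p = 0" and gM: "g (proj p x) \<in> M"
    if "x \<in> supported (insert p B)" for x
  proof -
    have "proj p x \<in> supported B" using that proj_in_supported_iff[OF insert.hyps(2)] by blast
    thus "g (proj p x) \<in> M" using g(3) by blast
    thus "g (proj p x) p = 0" using M(2) zero_p by blast
  qed
  have "inj_on f (supported (insert p B))"
  proof (rule inj_onI)
    fix x y assume xy: "x \<in> supported (insert p B)" "y \<in> supported (insert p B)" "f x = f y"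
    define z where "z = x - y"
    have z: "z \<in> supported (insert p B)" "f z = 0"
      using submod_diff[OF submod_supported xy(1,2)] xy(3) by (simp_all add: z_def linmapD(3)[OF f])
    have "f z p = z p * u p" by (simp add: f_def gp[OF z(1)])
    hence "z p = 0" using z(2) u(2) by simp
    hence "z \<in> supported B" "g (proj p z) = 0"
      using z zero_p by (auto simp: f_def)
    hence "g z = g 0" using proj_id[OF insert.hyps(2), of z] linmapD(4)[OF g(1)] by simp
    hence "z = 0"
      using inj_onD[OF g(2)] \<open>z \<in> supported B\<close> submod_zero[OF submod_supported] by blast
    thus "x = y" by (simp add: z_def)
  qed
  moreover have "f ` supported (insert p B) = \<Lambda>"
  proof (intro equalityI subsetI)
    fix z assume "z \<in> f ` supported (insert p B)"
    then obtain x where "x \<in> supported (insert p B)" "z = f x" by blast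
    thus "z \<in> \<Lambda>"
      using gM[of x] submod_add[OF \<Lambda>(1)] submod_scal[OF \<Lambda>(1) UNIV_I u(1)] by (simp add: f_def M_def)
  next
    fix z assume z: "z \<in> \<Lambda>"
    then obtain c where c: "z p = u p * c" using dvd by (auto simp: dvd_def)
    have "z - scal c u \<in> \<Lambda>" using submod_diff[OF \<Lambda>(1) z submod_scal[OF \<Lambda>(1) UNIV_I u(1)]] .
    moreover have "(z - scal c u) p = 0" using c by simp
    ultimately have "z - scal c u \<in> M" using \<Lambda>(2) zero_p by (auto simp: M_def)
    then obtain y where y: "y \<in> supported B" "z - scal c u = g y" using g(3) by blast
    have "proj p (y(p := c)) = y" using proj_id[OF insert.hyps(2) y(1)] by (auto simp: proj_def)
    hence "f (y(p := c)) = z" using y(2) by (simp add: f_def algebra_simps)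
    moreover have "y(p := c) \<in> supported (insert p B)" using y(1) by (auto simp: supported_def)
    ultimately show "z \<in> f ` supported (insert p B)" by blast
  qed
  ultimately show ?case using f by blast
qed

section \<open>Reduction modulo T and lattices with a given S-span\<close>

definition reduction :: "('i \<Rightarrow> 'a::field fps) \<Rightarrow> 'i \<Rightarrow> 'a" where
  "reduction x = (\<lambda>i. fps_nth (x i) 0)"

lemma reduction_simps [simp]:
  "reduction (x + y) = reduction x + reduction y" "reduction (x - y) = reduction x - reduction y"
  "reduction (scal c x) = scal (fps_nth c 0) (reduction x)" "reduction 0 = 0"
  "reduction (\<lambda>i. fps_const (z i)) = z"
  by (auto simp: reduction_def fun_eq_iff)

lemma reduction_supported: "x \<in> supported B \<Longrightarrow> reduction x \<in> supported B"
  by (auto simp: reduction_def supported_def)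

lemma const_supported: "z \<in> supported B \<Longrightarrow> (\<lambda>i. fps_const (z i)) \<in> supported B"
  by (auto simp: supported_def)

lemma reduction_image_supported:
  "reduction ` supported B = (supported B :: ('i \<Rightarrow> 'a::field) set)"
proof (intro equalityI subsetI)
  fix z :: "'i \<Rightarrow> 'a" assume "z \<in> supported B"
  thus "z \<in> reduction ` supported B"
    using const_supported by (intro image_eqI[of _ _ "\<lambda>i. fps_const (z i)"]) auto
qed (auto simp: reduction_supported)

context finite_quadratic_extension
begin

sublocale fps: quadratic_extension "const_in k" "fps_const w"
proof -
  interpret c: scalar_ring "const_in k" by (rule scalar_ring_const_in, unfold_locales)
  show "quadratic_extension (const_in k) (fps_const w)"
  proof
    fix c :: "'a fps"
    obtain a b where ab: "a \<in> k" "b \<in> k" "fps_nth c 0 = a + b * w" using decomp by blast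
    show "\<exists>f\<in>const_in k. \<exists>g\<in>const_in k. c = f + g * fps_const w"
    proof (intro bexI)
      \<comment> \<open>Only the constant term has to be corrected: everything but the constant
        \<open>b * w\<close> goes into the first summand, whose constant term is then
        \<open>a\<close>.\<close>
      show "c = (c - fps_const b * fps_const w) + fps_const b * fps_const w" by simp
    qed (use ab in \<open>auto simp: const_in_def\<close>)
  qed
qed

text \<open>A lattice with full span contains \<open>T\<close> times the ambient module, hence is
  the full preimage of its reduction modulo \<open>T\<close>. The reduction spans over
  \<open>K\<close>, and index and codimension correspond.\<close>

lemma card_spanning_lattices:
  assumes B: "finite B"
  shows "finite {L :: ('i \<Rightarrow> 'a fps) set. submod (const_in k) L \<and> L \<subseteq> supported B \<and>
      has_index (supported B) L (card k ^ j) \<and> fps.qspan L = supported B}" (is "finite ?T")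
    and "card {L :: ('i \<Rightarrow> 'a fps) set. submod (const_in k) L \<and> L \<subseteq> supported B \<and>
      has_index (supported B) L (card k ^ j) \<and> fps.qspan L = supported B} =
      card (spanning B j :: ('i \<Rightarrow> 'a) set set)"
proof -
  define lift where "lift V = {x\<in>supported B. reduction x \<in> V}" for V :: "('i \<Rightarrow> 'a) set"
  have submod_lift: "submod (const_in k) (lift V)" if V: "submod k V" for V
    by (rule submodI)
      (use submod_zero[OF V] submod_diff[OF V] submod_scal[OF V] submod_zero[OF submod_supported, of B]
        submod_diff[OF submod_supported, of _ B] submod_scal[OF submod_supported UNIV_I, of _ B]
        in \<open>auto simp: lift_def const_in_def\<close>)
  have index_lift: "has_index (supported B) (lift V) (card k ^ j) \<longleftrightarrow>
      card V * card k ^ j = card k ^ (2 * card B)" if V: "submod k V" "V \<subseteq> supported B" for V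
  proof -
    have "has_index (supported B) (lift V) (card k ^ j) \<longleftrightarrow>
        has_index (supported B) V (card k ^ j)"
    proof (rule has_index_transfer[OF submod_add_subgroup[OF submod_lift[OF V(1)]]
          submod_add_subgroup[OF V(1)], where f = reduction])
      fix z :: "'i \<Rightarrow> 'a" assume "z \<in> supported B"
      thus "\<exists>x\<in>supported B. z - reduction x \<in> V"
        using const_supported submod_zero[OF V(1)] by (intro bexI[of _ "\<lambda>i. fps_const (z i)"]) auto
    next
      fix x y :: "'i \<Rightarrow> 'a fps" assume "x \<in> supported B" "y \<in> supported B"
      thus "x - y \<in> lift V \<longleftrightarrow> reduction x - reduction y \<in> V"
        using submod_diff[OF submod_supported] by (auto simp: lift_def)
    qed (rule reduction_supported)
    also have "\<dots> \<longleftrightarrow> card k ^ (2 * card B) = card k ^ j * card V"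
      using has_index_finite_iff[OF submod_add_subgroup[OF V(1)] submod_add_subgroup[OF submod_supported]
          V(2) finite_supported(1)[OF B]] card_supported_sq[OF B] by simp
    finally show ?thesis by (auto simp: mult.commute)
  qed
  have reduction_lift: "reduction ` lift V = V" if "V \<subseteq> supported B" for V
  proof (intro equalityI subsetI)
    fix z assume "z \<in> V"
    thus "z \<in> reduction ` lift V"
      using const_supported[of z B] that
      by (intro image_eqI[of _ _ "\<lambda>i. fps_const (z i)"]) (auto simp: lift_def)
  qed (auto simp: lift_def)
  have lift_reduction: "lift (reduction ` L) = L" if L: "L \<in> ?T" for L
  proof (intro equalityI subsetI)
    fix x assume "x \<in> lift (reduction ` L)"
    then obtain y where x: "x \<in> supported B" and y: "y \<in> L" "reduction x = reduction y"
      by (auto simp: lift_def)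
    have "y \<in> supported B" using y(1) L by blast
    \<comment> \<open>Two vectors with equal reduction differ by \<open>T z\<close>. Writing
      \<open>z = a + w b\<close> with \<open>a\<close> and \<open>b\<close> in \<open>L\<close>
      gives T z = T a + (T w) b, and the coefficients \<open>T\<close> and \<open>T w\<close> lie in
      \<open>R\<close>.\<close>
    define z where "z = (\<lambda>i. fps_shift 1 (x i - y i))"
    have "z \<in> supported B" using x \<open>y \<in> supported B\<close> by (auto simp: z_def supported_def)
    hence "z \<in> fps.qspan L" using L by blast
    then obtain a b where ab: "a \<in> L" "b \<in> L" "z = a + scal (fps_const w) b" by (rule fps.qspanE)
    have "fps_nth (x i) 0 = fps_nth (y i) 0" for i
      using fun_cong[OF y(2), of i] by (simp add: reduction_def)
    hence "x - y = scal fps_X z"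
      by (intro ext fps_ext) (auto simp: z_def)
    also have "\<dots> = scal fps_X a + scal (fps_X * fps_const w) b"
      by (simp add: ab(3) scal_distribs scal_scal)
    also have "\<dots> \<in> L"
      using L ab zero_mem by (auto intro!: submod_add submod_scal simp: const_in_def)
    finally have "(x - y) + y \<in> L" using L y(1) submod_add by blast
    thus "x \<in> L" by simp
  qed (use L in \<open>auto simp: lift_def\<close>)
  have bij: "bij_betw lift (spanning B j) ?T"
  proof (rule bij_betwI[where g = "(`) reduction"])
    show "lift \<in> spanning B j \<rightarrow> ?T"
    proof
      fix V :: "('i \<Rightarrow> 'a) set" assume V: "V \<in> spanning B j"
      note V' = spanningD[OF V]
      have "x \<in> fps.qspan (lift V)" if x: "x \<in> supported B" for x
      proof -
        have "reduction x \<in> qspan V" using reduction_supported[OF x] V'(2) by simp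
        then obtain a b where ab: "a \<in> V" "b \<in> V" "reduction x = a + scal w b" by (rule qspanE)
        \<comment> \<open>With \<open>b\<close> lifted to a constant vector \<open>y\<close>, the
          remainder x - w y reduces to \<open>a\<close> and therefore lies in the preimage of
          \<open>V\<close>, as \<open>y\<close> does.\<close>
        define y :: "'i \<Rightarrow> 'a fps" where "y = (\<lambda>i. fps_const (b i))"
        have y: "y \<in> supported B" "reduction y = b"
          using const_supported ab(2) V'(4) by (auto simp: y_def)
        have "x - scal (fps_const w) y \<in> supported B"
          using submod_diff[OF submod_supported x submod_scal[OF submod_supported UNIV_I y(1)]] .
        hence "x - scal (fps_const w) y \<in> lift V" "y \<in> lift V"
          using y ab by (auto simp: lift_def)
        from fps.qspanI[OF this] show ?thesis by simp
      qed
      moreover have "fps.qspan (lift V) \<subseteq> supported B"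
        by (rule fps.qspan_least[OF submod_supported]) (auto simp: lift_def)
      ultimately have "fps.qspan (lift V) = supported B" by blast
      thus "lift V \<in> ?T"
        using submod_lift[OF V'(1)] index_lift[OF V'(1,4)] V'(3) by (auto simp: lift_def)
    qed
    show "(`) reduction \<in> ?T \<rightarrow> spanning B j"
    proof
      fix L assume L: "L \<in> ?T"
      have L': "submod (const_in k) L" "L \<subseteq> supported B" using L by auto
      have V: "submod k (reduction ` L)"
      proof (rule submodI)
        show "0 \<in> reduction ` L" using submod_zero[OF L'(1)] by (intro image_eqI[of _ _ 0]) auto
        show "x - y \<in> reduction ` L" if "x \<in> reduction ` L" "y \<in> reduction ` L" for x y
          using that submod_diff[OF L'(1)] by (auto simp flip: reduction_simps(2))
        show "scal c x \<in> reduction ` L" if x: "c \<in> k" "x \<in> reduction ` L" for c x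
        proof -
          obtain y where y: "y \<in> L" "x = reduction y" using x(2) by blast
          have "scal (fps_const c) y \<in> L"
            by (rule submod_scal[OF L'(1) _ y(1)]) (use x(1) in \<open>simp add: const_in_def\<close>)
          thus ?thesis by (rule image_eqI[rotated]) (simp add: y(2))
        qed
      qed
      have "qspan (reduction ` L) = reduction ` fps.qspan L"
      proof (intro equalityI subsetI)
        fix z assume "z \<in> qspan (reduction ` L)"
        then obtain x y where "x \<in> L" "y \<in> L" "z = reduction x + scal w (reduction y)"
          by (elim qspanE) auto
        thus "z \<in> reduction ` fps.qspan L"
          using fps.qspanI[of x L y] by (intro image_eqI[of _ _ "x + scal (fps_const w) y"]) auto
      next
        fix z assume "z \<in> reduction ` fps.qspan L"
        then obtain x y where "x \<in> L" "y \<in> L" "z = reduction (x + scal (fps_const w) y)"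
          by (elim imageE fps.qspanE) auto
        thus "z \<in> qspan (reduction ` L)" using qspanI[of "reduction x" "reduction ` L"] by simp
      qed
      hence "qspan (reduction ` L) = supported B" using L reduction_image_supported by simp
      moreover have "reduction ` L \<subseteq> supported B" using L'(2) reduction_supported by blast
      from index_lift[OF V this] have "card (reduction ` L) * card k ^ j = card k ^ (2 * card B)"
        using lift_reduction[OF L] L by simp
      ultimately show "reduction ` L \<in> spanning B j" using V by (simp add: spanning_def)
    qed
  next
    fix V :: "('i \<Rightarrow> 'a) set" assume "V \<in> spanning B j"
    thus "reduction ` lift V = V" by (rule reduction_lift[OF spanningD(4)])
  qed (rule lift_reduction)
  show "finite ?T" using bij_betw_finite[OF bij] finite_spanning[OF B] by simp
  show "card ?T = card (spanning B j :: ('i \<Rightarrow> 'a) set set)"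
    using bij_betw_same_card[OF bij] by simp
qed

text \<open>By freeness an S-linear bijection carries \<open>supported B\<close> to \<Lambda> and
  preserves spans, so the count does not depend on \<Lambda>.\<close>

lemma card_lattices_with_qspan:
  fixes \<Lambda> :: "('i \<Rightarrow> 'a fps) set"
  assumes B: "finite B" and \<Lambda>: "\<Lambda> \<in> sublattices UNIV (supported B) m"
  shows "finite {L. submod (const_in k) L \<and> L \<subseteq> \<Lambda> \<and> has_index \<Lambda> L (card k ^ j) \<and> fps.qspan L = \<Lambda>}"
    and "card {L. submod (const_in k) L \<and> L \<subseteq> \<Lambda> \<and> has_index \<Lambda> L (card k ^ j) \<and> fps.qspan L = \<Lambda>} =
      card (spanning B j :: ('i \<Rightarrow> 'a) set set)"
proof -
  obtain f where f: "linmap f" "inj_on f (supported B)" "f ` supported B = \<Lambda>"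
    using finite_index_free[OF B, of \<Lambda> m] \<Lambda> by (auto simp: sublattices_def)
  have "fps.qspan (f ` L) = \<Lambda> \<longleftrightarrow> fps.qspan L = supported B"
    if L: "submod (const_in k) L" "L \<subseteq> supported B" for L
  proof -
    have "fps.qspan (f ` L) = f ` fps.qspan L"
      by (rule fps.qspan_image) (simp add: linmapD[OF f(1)])
    moreover have "fps.qspan L \<subseteq> supported B" by (rule fps.qspan_least[OF submod_supported L(2)])
    ultimately show ?thesis using inj_on_image_eq_iff[OF f(2), of "fps.qspan L" "supported B"] f(3) by simp
  qed
  note qspan_iff = this
  have bij: "bij_betw ((`) f)
    {L. submod (const_in k) L \<and> L \<subseteq> supported B \<and> has_index (supported B) L (card k ^ j) \<and>
      fps.qspan L = supported B}
    {L. submod (const_in k) L \<and> L \<subseteq> \<Lambda> \<and> has_index \<Lambda> L (card k ^ j) \<and> fps.qspan L = \<Lambda>}"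
    using bij_betw_linmap_image[OF f(1,2) submod_supported,
        where P = "\<lambda>L. fps.qspan L = \<Lambda>" and Q = "\<lambda>L. fps.qspan L = supported B"] qspan_iff
    by (simp add: f(3))
  show "finite {L. submod (const_in k) L \<and> L \<subseteq> \<Lambda> \<and> has_index \<Lambda> L (card k ^ j) \<and> fps.qspan L = \<Lambda>}"
    using bij_betw_finite[OF bij] card_spanning_lattices(1)[OF B] by simp
  show "card {L. submod (const_in k) L \<and> L \<subseteq> \<Lambda> \<and> has_index \<Lambda> L (card k ^ j) \<and> fps.qspan L = \<Lambda>} =
      card (spanning B j :: ('i \<Rightarrow> 'a) set set)"
    using bij_betw_same_card[OF bij] card_spanning_lattices(2)[OF B] by simp
qed

text \<open>Sorting by the S-span turns multiplicativity of the index into a convolution. Indices of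
  S-submodules are powers of q^2, so the terms with odd \<open>i\<close> are zero; they are kept to
  have one exponent base.\<close>

lemma card_sublattices_supported:
  fixes B :: "'i set"
  assumes B: "finite B"
    and fin: "\<And>m. finite (sublattices UNIV (supported B :: ('i \<Rightarrow> 'a fps) set) m)"
  shows "finite (sublattices k (supported B :: ('i \<Rightarrow> 'a fps) set) (card k ^ e))"
    and "card (sublattices k (supported B :: ('i \<Rightarrow> 'a fps) set) (card k ^ e)) =
      (\<Sum>i\<le>e. card (sublattices UNIV (supported B :: ('i \<Rightarrow> 'a fps) set) (card k ^ i)) *
        card (spanning B (e - i) :: ('i \<Rightarrow> 'a) set set))"
proof -
  let ?U = "supported B :: ('i \<Rightarrow> 'a fps) set"
  let ?Z = "\<lambda>i. sublattices UNIV ?U (card k ^ i)"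
  have q: "card k \<ge> 2" by (rule card_k)
  define D where "D \<Lambda> j = {L. submod (const_in k) L \<and> L \<subseteq> \<Lambda> \<and> has_index \<Lambda> L (card k ^ j) \<and>
    fps.qspan L = \<Lambda>}" for \<Lambda> :: "('i \<Rightarrow> 'a fps) set" and j
  have D: "finite (D \<Lambda> j)" "card (D \<Lambda> j) = card (spanning B j :: ('i \<Rightarrow> 'a) set set)"
    if "\<Lambda> \<in> ?Z i" for \<Lambda> i j
    using card_lattices_with_qspan[OF B that] by (auto simp: D_def)
  have sa: "add_subgroup ?U" by (rule submod_add_subgroup[OF submod_supported])
  have eq: "sublattices k ?U (card k ^ e) = (\<Union>i\<in>{..e}. \<Union>\<Lambda>\<in>?Z i. D \<Lambda> (e - i))"
  proof (intro equalityI subsetI)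
    fix L assume "L \<in> sublattices k ?U (card k ^ e)"
    hence L: "submod (const_in k) L" "L \<subseteq> ?U" "has_index ?U L (card k ^ e)"
      by (auto simp: sublattices_def)
    define \<Lambda> where "\<Lambda> = fps.qspan L"
    have \<Lambda>: "submod UNIV \<Lambda>" "L \<subseteq> \<Lambda>" "\<Lambda> \<subseteq> ?U"
      using fps.submod_qspan[OF L(1)] fps.qspan_superset[OF L(1)]
        fps.qspan_least[OF submod_supported L(2)] by (auto simp: \<Lambda>_def)
    obtain a b where ab: "has_index ?U \<Lambda> a" "has_index \<Lambda> L b" "card k ^ e = a * b"
      by (rule has_index_factor[OF submod_add_subgroup[OF L(1)] submod_add_subgroup[OF \<Lambda>(1)] sa \<Lambda>(2,3) L(3)])
    have k\<Lambda>: "submod (const_in k) \<Lambda>" by (rule submod_mono[OF \<Lambda>(1)]) simp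
    obtain i j where ij: "a = card k ^ i" "b = card k ^ j"
      using has_index_power_lattice[OF finite_scalar_field_axioms submod_supported k\<Lambda> \<Lambda>(3) ab(1)]
        has_index_power_lattice[OF finite_scalar_field_axioms k\<Lambda> L(1) \<Lambda>(2) ab(2)] by blast
    have "card k ^ e = card k ^ (i + j)" using ab(3) ij by (simp add: power_add)
    hence e: "e = i + j" using q by (simp add: power_inject_exp)
    have "\<Lambda> \<in> ?Z i" using \<Lambda> ab(1) ij by (simp add: sublattices_def)
    moreover have "L \<in> D \<Lambda> (e - i)" using L(1) \<Lambda>(2) ab(2) ij(2) e by (simp add: D_def \<Lambda>_def)
    moreover have "i \<in> {..e}" using e by simp
    ultimately show "L \<in> (\<Union>i\<in>{..e}. \<Union>\<Lambda>\<in>?Z i. D \<Lambda> (e - i))" by blast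
  next
    fix L assume "L \<in> (\<Union>i\<in>{..e}. \<Union>\<Lambda>\<in>?Z i. D \<Lambda> (e - i))"
    then obtain i \<Lambda> where i: "i \<le> e" and *: "\<Lambda> \<in> ?Z i" "L \<in> D \<Lambda> (e - i)" by blast
    hence \<Lambda>: "submod UNIV \<Lambda>" "\<Lambda> \<subseteq> ?U" "has_index ?U \<Lambda> (card k ^ i)"
      and L: "submod (const_in k) L" "L \<subseteq> \<Lambda>" "has_index \<Lambda> L (card k ^ (e - i))"
      by (auto simp: sublattices_def D_def)
    have "has_index ?U L (card k ^ i * card k ^ (e - i))"
      by (rule has_index_mult[OF submod_add_subgroup[OF L(1)] submod_add_subgroup[OF \<Lambda>(1)] sa
            L(2) \<Lambda>(2,3) L(3)])
    hence "has_index ?U L (card k ^ e)" using i by (simp flip: power_add)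
    thus "L \<in> sublattices k ?U (card k ^ e)" using L \<Lambda>(2) by (auto simp: sublattices_def)
  qed
  have finD: "finite (\<Union>\<Lambda>\<in>?Z i. D \<Lambda> j)" for i j using fin D(1) by blast
  have disj: "D \<Lambda> i \<inter> D \<Lambda>' i' = {}" if "\<Lambda> \<noteq> \<Lambda>'" for \<Lambda> \<Lambda>' i i' using that by (auto simp: D_def)
  have disjZ: "\<Lambda> \<noteq> \<Lambda>'" if "\<Lambda> \<in> ?Z i" "\<Lambda>' \<in> ?Z i'" "i \<noteq> i'" for \<Lambda> \<Lambda>' i i'
  proof
    assume "\<Lambda> = \<Lambda>'"
    hence "card k ^ i = card k ^ i'" using that has_index_unique[of ?U \<Lambda>] by (auto simp: sublattices_def)
    thus False using q that(3) by (simp add: power_inject_exp)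
  qed
  show "finite (sublattices k ?U (card k ^ e))" unfolding eq using finD by blast
  have "card (sublattices k ?U (card k ^ e)) = (\<Sum>i\<le>e. card (\<Union>\<Lambda>\<in>?Z i. D \<Lambda> (e - i)))"
    unfolding eq
  proof (rule card_UN_disjoint)
    show "\<forall>i\<in>{..e}. \<forall>i'\<in>{..e}. i \<noteq> i' \<longrightarrow>
        (\<Union>\<Lambda>\<in>?Z i. D \<Lambda> (e - i)) \<inter> (\<Union>\<Lambda>\<in>?Z i'. D \<Lambda> (e - i')) = {}"
    proof (intro ballI impI)
      fix i i' :: nat assume "i \<noteq> i'"
      hence "D \<Lambda> (e - i) \<inter> D \<Lambda>' (e - i') = {}" if "\<Lambda> \<in> ?Z i" "\<Lambda>' \<in> ?Z i'" for \<Lambda> \<Lambda>'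
        using disj disjZ that by metis
      thus "(\<Union>\<Lambda>\<in>?Z i. D \<Lambda> (e - i)) \<inter> (\<Union>\<Lambda>\<in>?Z i'. D \<Lambda> (e - i')) = {}" by blast
    qed
  qed (use finD in auto)
  also have "\<dots> = (\<Sum>i\<le>e. \<Sum>\<Lambda>\<in>?Z i. card (D \<Lambda> (e - i)))"
    by (intro sum.cong refl card_UN_disjoint) (use fin D(1) disj in auto)
  also have "\<dots> = (\<Sum>i\<le>e. card (?Z i) * card (spanning B (e - i) :: ('i \<Rightarrow> 'a) set set))"
    using D(2) by (intro sum.cong) auto
  finally show "card (sublattices k ?U (card k ^ e)) =
      (\<Sum>i\<le>e. card (?Z i) * card (spanning B (e - i) :: ('i \<Rightarrow> 'a) set set))" .
qed

section \<open>Finiteness and recursions for the numbers of sublattices\<close>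

lemma finite_sublattices_UNIV:
  fixes B :: "'i set"
  assumes "finite B"
  shows "finite (sublattices UNIV (supported B :: ('i \<Rightarrow> 'a fps) set) m)"
  using assms
proof (induction B arbitrary: m rule: finite_induct)
  case empty
  have E: "supported {} = {0 :: 'i \<Rightarrow> 'a fps}" by (auto simp: supported_def fun_eq_iff)
  have "sublattices UNIV (supported {} :: ('i \<Rightarrow> 'a fps) set) m \<subseteq> Pow {0}"
    unfolding sublattices_def E by blast
  thus ?case by (rule finite_subset) simp
next
  case (insert p B)
  have q: "card (UNIV :: 'a set) \<ge> 2" by (rule finite_scalar_field.card_scalars[OF finite_scalar_field_UNIV]) simp
  show ?case
  \<comment> \<open>Over \<open>S\<close> the division by \<open>T\<close> returns to the same
    module with the index divided by q^2, so a second induction on \<open>m\<close> is needed. Index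
    0 would not decrease and is treated apart.\<close>
  proof (induction m rule: less_induct)
    case (less m)
    show ?case
    proof (cases "m = 0")
      case True
      have "sublattices UNIV (mixed_lattice UNIV {} (insert p B) :: ('i \<Rightarrow> 'a fps) set) 0 = {}"
        by (rule sublattices_zero[OF finite_scalar_field.axioms(1)[OF finite_scalar_field_UNIV]])
      thus ?thesis using True by (simp add: mixed_lattice_empty)
    next
      case False
      have "finite (sublattices UNIV (mixed_lattice UNIV (insert p {}) B :: ('i \<Rightarrow> 'a fps) set) m)"
      proof (rule card_sublattices_insert(1)[OF finite_scalar_field_UNIV])
        show "finite (sublattices UNIV (mixed_lattice UNIV {} B :: ('i \<Rightarrow> 'a fps) set) m)"
          using insert.IH by (simp add: mixed_lattice_empty)
        show "finite (sublattices UNIV (mixed_lattice UNIV {} (insert p B) :: ('i \<Rightarrow> 'a fps) set)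
            (m div card (UNIV :: 'a set)))"
          using less[of "m div card (UNIV :: 'a set)"] False q by (simp add: mixed_lattice_empty)
      qed (use insert.hyps in auto)
      thus ?thesis by (simp add: mixed_lattice_UNIV)
    qed
  qed
qed

text \<open>With all constants allowed, inserting \<open>p\<close> into the first or the second set
  of coordinates gives the same lattice, so the recursion refers to itself. The step is 2 because
  the residue field of \<open>S\<close> has q^2 elements.\<close>

lemma card_sublattices_UNIV_insert:
  fixes B :: "'i set"
  assumes "finite B" "p \<notin> B"
  shows "card (sublattices UNIV (supported (insert p B) :: ('i \<Rightarrow> 'a fps) set) (card k ^ e)) =
    card k ^ e * card (sublattices UNIV (supported B :: ('i \<Rightarrow> 'a fps) set) (card k ^ e)) +
    (if e \<ge> 2 then card (sublattices UNIV (supported (insert p B) :: ('i \<Rightarrow> 'a fps) set) (card k ^ (e - 2)))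
     else 0)"
proof -
  have q: "card k \<ge> 2" by (rule card_k)
  have "card (UNIV :: 'a set) dvd card k ^ e \<longleftrightarrow> e \<ge> 2"
    unfolding card_UNIV using q power_dvd_imp_le[of "card k" 2 e] le_imp_power_dvd[of 2 e "card k"] by auto
  moreover have "card k ^ e div card (UNIV :: 'a set) = card k ^ (e - 2)" if "e \<ge> 2"
    unfolding card_UNIV by (rule power_diff[symmetric]) (use q that in linarith)+
  moreover have "card (sublattices UNIV (mixed_lattice UNIV (insert p {}) B :: ('i \<Rightarrow> 'a fps) set) (card k ^ e)) =
      card k ^ e * card (sublattices UNIV (mixed_lattice UNIV {} B :: ('i \<Rightarrow> 'a fps) set) (card k ^ e)) +
      (if card (UNIV :: 'a set) dvd card k ^ e then
        card (sublattices UNIV (mixed_lattice UNIV {} (insert p B) :: ('i \<Rightarrow> 'a fps) set)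
          (card k ^ e div card (UNIV :: 'a set))) else 0)"
    by (rule card_sublattices_insert(2)[OF finite_scalar_field_UNIV])
      (use assms finite_sublattices_UNIV[of B] finite_sublattices_UNIV[of "insert p B"]
        in \<open>auto simp: mixed_lattice_empty\<close>)
  ultimately show ?thesis by (auto simp: mixed_lattice_empty mixed_lattice_UNIV)
qed

lemma finite_sublattices_lattice:
  fixes A B :: "'i set"
  assumes "finite A" "finite B" "A \<inter> B = {}"
  shows "finite (sublattices k (mixed_lattice k A B :: ('i \<Rightarrow> 'a fps) set) m)"
  using assms
proof (induction A arbitrary: B m rule: finite_induct)
  case empty
  show ?case
  proof (cases "\<exists>e. m = card k ^ e")
    case True
    thus ?thesis
      using card_sublattices_supported(1)[OF empty.prems(1) finite_sublattices_UNIV[OF empty.prems(1)]]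
      by (auto simp: mixed_lattice_empty)
  next
    case False
    have "L \<notin> sublattices k (supported B) m" for L :: "('i \<Rightarrow> 'a fps) set"
    proof
      assume "L \<in> sublattices k (supported B) m"
      hence "submod (const_in k) L" "L \<subseteq> supported B" "has_index (supported B) L m"
        by (auto simp: sublattices_def)
      from has_index_power_lattice[OF finite_scalar_field_axioms submod_supported this] False
      show False by blast
    qed
    hence "sublattices k (supported B :: ('i \<Rightarrow> 'a fps) set) m = {}" by blast
    thus ?thesis by (simp add: mixed_lattice_empty)
  qed
next
  case (insert p A)
  show ?case
    by (rule card_sublattices_insert(1)[OF finite_scalar_field_axioms])
      (use insert.IH insert.prems insert.hyps in auto)
qed

text \<open>The step in the exponent is 1 here, since the residue field of \<open>R\<close> is
  \<open>k\<close>; the divided coordinate now belongs to \<open>B\<close>.\<close>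

lemma card_sublattices_lattice_insert:
  fixes A B :: "'i set"
  assumes "finite A" "finite B" "A \<inter> B = {}" "p \<notin> A \<union> B"
  shows "card (sublattices k (mixed_lattice k (insert p A) B :: ('i \<Rightarrow> 'a fps) set) (card k ^ e)) =
    card k ^ e * card (sublattices k (mixed_lattice k A B :: ('i \<Rightarrow> 'a fps) set) (card k ^ e)) +
    (if e \<ge> 1 then card (sublattices k (mixed_lattice k A (insert p B) :: ('i \<Rightarrow> 'a fps) set) (card k ^ (e - 1)))
     else 0)"
proof -
  have q: "card k \<ge> 2" by (rule card_k)
  have "card k dvd card k ^ e \<longleftrightarrow> e \<ge> 1"
    using q power_dvd_imp_le[of "card k" 1 e] le_imp_power_dvd[of 1 e "card k"] by auto
  moreover have "card k ^ e div card k = card k ^ (e - 1)" if "e \<ge> 1"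
    using q that by (cases e) auto
  ultimately show ?thesis
    using card_sublattices_insert(2)[OF finite_scalar_field_axioms assms(4), of "card k ^ e"]
      finite_sublattices_lattice[of A B] finite_sublattices_lattice[of A "insert p B"] assms by auto
qed

end

section \<open>Comparison with the modules of the statement\<close>

lemma image_a_r_coset:
  assumes "\<And>h. h \<in> L \<Longrightarrow> f (h \<oplus>\<^bsub>M\<^esub> x) = f h + f x"
  shows "f ` (L +>\<^bsub>M\<^esub> x) = add_coset (f ` L) (f x)"
proof (intro equalityI subsetI)
  fix z assume "z \<in> f ` (L +>\<^bsub>M\<^esub> x)"
  then obtain h where "h \<in> L" "z = f (h \<oplus>\<^bsub>M\<^esub> x)" by (auto simp: a_r_coset_def')
  thus "z \<in> add_coset (f ` L) (f x)" using assms by (simp add: add_coset_def)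
next
  fix z assume "z \<in> add_coset (f ` L) (f x)"
  then obtain h where h: "h \<in> L" "z - f x = f h" by (auto simp: add_coset_def)
  hence "z = f (h \<oplus>\<^bsub>M\<^esub> x)" using assms[OF h(1)] by (simp add: algebra_simps)
  thus "z \<in> f ` (L +>\<^bsub>M\<^esub> x)" using h(1) by (auto simp: a_r_coset_def')
qed

text \<open>
  The elements of the free module are undefined, rather than zero, outside \<open>{..<n}\<close>.
\<close>

lemma card_finite_index_submodules:
  fixes k :: "'a::field set"
  assumes k: "subfield k (ring_on UNIV)" and sr: "scalar_ring k"
  shows "card (finite_index_submodules (R22 k) (free_module (R22 k) n) m) =
    card (sublattices k (mixed_lattice k {..<n} {} :: (nat \<Rightarrow> 'a fps) set) m)"
proof -
  define R where "R = R22 k"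
  define M where "M = free_module R n"
  define U :: "(nat \<Rightarrow> 'a fps) set" where "U = mixed_lattice k {..<n} {}"
  define f :: "(nat \<Rightarrow> 'a fps) \<Rightarrow> nat \<Rightarrow> 'a fps" where "f x = (\<lambda>i. if i < n then x i else 0)" for x
  interpret module R M unfolding R_def M_def by (rule module_R22[OF k])
  interpret c: scalar_ring "const_in k" by (rule scalar_ring_const_in[OF sr])
  have cR: "carrier R = const_in k" by (simp add: R_def R22_def const_in_def)
  have mR: "a \<otimes>\<^bsub>R\<^esub> b = a * b" "a \<oplus>\<^bsub>R\<^esub> b = a + b" "\<zero>\<^bsub>R\<^esub> = 0" for a b
    by (simp_all add: R_def R22_def)
  have cM: "carrier M = {..<n} \<rightarrow>\<^sub>E const_in k" by (simp add: M_def cR)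
  have fM: "f (x \<oplus>\<^bsub>M\<^esub> y) = f x + f y" "f (a \<odot>\<^bsub>M\<^esub> x) = scal a (f x)" "f \<zero>\<^bsub>M\<^esub> = 0" for a x y
    by (auto simp: f_def M_def mR fun_eq_iff)
  have fU: "bij_betw f (carrier M) U"
    by (rule bij_betwI[where g = "\<lambda>x. restrict x {..<n}"])
      (auto simp: cM U_def f_def mixed_lattice_def supported_def PiE_iff extensional_def fun_eq_iff)
  have inj: "inj_on f (carrier M)" and img: "f ` carrier M = U"
    using fU by (auto simp: bij_betw_def)
  have U: "submod (const_in k) U" unfolding U_def by (rule submod_lattice[OF sr])
  have submodule_iff: "submodule L R M \<longleftrightarrow> submod (const_in k) (f ` L)" if L: "L \<subseteq> carrier M" for L
  proof
    assume S: "submodule L R M"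
    note SE = submoduleE[OF S]
    have sc: "scal c u \<in> f ` L" if "c \<in> const_in k" "u \<in> f ` L" for c u
      using that SE(4) by (auto simp: cR simp flip: fM(2))
    show "submod (const_in k) (f ` L)"
    proof (rule submodI)
      show diff: "u - v \<in> f ` L" if uv: "u \<in> f ` L" "v \<in> f ` L" for u v
      proof -
        have "scal (- 1) v \<in> f ` L" by (rule sc[OF c.uminus_mem[OF c.one_mem] uv(2)])
        then obtain x y where xy: "x \<in> L" "y \<in> L" "u = f x" "scal (- 1) v = f y"
          using uv(1) by blast
        have "u - v = f (x \<oplus>\<^bsub>M\<^esub> y)" unfolding fM(1) xy(3) xy(4)[symmetric] by simp
        thus ?thesis using SE(5)[OF xy(1,2)] by blast
      qed
      show "0 \<in> f ` L" using SE(2) diff by fastforce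
    qed (rule sc)
  next
    assume S: "submod (const_in k) (f ` L)"
    have mem: "x \<in> L" if "f x \<in> f ` L" "x \<in> carrier M" for x
      using that L inj by (auto simp: inj_on_def)
    have sc: "a \<odot>\<^bsub>M\<^esub> x \<in> L" if "a \<in> carrier R" "x \<in> L" for a x
    proof (rule mem)
      show "f (a \<odot>\<^bsub>M\<^esub> x) \<in> f ` L" using submod_scal[OF S] that by (simp add: fM(2) cR)
    qed (use that L in auto)
    show "submodule L R M"
    proof (rule submoduleI)
      show "\<zero>\<^bsub>M\<^esub> \<in> L" by (rule mem) (use submod_zero[OF S] in \<open>auto simp: fM(3)\<close>)
      show "x \<oplus>\<^bsub>M\<^esub> y \<in> L" if "x \<in> L" "y \<in> L" for x y
        by (rule mem) (use submod_add[OF S] that L in \<open>auto simp: fM(1)\<close>)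
      show "\<ominus>\<^bsub>M\<^esub> x \<in> L" if "x \<in> L" for x
      proof -
        have xM: "x \<in> carrier M" using that L by blast
        have "\<ominus>\<^bsub>M\<^esub> x = (\<ominus>\<^bsub>R\<^esub> \<one>\<^bsub>R\<^esub>) \<odot>\<^bsub>M\<^esub> x" using xM by (simp add: smult_l_minus)
        thus ?thesis using sc[of "\<ominus>\<^bsub>R\<^esub> \<one>\<^bsub>R\<^esub>" x] that by simp
      qed
    qed (use L sc in auto)
  qed
  have index_iff: "finite (a_rcosets\<^bsub>M\<^esub> L) \<and> card (a_rcosets\<^bsub>M\<^esub> L) = m \<longleftrightarrow> has_index U (f ` L) m"
    if L: "L \<subseteq> carrier M" for L
  proof -
    have coset_img: "f ` (L +>\<^bsub>M\<^esub> x) = add_coset (f ` L) (f x)" for x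
      by (rule image_a_r_coset) (simp add: fM(1))
    have coset_sub: "L +>\<^bsub>M\<^esub> x \<subseteq> carrier M" if "x \<in> carrier M" for x
      using that L by (auto simp: a_r_coset_def')
    obtain h where h: "bij_betw h ((\<lambda>x. L +>\<^bsub>M\<^esub> x) ` carrier M) ((\<lambda>x. add_coset (f ` L) (f x)) ` carrier M)"
    proof (rule bij_betw_images)
      fix x y assume "x \<in> carrier M" "y \<in> carrier M"
      thus "L +>\<^bsub>M\<^esub> x = L +>\<^bsub>M\<^esub> y \<longleftrightarrow> add_coset (f ` L) (f x) = add_coset (f ` L) (f y)"
        using inj_on_image_eq_iff[OF inj coset_sub coset_sub] by (simp flip: coset_img)
    qed blast
    have "a_rcosets\<^bsub>M\<^esub> L = (\<lambda>x. L +>\<^bsub>M\<^esub> x) ` carrier M" by (auto simp: A_RCOSETS_def')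
    moreover have "(\<lambda>x. add_coset (f ` L) (f x)) ` carrier M = add_coset (f ` L) ` U"
      by (simp add: image_image flip: img)
    ultimately show ?thesis
      using bij_betw_finite[OF h] bij_betw_same_card[OF h] by (simp add: has_index_def)
  qed
  have "bij_betw ((`) f) (finite_index_submodules R M m) (sublattices k U m)"
    unfolding bij_betw_def
  proof
    have sub: "L \<subseteq> carrier M" if "L \<in> finite_index_submodules R M m" for L
      using that submoduleE(1) by (auto simp: finite_index_submodules_def)
    show "inj_on ((`) f) (finite_index_submodules R M m)"
      using inj_on_image_eq_iff[OF inj] sub by (intro inj_onI) blast
    show "(`) f ` finite_index_submodules R M m = sublattices k U m"
    proof (intro equalityI subsetI)
      fix N assume "N \<in> (`) f ` finite_index_submodules R M m"
      then obtain L where L: "L \<in> finite_index_submodules R M m" "N = f ` L" by blast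
      hence "submodule L R M" "finite (a_rcosets\<^bsub>M\<^esub> L) \<and> card (a_rcosets\<^bsub>M\<^esub> L) = m"
        by (auto simp: finite_index_submodules_def)
      hence "submod (const_in k) N" "has_index U N m"
        using submodule_iff[OF sub[OF L(1)]] index_iff[OF sub[OF L(1)]] L(2) by auto
      thus "N \<in> sublattices k U m" using sub[OF L(1)] img L(2) by (auto simp: sublattices_def)
    next
      fix N assume N: "N \<in> sublattices k U m"
      hence "N \<subseteq> f ` carrier M" using img by (simp add: sublattices_def)
      then obtain L where L: "L \<subseteq> carrier M" "N = f ` L" by (auto simp: subset_image_iff)
      hence "L \<in> finite_index_submodules R M m"
        using submodule_iff[OF L(1)] index_iff[OF L(1)] N
        by (simp add: finite_index_submodules_def sublattices_def)
      thus "N \<in> (`) f ` finite_index_submodules R M m" using L(2) by blast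
    qed
  qed
  from bij_betw_same_card[OF this] show ?thesis by (simp add: R_def M_def U_def)
qed

section \<open>Generating functions\<close>

text \<open>The exponents are integers because \<open>l\<close> may exceed \<open>b\<close>. For
  \<open>j > b\<close> the factor at \<open>l = b\<close> is 0, which fits the geometry: a spanning
  subspace has k-dimension 2b - j at least b.\<close>

definition spanning_count :: "rat \<Rightarrow> nat \<Rightarrow> nat \<Rightarrow> rat" where
  "spanning_count q b j =
    q ^ (j choose 2) * (\<Prod>l<j. (q powi (2 * (int b - int l)) - 1) / (q ^ Suc l - 1))"

lemma spanning_count_0: "spanning_count q b 0 = 1"
  by (simp add: spanning_count_def numeral_2_eq_2)

lemma spanning_count_Suc:
  "spanning_count q b (Suc j) =
    spanning_count q b j * q ^ j * (q powi (2 * (int b - int j)) - 1) / (q ^ Suc j - 1)"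
  by (simp add: spanning_count_def numeral_2_eq_2 power_add)

lemma spanning_count_Suc_Suc:
  "spanning_count q (Suc b) (Suc j) =
    spanning_count q b j * q ^ j * (q ^ (2 * Suc b) - 1) / (q ^ Suc j - 1)"
proof -
  have "(\<Prod>l<Suc j. q powi (2 * (int (Suc b) - int l)) - 1) =
      (q ^ (2 * Suc b) - 1) * (\<Prod>l<j. q powi (2 * (int b - int l)) - 1)"
    using power_int_of_nat[of q "2 * Suc b"]
    by (simp add: prod.lessThan_Suc_shift algebra_simps del: prod.lessThan_Suc power_int_of_nat)
  moreover have "(\<Prod>l<Suc j. q ^ Suc l - 1) = (\<Prod>l<j. q ^ Suc l - 1) * (q ^ Suc j - 1)" by simp
  ultimately show ?thesis
    unfolding spanning_count_def prod_dividef by (simp add: numeral_2_eq_2 power_add)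
qed

lemma spanning_count_eq_0: "j > b \<Longrightarrow> spanning_count q b j = 0"
  by (auto simp: spanning_count_def intro!: prod_zero bexI[of _ b])

text \<open>The recursion for spanning subspaces, with integer exponents in place of truncated
  differences so that it holds for all \<open>b\<close> and \<open>j\<close>.\<close>

lemma spanning_count_rec:
  fixes q :: rat
  assumes q: "q > 1"
  shows "spanning_count q (Suc b) j = spanning_count q b j
    + (if j \<ge> 1 then (q + 1) * spanning_count q b (j - 1) * q powi (2 * int b - (int j - 1)) else 0)
    + (if j \<ge> 2 then spanning_count q b (j - 2) * (q powi (2 * (2 * int b - (int j - 2))) - q ^ (2 * b)) else 0)"
proof (cases j)
  case 0
  thus ?thesis by (simp add: spanning_count_0)
next
  case (Suc i)
  show ?thesis
  proof (cases i)
    case 0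
    have "q powi (2 * int b) = q ^ (2 * b)" "q powi (2 + 2 * int b) = q ^ (2 + 2 * b)"
      using power_int_of_nat[of q "2 * b"] power_int_of_nat[of q "2 + 2 * b"] by simp_all
    thus ?thesis
      using q by (simp add: Suc 0 spanning_count_Suc spanning_count_Suc_Suc spanning_count_0
          divide_simps power2_eq_square) (simp add: algebra_simps)
  next
    case (Suc i')
    \<comment> \<open>In terms of \<open>a\<close>, \<open>x = q^(2(b - i'))\<close> and
      \<open>S\<close>, every term is \<open>S\<close> times a rational function of
      \<open>q\<close>, \<open>a\<close> and \<open>x\<close>; the recursion becomes an identity of
      such functions.\<close>
    define a where "a = q ^ i'"
    define d where "d = int b - int i'"
    define x where "x = q powi (2 * d)"
    define S where "S = spanning_count q b i'"
    have q0: "q \<noteq> 0" using q by simp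
    have b: "int b = int i' + d" and j: "j = Suc (Suc i')"
      by (simp_all add: d_def \<open>j = Suc i\<close> \<open>i = Suc i'\<close>)
    have a1: "a * q \<noteq> 1" "a * q * q \<noteq> 1"
    proof -
      have "q ^ Suc i' > 1" "q ^ Suc (Suc i') > 1" using q by (intro one_less_power; simp)+
      thus "a * q \<noteq> 1" "a * q * q \<noteq> 1" by (auto simp: a_def mult_ac)
    qed
    have P: "q powi (u + v) = q powi u * q powi v" for u v using q0 by (simp add: power_int_add)
    have A: "q powi (int i') = a" by (simp add: a_def)
    have x0: "q powi (2 * (int b - int i')) = x"
      by (simp add: x_def d_def)
    have x1: "q powi (2 * (int b - int (Suc i'))) = x / q ^ 2"
    proof -
      have eq: "2 * (int b - int (Suc i')) = 2 * d - 2" by (simp add: b)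
      show ?thesis unfolding eq using q0 by (simp add: x_def power_int_diff)
    qed
    have x2: "q powi (2 * int b - (int j - 1)) = x * a / q"
    proof -
      have eq: "2 * int b - (int j - 1) = 2 * d + int i' - 1" by (simp add: b j)
      show ?thesis unfolding eq using q0 by (simp add: x_def a_def power_int_add power_int_diff)
    qed
    have x3: "q powi (2 * (2 * int b - (int j - 2))) = (x * a) ^ 2"
    proof -
      have eq: "2 * (2 * int b - (int j - 2)) = (2 * d + int i') + (2 * d + int i')"
        by (simp add: b j)
      show ?thesis unfolding eq P A x_def[symmetric] by (simp add: power2_eq_square)
    qed
    have x4: "q ^ (2 * b) = x * a ^ 2"
    proof -
      have eq: "int (2 * b) = 2 * d + (int i' + int i')" by (simp add: b)
      have "q powi int (2 * b) = x * a ^ 2"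
        unfolding eq P A x_def[symmetric] by (simp add: power2_eq_square)
      thus ?thesis by (simp only: power_int_of_nat)
    qed
    have S1: "spanning_count q b (Suc i') = S * a * (x - 1) / (a * q - 1)"
      by (simp only: spanning_count_Suc x0) (simp add: S_def a_def mult.commute)
    have S2: "spanning_count q b j = S * a * (x - 1) / (a * q - 1) * (a * q) * (x / q ^ 2 - 1) / (a * q * q - 1)"
      unfolding j spanning_count_Suc[of q b "Suc i'"] x1 S1 by (simp add: a_def mult_ac)
    have S3: "spanning_count q (Suc b) j =
        S * a * (x - 1) / (a * q - 1) * (a * q) * (x * a ^ 2 * q ^ 2 - 1) / (a * q * q - 1)"
    proof -
      have "q ^ (2 * Suc b) = x * a ^ 2 * q ^ 2" using x4 by (simp add: power2_eq_square)
      thus ?thesis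
        unfolding j spanning_count_Suc_Suc[of q b "Suc i'"] S1 by (simp add: a_def mult_ac)
    qed
    have S4: "spanning_count q b (j - 1) = S * a * (x - 1) / (a * q - 1)"
      "spanning_count q b (j - 2) = S"
      using S1 by (simp_all add: j S_def)
    have "a * q - 1 \<noteq> 0" "a * q * q - 1 \<noteq> 0" using a1 by auto
    hence "spanning_count q (Suc b) j = spanning_count q b j
      + (q + 1) * spanning_count q b (j - 1) * (x * a / q)
      + spanning_count q b (j - 2) * ((x * a) ^ 2 - x * a ^ 2)"
      unfolding S2 S3 S4 using q0
      by (simp add: divide_simps) (simp add: algebra_simps power2_eq_square)
    thus ?thesis unfolding x2 x3 x4 by (simp add: j)
  qed
qed

section \<open>Gaussian binomials and dilated generating series\<close>

lemma qpoch_Suc: "qpoch a x (Suc n) = qpoch a x n * (1 - a * x ^ n)"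
  by (simp add: qpoch_def)

lemma qbinom_0: "qpoch x x n \<noteq> 0 \<Longrightarrow> qbinom x n 0 = 1"
  by (simp add: qbinom_def) (simp add: qpoch_def)

lemma qbinom_pascal:
  fixes x :: "'a::field"
  assumes nz: "\<And>m. qpoch x x m \<noteq> 0" and "i \<le> n"
  shows "qbinom x (Suc n) (Suc i) = x ^ (n - i) * qbinom x n i + qbinom x n (Suc i)"
proof (cases "i = n")
  case True
  thus ?thesis using nz[of 0] nz[of n] nz[of "Suc n"] by (simp add: qbinom_def qpoch_def)
next
  case False
  define m where "m = n - Suc i"
  have n: "n = Suc (i + m)" using False assms(2) by (simp add: m_def)
  have "1 - x * x ^ i \<noteq> 0" "1 - x * x ^ m \<noteq> 0" using nz[of "Suc i"] nz[of "Suc m"] by (auto simp: qpoch_Suc)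
  thus ?thesis
    using nz[of i] nz[of m] unfolding n
    by (simp add: qbinom_def qpoch_Suc Suc_diff_le divide_simps) (simp add: algebra_simps power_add)
qed

text \<open>The Gaussian binomial in base \<open>q\<close>, which is what the lattice recursion
  produces, written through base 1/q, which is what the claim uses.\<close>

definition gauss_binomial :: "rat \<Rightarrow> nat \<Rightarrow> nat \<Rightarrow> rat" where
  "gauss_binomial q n i = q ^ (i * (n - i)) * qbinom (inverse q) n i"

lemma qpoch_inverse_nonzero:
  fixes q :: rat
  assumes "q > 1"
  shows "qpoch (inverse q) (inverse q) m \<noteq> 0"
proof -
  have "inverse q * inverse q ^ l < 1" for l
    using power_Suc_less_one[of "inverse q" l] assms by (simp add: field_simps inverse_less_1_iff)
  hence "1 - inverse q * inverse q ^ l \<noteq> 0" for l by (metis diff_gt_0_iff_gt less_irrefl)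
  thus ?thesis by (simp add: qpoch_def)
qed

lemma gauss_binomial_simps:
  fixes q :: rat
  assumes q: "q > 1"
  shows "gauss_binomial q n 0 = 1" and "i > n \<Longrightarrow> gauss_binomial q n i = 0"
    and "gauss_binomial q (Suc n) (Suc i) = gauss_binomial q n i + q ^ Suc i * gauss_binomial q n (Suc i)"
proof -
  note nz = qpoch_inverse_nonzero[OF q]
  show "gauss_binomial q n 0 = 1" using qbinom_0[OF nz] by (simp add: gauss_binomial_def)
  show *: "gauss_binomial q n i = 0" if "i > n" for i n using that by (simp add: gauss_binomial_def qbinom_def)
  show "gauss_binomial q (Suc n) (Suc i) = gauss_binomial q n i + q ^ Suc i * gauss_binomial q n (Suc i)"
  proof (cases "i < n")
    case True
    then obtain m where n: "n = Suc (i + m)" by (metis less_imp_Suc_add)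
    have "q ^ (Suc i * Suc m) * inverse q ^ Suc m = q ^ (i * Suc m)"
      using q by (simp add: power_add field_simps power_inverse)
    moreover have "q ^ (Suc i * Suc m) = q ^ Suc i * q ^ (Suc i * m)" by (simp flip: power_add)
    ultimately have "q ^ (Suc i * Suc m) * (inverse q ^ Suc m * u + v) =
        q ^ (i * Suc m) * u + q ^ Suc i * (q ^ (Suc i * m) * v)" for u v
      by (simp only: distrib_left mult.assoc[symmetric])
    moreover have "qbinom (inverse q) (Suc n) (Suc i) =
        inverse q ^ Suc m * qbinom (inverse q) n i + qbinom (inverse q) n (Suc i)"
      using qbinom_pascal[OF nz, of i n] n by (simp del: power_Suc)
    moreover have "Suc n - Suc i = Suc m" "n - i = Suc m" "n - Suc i = m" using n by auto
    ultimately show ?thesis unfolding gauss_binomial_def by (simp only:)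
  next
    case False
    thus ?thesis
      using qbinom_pascal[OF nz, of i n] *[of n i] *[of n "Suc i"] *[of "Suc n" "Suc i"]
      by (cases "i = n") (auto simp: gauss_binomial_def qbinom_def)
  qed
qed

text \<open>The series F(c t). As a composition it inherits compatibility with products, sums and
  inverses.\<close>

definition dilate :: "'a::field \<Rightarrow> 'a fps \<Rightarrow> 'a fps" where
  "dilate c F = F oo (fps_const c * fps_X)"

lemma dilate_nth [simp]: "fps_nth (dilate c F) n = c ^ n * fps_nth F n"
  by (simp add: dilate_def fps_compose_linear)

lemma dilate_mult: "dilate c (F * G) = dilate c F * dilate c G"
  by (simp add: dilate_def fps_compose_mult_distrib)

lemma dilate_prod: "dilate c (prod f S) = (\<Prod>l\<in>S. dilate c (f l))"
  by (simp add: dilate_def fps_compose_prod_distrib)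

lemma dilate_sum: "dilate c (sum f S) = (\<Sum>l\<in>S. dilate c (f l))"
  by (simp add: dilate_def fps_compose_sum_distrib)

lemma dilate_inverse: "fps_nth F 0 \<noteq> 0 \<Longrightarrow> dilate c (inverse F) = inverse (dilate c F)"
  by (simp add: dilate_def fps_inverse_compose)

lemma dilate_const: "dilate c (fps_const a) = fps_const a"
  by (simp add: dilate_def)

lemma dilate_dilate: "dilate c (dilate d F) = dilate (c * d) F"
  by (rule fps_ext) (simp add: power_mult_distrib)

lemma dilate_X_power: "dilate c (fps_X ^ n) = fps_const (c ^ n) * fps_X ^ n"
  by (rule fps_ext) (simp add: fps_X_power_nth)

definition zeta_series :: "rat \<Rightarrow> nat \<Rightarrow> rat fps" where
  "zeta_series q b = (\<Prod>l<b. inverse (1 - fps_const (q ^ (2 * l)) * fps_X ^ 2))"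

definition spanning_series :: "rat \<Rightarrow> nat \<Rightarrow> rat fps" where
  "spanning_series q b = Abs_fps (spanning_count q b)"

lemma dilate_zeta_factor:
  "dilate c (inverse (1 - fps_const a * fps_X ^ 2)) = inverse (1 - fps_const (a * c ^ 2) * fps_X ^ 2)"
proof -
  have "dilate c (1 - fps_const a * fps_X ^ 2) = 1 - fps_const (a * c ^ 2) * fps_X ^ 2"
    by (rule fps_ext) (auto simp: fps_X_power_nth algebra_simps)
  thus ?thesis by (simp add: dilate_inverse)
qed

text \<open>Dilation by \<open>q\<close> turns the factor for \<open>l\<close> into that for
  \<open>l + 1\<close>; only the factor for \<open>l = 0\<close>, which is 1/(1 - t^2), is then
  missing.\<close>

lemma zeta_series_Suc: "zeta_series q (Suc b) * (1 - fps_X ^ 2) = dilate q (zeta_series q b)"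
proof -
  have "dilate q (zeta_series q b) = (\<Prod>l<b. inverse (1 - fps_const (q ^ (2 * Suc l)) * fps_X ^ 2))"
  proof -
    have "q ^ (2 * l) * q ^ 2 = q ^ (2 * Suc l)" for l by (simp flip: power_add)
    thus ?thesis by (simp only: zeta_series_def dilate_prod dilate_zeta_factor)
  qed
  moreover have "zeta_series q (Suc b) = inverse (1 - fps_X ^ 2) *
      (\<Prod>l<b. inverse (1 - fps_const (q ^ (2 * Suc l)) * fps_X ^ 2))"
    unfolding zeta_series_def prod.lessThan_Suc_shift by simp
  moreover have "inverse (1 - fps_X ^ 2) * (1 - fps_X ^ 2 :: rat fps) = 1"
    by (rule inverse_mult_eq_1) simp
  ultimately show ?thesis by (simp add: mult_ac)
qed

text \<open>The assumed recurrence says that F(t) (1 - t^2) is the series for \<open>b\<close> taken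
  at q t, and 1 - t^2 can be cancelled.\<close>

lemma zeta_series_unique:
  assumes "\<And>e. fps_nth F e = q ^ e * fps_nth (zeta_series q b) e + (if e \<ge> 2 then fps_nth F (e - 2) else 0)"
  shows "F = zeta_series q (Suc b)"
proof -
  have "F * (1 - fps_X ^ 2) = dilate q (zeta_series q b)"
  proof (rule fps_ext)
    fix e
    show "fps_nth (F * (1 - fps_X ^ 2)) e = fps_nth (dilate q (zeta_series q b)) e"
      using assms[of e] by (auto simp: right_diff_distrib fps_X_power_mult_right_nth)
  qed
  hence "F * (1 - fps_X ^ 2) = zeta_series q (Suc b) * (1 - fps_X ^ 2)" by (simp add: zeta_series_Suc)
  moreover have "fps_nth (1 - fps_X ^ 2 :: rat fps) 0 = 1" by simp
  hence "(1 - fps_X ^ 2 :: rat fps) \<noteq> 0" by force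
  ultimately show ?thesis by simp
qed

context finite_quadratic_extension
begin

abbreviation "q \<equiv> (of_nat (card k) :: rat)"

lemma q_gt_1: "q > 1"
  using card_k by simp

lemma card_spanning:
  assumes "finite B"
  shows "of_nat (card (spanning B j :: ('i \<Rightarrow> 'a) set set)) = spanning_count q (card B) j"
  using assms
proof (induction B arbitrary: j rule: finite_induct)
  case empty
  show ?case
    by (cases j) (auto simp: spanning_empty spanning_count_0 spanning_count_eq_0)
next
  case (insert p B)
  \<comment> \<open>The truncated exponent 2 |B| - i agrees with the integer one whenever a spanning
    subspace of codimension \<open>i\<close> exists. Otherwise both sides are 0 by the induction
    hypothesis.\<close>
  have powi: "spanning_count q (card B) i * q ^ (c * (2 * card B - i)) =
      spanning_count q (card B) i * q powi (int c * (2 * int (card B) - int i))" for i c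
  proof (cases "(spanning B i :: ('i \<Rightarrow> 'a) set set) = {}")
    case True
    thus ?thesis by (simp flip: insert.IH)
  next
    case False
    then obtain V :: "('i \<Rightarrow> 'a) set" where "V \<in> spanning B i" by blast
    from card_spanning_member(1)[OF this] have "int (c * (2 * card B - i)) = int c * (2 * int (card B) - int i)"
      by (simp add: of_nat_diff)
    thus ?thesis by (metis power_int_of_nat)
  qed
  have "rat_of_int (int (card (spanning (insert p B) j :: ('i \<Rightarrow> 'a) set set))) =
      rat_of_int (int (card (spanning B j :: ('i \<Rightarrow> 'a) set set))
    + (if j \<ge> 1 then (int (card k) + 1) * int (card (spanning B (j - 1) :: ('i \<Rightarrow> 'a) set set))
         * int (card k) ^ (2 * card B - (j - 1)) else 0)
    + (if j \<ge> 2 then int (card (spanning B (j - 2) :: ('i \<Rightarrow> 'a) set set))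
         * (int (card k) ^ (2 * (2 * card B - (j - 2))) - int (card k) ^ (2 * card B)) else 0))"
    by (subst card_spanning_insert[OF insert.hyps]) (rule refl)
  hence "of_nat (card (spanning (insert p B) j :: ('i \<Rightarrow> 'a) set set)) =
      spanning_count q (card B) j
    + (if j \<ge> 1 then (q + 1) * (spanning_count q (card B) (j - 1) * q ^ (1 * (2 * card B - (j - 1)))) else 0)
    + (if j \<ge> 2 then spanning_count q (card B) (j - 2) * q ^ (2 * (2 * card B - (j - 2)))
         - spanning_count q (card B) (j - 2) * q ^ (2 * card B) else 0)"
    by (simp add: insert.IH right_diff_distrib mult.assoc if_distrib[of rat_of_int]
        split del: if_split cong: if_cong)
  also have "\<dots> = spanning_count q (Suc (card B)) j"
    unfolding powi spanning_count_rec[OF q_gt_1]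
    by (cases "j = 1") (auto simp: of_nat_diff right_diff_distrib mult.assoc)
  also have "Suc (card B) = card (insert p B)" using insert.hyps by simp
  finally show ?case .
qed

lemma zeta_series_sublattices:
  assumes "finite B"
  shows "Abs_fps (\<lambda>e. of_nat (card (sublattices UNIV (supported B :: ('i \<Rightarrow> 'a fps) set) (card k ^ e)))) =
    zeta_series q (card B)"
  using assms
proof (induction B rule: finite_induct)
  case empty
  have E: "supported {} = {0 :: 'i \<Rightarrow> 'a fps}" by (auto simp: supported_def fun_eq_iff)
  have "L = {0}" if "submod UNIV L" "L \<subseteq> {0}" for L :: "('i \<Rightarrow> 'a fps) set"
    using that submod_zero by blast
  hence "sublattices UNIV (supported {} :: ('i \<Rightarrow> 'a fps) set) m = (if m = 1 then {{0}} else {})" for m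
    using has_index_refl[of "{0 :: 'i \<Rightarrow> 'a fps}" m] submod_add_subgroup[OF submod_zero_set] submod_zero_set
    unfolding sublattices_def E by auto
  moreover have "card k ^ e = 1 \<longleftrightarrow> e = 0" for e using card_k by (cases e) auto
  ultimately show ?case
    by (intro fps_ext) (simp add: zeta_series_def fps_one_nth)
next
  case (insert p B)
  let ?F = "\<lambda>B. Abs_fps (\<lambda>e. rat_of_nat (card (sublattices UNIV (supported B :: ('i \<Rightarrow> 'a fps) set) (card k ^ e))))"
  have "?F (insert p B) = zeta_series q (Suc (card B))"
  proof (rule zeta_series_unique)
    fix e
    have "fps_nth (?F B) e = fps_nth (zeta_series q (card B)) e" by (simp only: insert.IH)
    thus "fps_nth (?F (insert p B)) e = q ^ e * fps_nth (zeta_series q (card B)) e +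
        (if e \<ge> 2 then fps_nth (?F (insert p B)) (e - 2) else 0)"
      by (simp add: card_sublattices_UNIV_insert[OF insert.hyps])
  qed
  thus ?case using insert.hyps by simp
qed

lemma series_sublattices_supported:
  assumes B: "finite B"
  shows "Abs_fps (\<lambda>e. of_nat (card (sublattices k (supported B :: ('i \<Rightarrow> 'a fps) set) (card k ^ e)))) =
    zeta_series q (card B) * spanning_series q (card B)"
proof (rule fps_ext)
  fix e
  have Z: "rat_of_nat (card (sublattices UNIV (supported B :: ('i \<Rightarrow> 'a fps) set) (card k ^ i))) =
      fps_nth (zeta_series q (card B)) i" for i
    using arg_cong[OF zeta_series_sublattices[OF B], of "\<lambda>F. fps_nth F i"] by simp
  show "fps_nth (Abs_fps (\<lambda>e. of_nat (card (sublattices k (supported B :: ('i \<Rightarrow> 'a fps) set) (card k ^ e))))) e =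
      fps_nth (zeta_series q (card B) * spanning_series q (card B)) e"
    by (simp add: card_sublattices_supported(2)[OF B finite_sublattices_UNIV[OF B]] Z
        card_spanning[OF B] fps_mult_nth spanning_series_def atLeast0AtMost)
qed

text \<open>The recursion F(A + p, B)(t) = F(A, B)(q t) + t F(A, B + p)(t) is solved by induction on
  \<open>A\<close> with \<open>B\<close> arbitrary. The dilation multiplies the i-th term by
  \<open>q^i\<close> and raises its inner dilation from \<open>q^(a-i)\<close> to
  \<open>q^(a+1-i)\<close>, so the coefficients obey the Pascal rule in base
  \<open>q\<close>.\<close>

lemma series_sublattices_lattice:
  fixes A B :: "'i set"
  assumes "finite A" "finite B" "A \<inter> B = {}"
  shows "Abs_fps (\<lambda>e. of_nat (card (sublattices k (mixed_lattice k A B :: ('i \<Rightarrow> 'a fps) set) (card k ^ e)))) =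
    (\<Sum>i\<le>card A. fps_const (gauss_binomial q (card A) i) * fps_X ^ i *
      dilate (q ^ (card A - i)) (zeta_series q (card B + i) * spanning_series q (card B + i)))"
  using assms
proof (induction A arbitrary: B rule: finite_induct)
  case empty
  have "dilate 1 F = F" for F :: "rat fps" by (rule fps_ext) simp
  thus ?case
    using series_sublattices_supported[OF empty.prems(1)]
    by (simp add: mixed_lattice_empty gauss_binomial_simps(1)[OF q_gt_1])
next
  case (insert p A B)
  let ?F = "\<lambda>A B. Abs_fps (\<lambda>e. rat_of_nat (card (sublattices k (mixed_lattice k A B :: ('i \<Rightarrow> 'a fps) set) (card k ^ e))))"
  define a b where "a = card A" and "b = card B"
  define G where "G i = zeta_series q i * spanning_series q i" for i
  define T where "T i = fps_X ^ i * dilate (q ^ (Suc a - i)) (G (b + i))" for i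
  let ?g = "\<lambda>a i. fps_const (gauss_binomial q a i)"
  have p: "p \<notin> A \<union> B" using insert by auto
  have "?F (insert p A) B = dilate q (?F A B) + fps_X * ?F A (insert p B)"
  proof (rule fps_ext)
    fix e
    show "fps_nth (?F (insert p A) B) e = fps_nth (dilate q (?F A B) + fps_X * ?F A (insert p B)) e"
      using insert.hyps insert.prems p
      by (cases e) (simp_all add: card_sublattices_lattice_insert)
  qed
  also have "?F A B = (\<Sum>i\<le>a. ?g a i * fps_X ^ i * dilate (q ^ (a - i)) (G (b + i)))"
    using insert.IH[of B] insert.prems by (simp add: a_def b_def G_def)
  also have "dilate q \<dots> = (\<Sum>i\<le>a. fps_const (q ^ i) * ?g a i * T i)"
    unfolding dilate_sum
  proof (rule sum.cong[OF refl])
    fix i assume "i \<in> {..a}"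
    hence "q * q ^ (a - i) = q ^ (Suc a - i)" by (simp add: Suc_diff_le)
    thus "dilate q (?g a i * fps_X ^ i * dilate (q ^ (a - i)) (G (b + i))) = fps_const (q ^ i) * ?g a i * T i"
      by (simp add: T_def dilate_mult dilate_const dilate_X_power dilate_dilate mult_ac)
  qed
  also have "?F A (insert p B) = (\<Sum>i\<le>a. ?g a i * fps_X ^ i * dilate (q ^ (a - i)) (G (Suc b + i)))"
    using insert.IH[of "insert p B"] insert.prems insert.hyps p by (simp add: a_def b_def G_def)
  also have "fps_X * \<dots> = (\<Sum>i\<le>a. ?g a i * T (Suc i))"
    by (simp add: sum_distrib_left T_def mult_ac)
  also have "(\<Sum>i\<le>a. fps_const (q ^ i) * ?g a i * T i) =
      (\<Sum>i\<le>Suc a. fps_const (q ^ i) * ?g a i * T i)"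
    using gauss_binomial_simps(2)[OF q_gt_1, of a "Suc a"] by simp
  also have "\<dots> = T 0 + (\<Sum>i\<le>a. fps_const (q ^ Suc i) * ?g a (Suc i) * T (Suc i))"
    unfolding sum.atMost_Suc_shift by (simp add: gauss_binomial_simps(1)[OF q_gt_1])
  also have "\<dots> + (\<Sum>i\<le>a. ?g a i * T (Suc i)) = T 0 + (\<Sum>i\<le>a. ?g (Suc a) (Suc i) * T (Suc i))"
    unfolding gauss_binomial_simps(3)[OF q_gt_1] add.assoc sum.distrib[symmetric]
    by (simp add: algebra_simps flip: fps_const_add fps_const_mult)
  also have "\<dots> = (\<Sum>i\<le>Suc a. ?g (Suc a) i * T i)"
    unfolding sum.atMost_Suc_shift by (simp add: gauss_binomial_simps(1)[OF q_gt_1])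
  finally show ?case
    using insert.hyps by (simp add: T_def G_def a_def b_def mult.assoc)
qed

end

section \<open>Agreement with the closed formula\<close>

lemma zeta_series_dilate:
  fixes q :: rat
  assumes "q \<noteq> 0"
  shows "dilate (inverse q ^ i) (zeta_series q i) =
    inverse (qpoch (fps_X ^ 2 * fps_const (q powi - 2)) (fps_const (q powi - 2)) i)"
proof -
  have "dilate (inverse q ^ i) (zeta_series q i) =
      (\<Prod>l<i. inverse (1 - fps_const (q ^ (2 * l) * (inverse q ^ i) ^ 2) * fps_X ^ 2))"
    by (simp add: zeta_series_def dilate_prod dilate_zeta_factor)
  \<comment> \<open>At q^(-i) t the coefficients of t^2 are q^(2l - 2i). Reversing the order of the
    factors turns them into q^(-2(l+1)), the progression of the Pochhammer symbol.\<close>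
  also have "\<dots> = (\<Prod>l<i. inverse (1 - fps_const (q ^ (2 * (i - Suc l)) * (inverse q ^ i) ^ 2) * fps_X ^ 2))"
    by (rule prod.nat_diff_reindex[symmetric])
  also have "\<dots> = (\<Prod>l<i. inverse (1 - fps_X ^ 2 * fps_const (q powi - 2) * fps_const (q powi - 2) ^ l))"
  proof (rule prod.cong[OF refl])
    fix l assume "l \<in> {..<i}"
    then obtain d where "i = Suc (l + d)" by (metis lessThan_iff less_imp_Suc_add)
    hence i: "i - Suc l = d" "i * 2 = 2 * d + 2 * Suc l" by simp_all
    have "q ^ (2 * d) * inverse q ^ (2 * d) = 1"
      using assms by (simp flip: power_mult_distrib)
    hence "q ^ (2 * (i - Suc l)) * (inverse q ^ i) ^ 2 = inverse q ^ (2 * Suc l)"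
      unfolding power_mult[symmetric] i power_add mult.assoc[symmetric] by (simp only: mult_1_left)
    also have "\<dots> = (q powi - 2) * (q powi - 2) ^ l"
      unfolding power_mult by (simp add: power_int_minus power_inverse)
    finally have "q ^ (2 * (i - Suc l)) * (inverse q ^ i) ^ 2 = (q powi - 2) * (q powi - 2) ^ l" .
    thus "inverse (1 - fps_const (q ^ (2 * (i - Suc l)) * (inverse q ^ i) ^ 2) * fps_X ^ 2) =
        inverse (1 - fps_X ^ 2 * fps_const (q powi - 2) * fps_const (q powi - 2) ^ l)"
      by (simp add: mult_ac)
  qed
  also have "\<dots> = inverse (qpoch (fps_X ^ 2 * fps_const (q powi - 2)) (fps_const (q powi - 2)) i)"
    unfolding qpoch_def by (induction i) (simp_all add: fps_inverse_mult)
  finally show ?thesis .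
qed

lemma spanning_series_dilate:
  "dilate c (spanning_series q i) = (\<Sum>j\<le>i. fps_const (spanning_count q i j * c ^ j) * fps_X ^ j)"
  by (rule fps_ext)
    (auto simp: spanning_series_def fps_sum_nth fps_X_power_nth spanning_count_eq_0
      if_distrib[of "\<lambda>x. _ * x"] sum.delta cong: if_cong)

text \<open>Extracting -1 from each numerator and \<open>q^(l+1)\<close> from each denominator
  leaves the factors of the Pochhammer symbols. The signs give (-1)^j, and the power of
  \<open>q\<close> is (j choose 2) - (j+1 choose 2) = -j.\<close>

lemma spanning_count_qpoch:
  fixes q :: rat
  assumes q: "q > 1"
  shows "spanning_count q i j = (- 1) ^ j * q powi (- int j) *
    qpoch (q powi (2 * int i)) (q powi - 2) j / qpoch (q powi - 1) (q powi - 1) j"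
proof (induction j)
  case 0
  show ?case by (simp add: spanning_count_0 qpoch_def)
next
  case (Suc j)
  have q0: "q \<noteq> 0" using q by simp
  have q1: "q * q ^ j \<noteq> 1" using one_less_power[OF q, of "Suc j"] by simp
  have x: "q powi (2 * (int i - int j)) = q powi (2 * int i) * (q powi - 2) ^ j"
  proof -
    have "q powi (2 * (int i - int j)) = q powi (2 * int i + (- 2) * int j)" by (simp add: algebra_simps)
    also have "\<dots> = q powi (2 * int i) * q powi ((- 2) * int j)"
      using q0 by (intro power_int_add) simp
    also have "q powi ((- 2) * int j) = (q powi - 2) ^ j" by (simp only: power_int_mult power_int_of_nat)
    finally show ?thesis .
  qed
  have y: "1 - q powi - 1 * (q powi - 1) ^ j = (q ^ Suc j - 1) / q ^ Suc j"
    using q0 by (simp add: power_int_minus field_simps)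
  have z: "q powi (- int (Suc j)) = q powi (- int j) / q"
  proof -
    have eq: "- int (Suc j) = - int j - 1" by simp
    show ?thesis unfolding eq using q0 by (simp add: power_int_diff)
  qed
  have nz: "qpoch (q powi - 1) (q powi - 1) j \<noteq> 0"
    using qpoch_inverse_nonzero[OF q, of j] by (simp add: power_int_minus)
  show ?case
    unfolding spanning_count_Suc Suc.IH qpoch_Suc x y z
    using q0 q1 nz by (simp add: divide_simps) (simp add: algebra_simps)
qed

text \<open>The exponent i^2 + i j + j has three sources. The factor q^(i(n-i)) of the Gaussian
  binomial and the dilation of t^i by q^(-n) leave q^(-i^2). The inner dilations combine to q^(-n)
  q^(n-i) = q^(-i), which contributes q^(-i j) to t^j. The number of spanning subspaces supplies
  q^(-j).\<close>

lemma coh_series_eq: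
  fixes q :: rat
  assumes q: "q > 1"
  shows "dilate (inverse q ^ n) (\<Sum>i\<le>n. fps_const (gauss_binomial q n i) * fps_X ^ i *
      dilate (q ^ (n - i)) (zeta_series q i * spanning_series q i)) =
    (let Q = (\<lambda>e::int. q powi e); t = (fps_X :: rat fps) in
       \<Sum>i\<le>n. \<Sum>j\<le>i.
         fps_const ((- 1) ^ j * Q (- int (i ^ 2 + i * j + j)) * qbinom (Q (- 1)) n i
                    * qpoch (Q (2 * int i)) (Q (- 2)) j / qpoch (Q (- 1)) (Q (- 1)) j)
         * t ^ (i + j) / qpoch (t ^ 2 * fps_const (Q (- 2))) (fps_const (Q (- 2))) i)"
  unfolding Let_def dilate_sum
proof (rule sum.cong[OF refl])
  fix i assume "i \<in> {..n}"
  then obtain d where n: "n = i + d" by (metis atMost_iff le_Suc_ex)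
  have q0: "q \<noteq> 0" using q by simp
  define r where "r = inverse q"
  have rq: "q ^ m * r ^ m = 1" for m using q0 by (simp add: r_def flip: power_mult_distrib)
  have powi: "q powi (- int m) = r ^ m" for m by (simp add: r_def power_int_minus power_inverse)
  define P where "P = qpoch (fps_X ^ 2 * fps_const (q powi - 2)) (fps_const (q powi - 2)) i"
  have "fps_nth (qpoch (fps_X ^ 2 * fps_const (q powi - 2)) (fps_const (q powi - 2)) l) 0 = 1" for l
    by (induction l) (simp_all add: qpoch_Suc, simp add: qpoch_def)
  hence P0: "fps_nth P 0 \<noteq> 0" by (simp add: P_def)
  have "r ^ n * q ^ (n - i) = r ^ i"
    using rq[of d] by (simp add: n power_add mult_ac)
  hence "dilate (r ^ n) (fps_const (gauss_binomial q n i) * fps_X ^ i *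
      dilate (q ^ (n - i)) (zeta_series q i * spanning_series q i)) =
    fps_const (gauss_binomial q n i) * (fps_const ((r ^ n) ^ i) * fps_X ^ i) *
      (inverse P * (\<Sum>j\<le>i. fps_const (spanning_count q i j * (r ^ i) ^ j) * fps_X ^ j))"
    by (simp only: dilate_mult dilate_const dilate_X_power dilate_dilate)
      (simp only: r_def zeta_series_dilate[OF q0] spanning_series_dilate P_def)
  also have "\<dots> = (\<Sum>j\<le>i. fps_const (gauss_binomial q n i * (r ^ n) ^ i * (spanning_count q i j * (r ^ i) ^ j))
      * fps_X ^ (i + j) / P)"
    by (simp add: fps_divide_unit[OF P0] sum_distrib_left sum_distrib_right power_add mult_ac
        flip: fps_const_mult)
  also have "\<dots> = (\<Sum>j\<le>i.
         fps_const ((- 1) ^ j * q powi (- int (i ^ 2 + i * j + j)) * qbinom (q powi (- 1)) n i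
                    * qpoch (q powi (2 * int i)) (q powi (- 2)) j / qpoch (q powi (- 1)) (q powi (- 1)) j)
         * fps_X ^ (i + j) / P)"
  proof (rule sum.cong[OF refl])
    fix j
    have "(r ^ n) ^ i = r ^ (i ^ 2) * r ^ (i * d)"
    proof -
      have "n * i = i ^ 2 + i * d" by (simp add: n power2_eq_square algebra_simps)
      thus ?thesis by (simp flip: power_mult power_add)
    qed
    hence "q ^ (i * d) * (r ^ n) ^ i = r ^ (i ^ 2)" using rq[of "i * d"] by (simp add: mult_ac)
    hence "q ^ (i * d) * (r ^ n) ^ i * ((r ^ i) ^ j * r ^ j) = r ^ (i ^ 2 + i * j + j)"
      by (simp add: power_add power_mult mult.assoc)
    moreover have "gauss_binomial q n i = q ^ (i * d) * qbinom (q powi (- 1)) n i"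
      by (simp add: gauss_binomial_def n power_int_minus)
    ultimately have "gauss_binomial q n i * (r ^ n) ^ i * (spanning_count q i j * (r ^ i) ^ j) =
        (- 1) ^ j * q powi (- int (i ^ 2 + i * j + j)) * qbinom (q powi (- 1)) n i
          * qpoch (q powi (2 * int i)) (q powi (- 2)) j / qpoch (q powi (- 1)) (q powi (- 1)) j"
      unfolding spanning_count_qpoch[OF q] powi by (simp add: mult_ac)
    thus "fps_const (gauss_binomial q n i * (r ^ n) ^ i * (spanning_count q i j * (r ^ i) ^ j)) * fps_X ^ (i + j) / P =
        fps_const ((- 1) ^ j * q powi (- int (i ^ 2 + i * j + j)) * qbinom (q powi (- 1)) n i
          * qpoch (q powi (2 * int i)) (q powi (- 2)) j / qpoch (q powi (- 1)) (q powi (- 1)) j)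
         * fps_X ^ (i + j) / P" by simp
  qed
  finally show "dilate (inverse q ^ n) (fps_const (gauss_binomial q n i) * fps_X ^ i *
      dilate (q ^ (n - i)) (zeta_series q i * spanning_series q i)) =
    (\<Sum>j\<le>i.
         fps_const ((- 1) ^ j * q powi (- int (i ^ 2 + i * j + j)) * qbinom (q powi (- 1)) n i
                    * qpoch (q powi (2 * int i)) (q powi (- 2)) j / qpoch (q powi (- 1)) (q powi (- 1)) j)
         * fps_X ^ (i + j) / qpoch (fps_X ^ 2 * fps_const (q powi - 2)) (fps_const (q powi - 2)) i)"
    by (simp only: r_def P_def)
qed

text \<open>Inverses come from finiteness: multiplication by a nonzero \<open>a\<close> is an
  injective map of \<open>k\<close> to itself, hence attains 1.\<close>

lemma finite_scalar_field_subfield: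
  fixes k :: "'a::{field,finite} set"
  assumes "subfield k (ring_on UNIV)"
  shows "finite_scalar_field k"
proof
  note kD = subfield_ring_onD[OF assms]
  show "a - b \<in> k" if "a \<in> k" "b \<in> k" for a b using kD(4)[OF that(1) kD(3)[OF that(2)]] by simp
  show "\<exists>b\<in>k. b * a = 1" if a: "a \<in> k" "a \<noteq> 0" for a
  proof -
    have "(\<lambda>b. b * a) ` k = k"
      by (rule endo_inj_surj) (use a kD(5) in \<open>auto simp: inj_on_def\<close>)
    thus ?thesis using kD(2) by (metis imageE)
  qed
qed (use subfield_ring_onD[OF assms] in auto)

theorem theorem5p3:
  fixes q n :: nat and k :: "'a::{field,finite} set"
  assumes "primepow q"
    and "card (UNIV :: 'a set) = q ^ 2"
    and "subfield k (ring_on UNIV)" and "card k = q"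
  shows "coh_zeta (R22 k) n =
    dirichlet_of_fps q
      (let Q = (\<lambda>e::int. (of_nat q :: rat) powi e); t = (fps_X :: rat fps) in
       \<Sum>i\<le>n. \<Sum>j\<le>i.
         fps_const ((- 1) ^ j * Q (- int (i ^ 2 + i * j + j)) * qbinom (Q (- 1)) n i
                    * qpoch (Q (2 * int i)) (Q (- 2)) j / qpoch (Q (- 1)) (Q (- 1)) j)
         * t ^ (i + j) / qpoch (t ^ 2 * fps_const (Q (- 2))) (fps_const (Q (- 2))) i)"
proof -
  interpret F: finite_scalar_field k by (rule finite_scalar_field_subfield[OF assms(3)])
  have q2: "q \<ge> 2" using F.card_scalars assms(4) by simp
  have "k \<noteq> UNIV"
  proof
    assume "k = UNIV"
    hence "q ^ 2 = q" using assms(2,4) by simp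
    thus False using q2 by (simp add: power2_eq_square)
  qed
  \<comment> \<open>Any element outside \<open>k\<close> serves. The map from (a, b) to a + b w is
    injective, since otherwise \<open>w\<close> would be a quotient of elements of \<open>k\<close>;
    comparison of the sizes q^2 makes it surjective.\<close>
  then obtain w where w: "w \<notin> k" by blast
  have inj: "inj_on (\<lambda>(a, b). a + b * w) (k \<times> k)"
  proof (rule inj_onI; clarify)
    fix a b c d assume *: "a \<in> k" "b \<in> k" "c \<in> k" "d \<in> k" "a + b * w = c + d * w"
    hence eq: "(d - b) * w = a - c" by (simp add: algebra_simps)
    have "d = b"
    proof (rule ccontr)
      assume "d \<noteq> b"
      then obtain e where e: "e \<in> k" "e * (d - b) = 1"
        using F.inverse_mem[OF F.diff_mem[OF *(4,2)]] by auto
      have "w = e * (d - b) * w" using e by simp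
      also have "\<dots> = e * (a - c)" using eq by (simp only: mult.assoc)
      finally show False using w F.mult_mem[OF e(1) F.diff_mem[OF *(1,3)]] by simp
    qed
    thus "a = c \<and> b = d" using eq by simp
  qed
  have "card ((\<lambda>(a, b). a + b * w) ` (k \<times> k)) = card (UNIV :: 'a set)"
    using card_image[OF inj] assms(2,4) by (simp add: card_cartesian_product power2_eq_square)
  hence surj: "(\<lambda>(a, b). a + b * w) ` (k \<times> k) = UNIV"
    by (intro card_subset_eq) auto
  interpret finite_quadratic_extension k w
  proof
    show "\<exists>a\<in>k. \<exists>b\<in>k. c = a + b * w" for c
    proof -
      have "c \<in> (\<lambda>(a, b). a + b * w) ` (k \<times> k)" using surj by simp
      thus ?thesis by auto
    qed
  qed (use assms in simp)
  let ?c = "\<lambda>m. card (sublattices k (mixed_lattice k {..<n} {} :: (nat \<Rightarrow> 'a fps) set) m)"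
  let ?Q = "of_nat q :: rat"
  let ?G = "\<Sum>i\<le>n. fps_const (gauss_binomial ?Q n i) * fps_X ^ i *
      dilate (?Q ^ (n - i)) (zeta_series ?Q i * spanning_series ?Q i)"
  have Q1: "?Q > 1" using q2 by simp
  have coh: "coh_zeta (R22 k) n m = of_nat (?c m) / of_nat m ^ n" for m
    using card_finite_index_submodules[OF assms(3) F.scalar_ring_axioms, of n m]
    by (simp add: coh_zeta_def dirichlet_shift_def quot_zeta_def)
  have series: "rat_of_nat (?c (q ^ e)) = fps_nth ?G e" for e
    using arg_cong[OF series_sublattices_lattice[of "{..<n}" "{}"], of "\<lambda>F. fps_nth F e"] assms(4)
    by simp
  have "coh_zeta (R22 k) n = dirichlet_of_fps q (dilate (inverse ?Q ^ n) ?G)"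
  proof
    fix m
    show "coh_zeta (R22 k) n m = dirichlet_of_fps q (dilate (inverse ?Q ^ n) ?G) m"
    proof (cases "\<exists>e. m = q ^ e")
      case True
      then obtain e where e: "m = q ^ e" by blast
      have "(THE e'. m = q ^ e') = e" using q2 e by (intro the_equality) (auto simp: power_inject_exp)
      hence "dirichlet_of_fps q (dilate (inverse ?Q ^ n) ?G) m = (inverse ?Q ^ n) ^ e * fps_nth ?G e"
        using True unfolding dirichlet_of_fps_def by (simp only: if_True dilate_nth)
      \<comment> \<open>The shift by n divides the coefficient at m = q^e by (q^e)^n = (q^n)^e,
        which is the dilation of the power series by q^(-n).\<close>
      also have "\<dots> = of_nat (?c m) / of_nat m ^ n"
        using q2 unfolding e series
        by (simp add: power_inverse divide_inverse mult.commute flip: power_mult)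
      finally show ?thesis using coh by simp
    next
      case False
      have "L \<notin> sublattices k (mixed_lattice k {..<n} {}) m" for L :: "(nat \<Rightarrow> 'a fps) set"
      proof
        assume "L \<in> sublattices k (mixed_lattice k {..<n} {}) m"
        hence "submod (const_in k) L" "L \<subseteq> mixed_lattice k {..<n} {}" "has_index (mixed_lattice k {..<n} {}) L m"
          by (auto simp: sublattices_def)
        from has_index_power_lattice[OF F.finite_scalar_field_axioms submod_lattice[OF F.scalar_ring_axioms] this]
        show False using False assms(4) by blast
      qed
      hence "?c m = 0" by (metis card.empty all_not_in_conv)
      thus ?thesis using False coh by (simp add: dirichlet_of_fps_def)
    qed
  qed
  thus ?thesis unfolding coh_series_eq[OF Q1] .
qed

end
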